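(* Let $f_0:[0,\infty)\to\mathbb{C}$ and let $f(x_1,x_2)=f_0(\max\{|x_1|,|x_2|\})$ satisfy $f\in C(\mathbb{R}^2)\cap L_1(\mathbb{R}^2)$, and let $f_0\in AC_{loc}(0,+\infty)$. Put $f_1'(t)=t f_0'(t)$ for $t>0$. If $$\int_0^1|f_0'(t)|\ln^2\frac{2}{t}\,dt+\int_1^\infty t^2|f_0'(t)|\,dt<\infty$$ and $$\int_0^1\frac{\omega(f_0';t)_1}{t}\ln\frac{2}{t}\,dt+\int_0^1\frac{\omega(f_1';t)_1}{t}\,dt<\infty,$$ then $f\in A(\mathbb{R}^2)$.
   Context: $AC_{loc}(0,+\infty)$ denotes functions absolutely continuous on every compact subinterval of $(0,+\infty)$. $\omega(g;h)_1$ is the modulus of continuity of $g$ in the metric of $L_1(\mathbb{R}_+)$, $\mathbb{R}_+=[0,\infty)$: $\omega(g;h)_1=\sup_{0<\delta\le h}\int_0^\infty|g(t)-g(t+\delta)|\,dt$. The Wiener algebra $A(\mathbb{R}^2)$ is the set of all functions $f$ of the form $f(x)=\int_{\mathbb{R}^2} g(y)e^{-i(x,y)}\,dy$ ($x\in\mathbb{R}^2$) with $g\in L_1(\mathbb{R}^2)$, where $(x,y)=x_1y_1+x_2y_2$. *)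

theory Defs
  imports "HOL-Analysis.Analysis"
begin

text \<open>Each \<open>k \<in> d\<close> is a compact interval with end points \<open>Inf k \<le> Sup k\<close>; the members of a
  division are finitely many and non-overlapping.\<close>

definition absolutely_continuous_fun_on :: "(real \<Rightarrow> 'a::real_normed_vector) \<Rightarrow> real set \<Rightarrow> bool"
  where "absolutely_continuous_fun_on g S \<longleftrightarrow>
    (\<forall>\<epsilon>>0. \<exists>\<delta>>0. \<forall>d t. d division_of t \<and> t \<subseteq> S \<and> (\<Sum>k\<in>d. Sup k - Inf k) < \<delta>
      \<longrightarrow> (\<Sum>k\<in>d. norm (g (Sup k) - g (Inf k))) < \<epsilon>)"

definition AC_loc_pos :: "(real \<Rightarrow> 'a::real_normed_vector) \<Rightarrow> bool"
  where "AC_loc_pos g \<longleftrightarrow> (\<forall>a b. 0 < a \<and> a \<le> b \<longrightarrow> absolutely_continuous_fun_on g {a..b})"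

text \<open>The modulus of continuity in \<open>L\<^sub>1([0,\<infinity>))\<close>, with values in \<open>[0,\<infinity>]\<close>, so that no
  integrability of \<open>g\<close> is presupposed.\<close>

definition L1_modulus :: "(real \<Rightarrow> 'a::real_normed_vector) \<Rightarrow> real \<Rightarrow> ennreal"
  where "L1_modulus g h =
    (SUP \<delta>\<in>{0<..h}. \<integral>\<^sup>+t\<in>{0..}. ennreal (norm (g t - g (t + \<delta>))) \<partial>lebesgue)"

definition wiener_algebra :: "('a::euclidean_space \<Rightarrow> complex) set"
  where "wiener_algebra =
    {f. \<exists>g. integrable lebesgue g \<and>
        (\<forall>x. f x = (\<integral>y. g y * exp (- \<i> * complex_of_real (x \<bullet> y)) \<partial>lebesgue))}"

end

theory Submission
  imports Defs "HOL-Probability.Probability"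
begin

text \<open>
  Write \<open>p\<close> for the derivative of \<open>f0\<close>. Since \<open>f0\<close> is locally absolutely continuous and \<open>f\<close> is
  integrable, \<open>f\<close> is minus the superposition, with weight \<open>p t\<close>, of the indicators of the squares
  \<open>max |x\<^sub>1| |x\<^sub>2| \<le> t\<close> (\<open>tail_max_representation\<close>). Integrating over each square shows that the Fourier
  transform of \<open>f\<close> at \<open>(a, b)\<close> is minus the integral of
  \<open>p t * (2 sin (t a) / a) * (2 sin (t b) / b)\<close>, which equals
  \<open>-2 / (a b) * (F (a - b) - F (a + b))\<close>, where \<open>F\<close> is the cosine transform of \<open>p\<close>.

  The heart of the matter is that this function of \<open>(a, b)\<close> is integrable
  (\<open>square_kernel_integrable_of_moduli\<close>). Shifting by half a period \<open>pi / u\<close> bounds \<open>F u\<close> by the \<open>L\<^sub>1\<close>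
  norm of an increment of \<open>p\<close> with step \<open>pi / u\<close> plus the mass of \<open>p\<close> on \<open>(0, pi / u]\<close>
  (\<open>trig_transform_le_shift_variation\<close>). The substitution \<open>h = pi / u\<close> then turns the hypotheses on the
  modulus of continuity into integrability of \<open>|F u| (1 + ln u) / u\<close> at infinity; the mass on the
  initial segments is controlled by the weight \<open>ln\<^sup>2 (2 / t)\<close>. This settles the part of the plane where
  \<open>|a|\<close> and \<open>|b|\<close> are both at least 1, since integrating \<open>1 / (a b)\<close> along the lines on which
  \<open>a - b\<close> or \<open>a + b\<close> is constant produces the weight \<open>ln u / u\<close>. Near the coordinate axes the factor
  \<open>1 / b\<close> must be compensated: there \<open>F (a - b) - F (a + b)\<close> is the integral of the sine transform of
  \<open>t p t\<close> over an interval of length \<open>2 b\<close>, and the same estimate with the function \<open>t p t\<close> applies,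
  without the logarithm.

  Once the Fourier transform is integrable, Fourier inversion for bounded continuous functions
  (\<open>fourier_inversion\<close>) represents \<open>f\<close> at every point. The remaining ingredient is the fundamental
  theorem of calculus for absolutely continuous functions
  (\<open>absolutely_continuous_imp_indefinite_integral\<close>, \<open>AC_loc_pos_derivative\<close>); it is derived from the
  Radon-Nikodym theorem by way of the variation function.
\<close>

section \<open>Absolutely continuous functions as indefinite integrals\<close>

text \<open>The total variation of \<open>f\<close> on an arbitrary set. The divisions need not fill \<open>S\<close>, so that
  monotonicity and superadditivity in \<open>S\<close> come for free, and values in \<open>ennreal\<close> postpone every
  finiteness question.\<close>

definition variation_on :: "(real \<Rightarrow> 'a::real_normed_vector) \<Rightarrow> real set \<Rightarrow> ennreal" where
  "variation_on f S = (SUP d\<in>{d. d division_of \<Union>d \<and> \<Union>d \<subseteq> S}. \<Sum>k\<in>d. ennreal (norm (f (Sup k) - f (Inf k))))"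

lemma variation_on_mono: "S \<subseteq> T \<Longrightarrow> variation_on f S \<le> variation_on f T"
  unfolding variation_on_def by (rule SUP_subset_mono) auto

lemma variation_on_ge:
  assumes "d division_of t" "t \<subseteq> S"
  shows "(\<Sum>k\<in>d. ennreal (norm (f (Sup k) - f (Inf k)))) \<le> variation_on f S"
proof -
  have "\<Union>d = t" using assms by auto
  then show ?thesis
    unfolding variation_on_def using assms by (intro SUP_upper) auto
qed

lemma increment_le_variation_on:
  assumes "x \<le> y" "{x..y} \<subseteq> S"
  shows "ennreal (norm (f y - f x)) \<le> variation_on f S"
proof -
  have "{{x..y}} division_of {x..y}"
    using division_of_self[of x y] assms by (simp add: cbox_interval)
  from variation_on_ge[OF this assms(2), of f] assms(1) show ?thesis by simp
qed

lemma variation_on_empty [simp]: "variation_on f {} = 0"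
proof -
  have "{d. d division_of \<Union>d \<and> \<Union>d \<subseteq> ({}::real set)} = {{}}"
    by (auto simp: division_of_def)
  then show ?thesis unfolding variation_on_def by simp
qed

text \<open>Two divisions of sets with disjoint interiors unite to a division. An interval that belongs to
  both is degenerate and contributes nothing, so the sums add up.\<close>

lemma variation_on_superadditive:
  assumes "interior S \<inter> interior T = {}"
  shows "variation_on f S + variation_on f T \<le> variation_on f (S \<union> T)"
proof -
  let ?D = "\<lambda>S. {d. d division_of \<Union>d \<and> \<Union>d \<subseteq> (S::real set)}"
  let ?s = "\<lambda>d. \<Sum>k\<in>d. ennreal (norm (f (Sup k) - f (Inf k)))"
  have ne: "?D S \<noteq> {}" for S by (auto intro!: exI[of _ "{}"])
  have main: "?s d + ?s e \<le> variation_on f (S \<union> T)" if d: "d \<in> ?D S" and e: "e \<in> ?D T" for d e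
  proof -
    have "interior (\<Union>d) \<inter> interior (\<Union>e) = {}"
      using d e assms interior_mono[of "\<Union>d" S] interior_mono[of "\<Union>e" T] by auto
    then have div: "(d \<union> e) division_of (\<Union>d \<union> \<Union>e)"
      using d e by (intro division_disjoint_union) auto
    have fin: "finite d" "finite e" using d e by auto
    have z: "ennreal (norm (f (Sup k) - f (Inf k))) = 0" if "k \<in> d \<inter> e" for k
    proof -
      from that d obtain a b where k: "k = {a..b}" "k \<noteq> {}"
        by (metis (no_types, lifting) IntD1 cbox_interval division_ofD(3,4) mem_Collect_eq)
      have "interior k \<subseteq> interior S" "interior k \<subseteq> interior T"
        using that d e by (auto intro!: interior_mono)
      then have "interior k = {}" using assms by auto
      then have "a = b" using k by (auto simp: interior_atLeastAtMost_real)
      then show ?thesis using k by simp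
    qed
    have "?s d + ?s e = ?s (d \<union> e) + ?s (d \<inter> e)"
      using fin by (rule sum.union_inter[symmetric])
    also have "?s (d \<inter> e) = 0" using z by (intro sum.neutral) auto
    finally have "?s d + ?s e = ?s (d \<union> e)" by simp
    also have "\<dots> \<le> variation_on f (S \<union> T)"
      using d e by (intro variation_on_ge[OF div]) auto
    finally show ?thesis .
  qed
  have "variation_on f S + variation_on f T = (SUP d\<in>?D S. ?s d + variation_on f T)"
    unfolding variation_on_def[of f S] by (subst ennreal_SUP_add_left[OF ne]) simp
  also have "\<dots> = (SUP d\<in>?D S. SUP e\<in>?D T. ?s d + ?s e)"
    unfolding variation_on_def[of f T] by (subst ennreal_SUP_add_right[OF ne]) simp
  also have "\<dots> \<le> variation_on f (S \<union> T)"
    using main by (intro SUP_least) auto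
  finally show ?thesis .
qed

lemma sum_variation_on_le:
  assumes "finite p" "\<And>k. k \<in> p \<Longrightarrow> \<exists>u v. k = {u..v}"
    "\<And>k l. k \<in> p \<Longrightarrow> l \<in> p \<Longrightarrow> k \<noteq> l \<Longrightarrow> interior k \<inter> interior l = {}" "closed A"
  shows "(\<Sum>k\<in>p. variation_on f (k \<inter> A)) \<le> variation_on f (\<Union>p \<inter> A)"
  using assms
proof (induction p)
  case (insert k p)
  have "interior k \<inter> interior (\<Union>p) = {}"
    using insert by (intro Int_interior_Union_intervals) auto
  then have "interior (k \<inter> A) \<inter> interior (\<Union>p \<inter> A) = {}" by auto
  from variation_on_superadditive[OF this, of f]
  have "variation_on f (k \<inter> A) + variation_on f (\<Union>p \<inter> A) \<le> variation_on f (\<Union>(insert k p) \<inter> A)"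
    by (simp add: Int_Un_distrib2)
  moreover have "(\<Sum>k\<in>p. variation_on f (k \<inter> A)) \<le> variation_on f (\<Union>p \<inter> A)"
    using insert by blast
  ultimately show ?case
    using insert(1,2) by (simp del: Union_insert) (meson add_left_mono order_trans)
qed simp

text \<open>By the triangle inequality, cutting every interval of a division at \<open>x\<close> can only increase its
  sum.\<close>

lemma variation_on_subadditive:
  assumes "x \<in> {a..b}"
  shows "variation_on f {a..b} \<le> variation_on f {a..x} + variation_on f {x..b}"
  unfolding variation_on_def[of f "{a..b}"]
proof (rule SUP_least)
  let ?g = "\<lambda>k. ennreal (norm (f (Sup k) - f (Inf k)))"
  fix d assume "d \<in> {d. d division_of \<Union>d \<and> \<Union>d \<subseteq> {a..b}}"
  then have d: "d division_of \<Union>d" "\<Union>d \<subseteq> {a..b}" by auto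
  have fin: "finite d" using d by auto
  have part: "(\<Sum>k\<in>{k\<in>d. k \<inter> {u..v} \<noteq> {}}. ?g (k \<inter> {u..v})) \<le> variation_on f {u..v}" for u v
  proof (cases "u \<le> v")
    case True
    let ?d = "{k\<in>d. k \<inter> {u..v} \<noteq> {}}"
    let ?e = "(\<lambda>k. k \<inter> {u..v}) ` ?d"
    have "{{u..v}} division_of {u..v}"
      using division_of_self[of u v] True by (simp add: cbox_interval)
    from division_inter[OF d(1) this]
    have "{k1 \<inter> k2 |k1 k2. k1 \<in> d \<and> k2 \<in> {{u..v}} \<and> k1 \<inter> k2 \<noteq> {}} division_of \<Union>d \<inter> {u..v}" .
    also have "{k1 \<inter> k2 |k1 k2. k1 \<in> d \<and> k2 \<in> {{u..v}} \<and> k1 \<inter> k2 \<noteq> {}} = ?e" by auto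
    finally have e: "?e division_of \<Union>d \<inter> {u..v}" .
    have "(\<Sum>k\<in>?d. ?g (k \<inter> {u..v})) = (\<Sum>k\<in>?e. ?g k)"
    proof (subst sum.reindex_nontrivial)
      show "finite ?d" using fin by auto
      fix k l assume kl: "k \<in> ?d" "l \<in> ?d" "k \<noteq> l" "k \<inter> {u..v} = l \<inter> {u..v}"
      then have "k \<inter> {u..v} \<in> ?e" by auto
      with e obtain r s where rs: "k \<inter> {u..v} = {r..s}" "k \<inter> {u..v} \<noteq> {}"
        by (metis (no_types, lifting) cbox_interval division_ofD(3,4))
      have "interior (k \<inter> {u..v}) \<subseteq> interior k \<inter> interior l"
        using kl by (metis Int_lower1 Int_subset_iff interior_mono)
      also have "\<dots> = {}" using d kl by auto
      finally have "r = s" using rs by (auto simp: interior_atLeastAtMost_real)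
      with rs show "?g (k \<inter> {u..v}) = 0" by simp
    qed (simp add: o_def)
    also have "\<dots> \<le> variation_on f {u..v}"
      by (rule variation_on_ge[OF e]) auto
    finally show ?thesis .
  qed simp
  let ?dl = "{k\<in>d. k \<inter> {a..x} \<noteq> {}}" and ?dr = "{k\<in>d. k \<inter> {x..b} \<noteq> {}}"
  have cut: "?g k \<le> (if k \<in> ?dl then ?g (k \<inter> {a..x}) else 0) + (if k \<in> ?dr then ?g (k \<inter> {x..b}) else 0)"
    if kd: "k \<in> d" for k
  proof -
    from d kd obtain r s where k: "k = {r..s}" "k \<noteq> {}"
      by (metis cbox_interval division_ofD(3,4))
    have rs: "r \<le> s" using k by auto
    have rs: "r \<le> s" "k \<subseteq> {a..b}" using rs d(2) kd by blast+
    have ab: "a \<le> r" "s \<le> b" using rs subsetD[OF rs(2), of r] subsetD[OF rs(2), of s] k(1) by auto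
    consider "s < x" | "x < r" | "r \<le> x" "x \<le> s" by linarith
    then show ?thesis
    proof cases
      case 1
      then have "k \<inter> {a..x} = k" "k \<inter> {x..b} = {}" using k rs ab by auto
      then show ?thesis using kd k by auto
    next
      case 2
      then have "k \<inter> {x..b} = k" "k \<inter> {a..x} = {}" using k rs ab by auto
      then show ?thesis using kd k by auto
    next
      case 3
      have "k \<inter> {a..x} = {r..x}" "k \<inter> {x..b} = {x..s}" using 3 k rs ab by auto
      moreover have "norm (f s - f r) \<le> norm (f x - f r) + norm (f s - f x)"
        using norm_triangle_ineq[of "f x - f r" "f s - f x"] by simp
      then have "ennreal (norm (f s - f r)) \<le> ennreal (norm (f x - f r)) + ennreal (norm (f s - f x))"
        by (metis ennreal_leI ennreal_plus norm_ge_zero)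
      ultimately show ?thesis using 3 kd k rs by auto
    qed
  qed
  have "(\<Sum>k\<in>d. ?g k) \<le> (\<Sum>k\<in>d. (if k \<in> ?dl then ?g (k \<inter> {a..x}) else 0) + (if k \<in> ?dr then ?g (k \<inter> {x..b}) else 0))"
    using cut by (rule sum_mono)
  also have "\<dots> = (\<Sum>k\<in>?dl. ?g (k \<inter> {a..x})) + (\<Sum>k\<in>?dr. ?g (k \<inter> {x..b}))"
  proof -
    have s: "(\<Sum>k\<in>d. if k \<in> {k\<in>d. P k} then h k else 0) = (\<Sum>k\<in>{k\<in>d. P k}. h k)" for P and h :: "real set \<Rightarrow> ennreal"
      using fin by (simp add: sum.inter_filter[symmetric])
    show ?thesis unfolding sum.distrib s ..
  qed
  also have "\<dots> \<le> variation_on f {a..x} + variation_on f {x..b}"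
    by (intro add_mono part)
  finally show "(\<Sum>k\<in>d. ?g k) \<le> variation_on f {a..x} + variation_on f {x..b}" .
qed

text \<open>Absolute continuity is uniform over all finite families of intervals of small total length,
  hence passes to the supremum over them.\<close>

lemma absolutely_continuous_variation_small:
  assumes "absolutely_continuous_fun_on f A" "e > 0"
  obtains \<delta> where "\<delta> > 0"
    "\<And>t. t \<in> lmeasurable \<Longrightarrow> t \<subseteq> A \<Longrightarrow> measure lebesgue t < \<delta> \<Longrightarrow> variation_on f t \<le> ennreal e"
proof -
  obtain \<delta> where "\<delta> > 0" and \<delta>: "\<And>d t. d division_of t \<Longrightarrow> t \<subseteq> A \<Longrightarrow> (\<Sum>k\<in>d. Sup k - Inf k) < \<delta>
      \<Longrightarrow> (\<Sum>k\<in>d. norm (f (Sup k) - f (Inf k))) < e"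
    using assms unfolding absolutely_continuous_fun_on_def by meson
  have "variation_on f t \<le> ennreal e"
    if t: "t \<in> lmeasurable" "t \<subseteq> A" "measure lebesgue t < \<delta>" for t
    unfolding variation_on_def
  proof (rule SUP_least)
    fix d assume "d \<in> {d. d division_of \<Union>d \<and> \<Union>d \<subseteq> t}"
    then have d: "d division_of \<Union>d" "\<Union>d \<subseteq> t" by auto
    have "Sup k - Inf k = measure lebesgue k" if "k \<in> d" for k
    proof -
      from d that obtain u v where "k = {u..v}" "k \<noteq> {}"
        by (metis cbox_interval division_ofD(3,4))
      then show ?thesis by auto
    qed
    then have "(\<Sum>k\<in>d. Sup k - Inf k) = measure lebesgue (\<Union>d)"
      using content_division[OF d(1)] by (simp cong: sum.cong)
    also have "\<dots> \<le> measure lebesgue t"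
      using d t by (intro measure_mono_fmeasurable) (auto intro: fmeasurableD lmeasurable_division)
    finally have "(\<Sum>k\<in>d. norm (f (Sup k) - f (Inf k))) < e"
      using \<delta>[OF d(1)] d t by auto
    then show "(\<Sum>k\<in>d. ennreal (norm (f (Sup k) - f (Inf k)))) \<le> ennreal e"
      by (simp add: sum_ennreal ennreal_leI)
  qed
  with \<open>\<delta> > 0\<close> that show ?thesis by blast
qed

lemma absolutely_continuous_variation_finite:
  assumes "absolutely_continuous_fun_on f {a..b}"
  shows "variation_on f {a..b} < \<infinity>"
proof (cases "a \<le> b")
  case True
  obtain \<delta> where \<delta>: "\<delta> > 0" "\<And>t. t \<in> lmeasurable \<Longrightarrow> t \<subseteq> {a..b} \<Longrightarrow> measure lebesgue t < \<delta> \<Longrightarrow>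
      variation_on f t \<le> ennreal 1"
    using absolutely_continuous_variation_small[OF assms zero_less_one] by blast
  have small: "variation_on f t < \<infinity>"
    if "t \<in> lmeasurable" "t \<subseteq> {a..b}" "measure lebesgue t < \<delta>" for t
    using order.strict_trans1[OF \<delta>(2)[OF that] ennreal_less_top] by simp
  have step: "variation_on f {a..x} < \<infinity>" if "x \<in> {a..b}" "x \<le> a + real n * (\<delta>/2)" for n x
    using that
  proof (induction n arbitrary: x)
    case 0
    then have "x = a" by simp
    then show ?case using small[OF lmeasurable_interval(1), of a a] \<delta>(1) True by simp
  next
    case (Suc n)
    let ?y = "max a (x - \<delta>/2)"
    have "variation_on f {a..?y} < \<infinity>"
      using Suc.prems \<delta>(1) by (intro Suc.IH) (simp_all add: algebra_simps add_divide_distrib)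
    moreover have "variation_on f {?y..x} < \<infinity>"
      using \<delta>(1) Suc.prems by (intro small) simp_all
    moreover have "variation_on f {a..x} \<le> variation_on f {a..?y} + variation_on f {?y..x}"
      using Suc.prems \<delta>(1) by (intro variation_on_subadditive) auto
    ultimately show ?case
      by (metis ennreal_add_less_top infinity_ennreal_def le_less_trans)
  qed
  obtain n where "(b - a) / (\<delta>/2) < real n" using reals_Archimedean2 by blast
  then have "b \<le> a + real n * (\<delta>/2)" using \<delta>(1) by (simp add: field_simps)
  then show ?thesis using step[of b n] True by auto
qed simp

text \<open>The Stieltjes measure of a function dominated by the variation of an absolutely continuous
  \<open>f\<close> vanishes on Lebesgue null sets, so the Radon-Nikodym theorem provides a density. The factor 2
  leaves room for the variation function minus a component of \<open>f\<close>.\<close>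

lemma variation_dominated_has_density:
  fixes F :: "real \<Rightarrow> real"
  assumes ac: "absolutely_continuous_fun_on f {a..b}" and ab: "a \<le> b"
    and mono: "\<And>x y. x \<le> y \<Longrightarrow> F x \<le> F y"
    and dom: "\<And>x y. x \<le> y \<Longrightarrow> ennreal (F y - F x) \<le> 2 * variation_on f ({x..y} \<inter> {a..b})"
  shows "\<exists>g. integrable lborel g \<and> (\<forall>x\<in>{a..b}. F x - F a = (LINT t:{a..x}|lborel. g t))"
proof -
  have cont: "continuous_on UNIV F"
    unfolding continuous_on_iff
  proof (intro ballI allI impI)
    fix x e :: real assume "e > 0"
    then have "e / 4 > 0" by simp
    from absolutely_continuous_variation_small[OF ac this] obtain \<delta> where \<delta>: "\<delta> > 0"
      "\<And>t. t \<in> lmeasurable \<Longrightarrow> t \<subseteq> {a..b} \<Longrightarrow> measure lebesgue t < \<delta> \<Longrightarrow> variation_on f t \<le> ennreal (e/4)"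
      by blast
    have incr: "F v - F u < e" if "u \<le> v" "v - u < \<delta>" for u v
    proof -
      have "measure lebesgue ({u..v} \<inter> {a..b}) \<le> measure lebesgue {u..v}"
        by (intro measure_mono_fmeasurable) auto
      then have "variation_on f ({u..v} \<inter> {a..b}) \<le> ennreal (e/4)"
        using that by (intro \<delta>(2)) (auto simp: Int_atLeastAtMost)
      then have "2 * variation_on f ({u..v} \<inter> {a..b}) \<le> 2 * ennreal (e/4)"
        by (intro mult_left_mono) auto
      also have "\<dots> = ennreal (e/2)" using \<open>e > 0\<close> by (simp flip: ennreal_mult' ennreal_numeral)
      finally have "ennreal (F v - F u) \<le> ennreal (e/2)"
        using dom[OF that(1)] by (rule order_trans[rotated])
      then show ?thesis using \<open>e > 0\<close> by (subst (asm) ennreal_le_iff) auto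
    qed
    show "\<exists>d>0. \<forall>x'\<in>UNIV. dist x' x < d \<longrightarrow> dist (F x') (F x) < e"
    proof (intro exI[of _ \<delta>] conjI ballI impI)
      fix y assume "dist y x < \<delta>"
      then show "dist (F y) (F x) < e"
        using incr[of x y] incr[of y x] mono[of x y] mono[of y x]
        by (cases "x \<le> y") (auto simp: dist_real_def)
    qed (use \<delta> in auto)
  qed
  let ?M = "interval_measure F"
  have Icc: "emeasure ?M {x..y} = ennreal (F y - F x)" if "x \<le> y" for x y
    using that mono cont by (rule emeasure_interval_measure_Icc)
  have Icc_le: "emeasure ?M {x..y} \<le> 2 * variation_on f ({x..y} \<inter> {a..b})" for x y
    using Icc[of x y] dom[of x y] by (cases "x \<le> y") auto
  have fin: "finite_measure ?M"
  proof
    have "emeasure ?M (\<Union>n. {- real n..real n}) = (SUP n. emeasure ?M {- real n..real n})"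
      by (intro SUP_emeasure_incseq[symmetric]) (auto simp: incseq_def)
    also have "\<dots> \<le> 2 * variation_on f {a..b}"
      by (intro SUP_least order_trans[OF Icc_le] mult_left_mono variation_on_mono) auto
    also have "\<dots> < \<infinity>"
      using absolutely_continuous_variation_finite[OF ac]
      by (simp add: ennreal_mult_less_top)
    also have "(\<Union>n. {- real n..real n}) = UNIV"
    proof (rule UNIV_eq_I[symmetric])
      fix x :: real
      obtain n where "\<bar>x\<bar> < real n" using reals_Archimedean2 by blast
      then show "x \<in> (\<Union>n. {- real n..real n})" by (auto intro!: exI[of _ n])
    qed
    finally show "emeasure ?M (space ?M) \<noteq> \<infinity>" by simp
  qed
  \<comment> \<open>Absolute continuity speaks of finite families only: inner regularity leaves compact null
    sets, and these are covered by finitely many intervals inside an open set of small measure.\<close>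
  have compact_null: "emeasure ?M K = 0" if K: "compact K" "K \<in> null_sets lborel" for K
  proof (rule ccontr)
    assume "emeasure ?M K \<noteq> 0"
    then obtain e' where "0 < e'" "e' < emeasure ?M K"
      using dense[of 0 "emeasure ?M K"] by (auto simp: zero_less_iff_neq_zero)
    then obtain e where e: "e > 0" "ennreal e < emeasure ?M K"
      by (cases e') (auto simp: ennreal_less_zero_iff)
    then have "e / 2 > 0" by simp
    from absolutely_continuous_variation_small[OF ac this] obtain \<delta> where \<delta>: "\<delta> > 0"
      "\<And>t. t \<in> lmeasurable \<Longrightarrow> t \<subseteq> {a..b} \<Longrightarrow> measure lebesgue t < \<delta> \<Longrightarrow> variation_on f t \<le> ennreal (e/2)"
      by blast
    have Kl: "K \<in> null_sets lebesgue" using K(2) by (simp add: null_sets_completionI)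
    obtain U where U: "open U" "K \<subseteq> U" "U - K \<in> lmeasurable" "emeasure lebesgue (U - K) < ennreal \<delta>"
      using sets_lebesgue_outer_open[of K \<delta>] Kl \<delta>(1) by blast
    have "emeasure lebesgue U = emeasure lebesgue (U - K)"
      using Kl U by (simp add: emeasure_Diff_null_set)
    with U(4) have Um: "emeasure lebesgue U < ennreal \<delta>" by simp
    then have Ul: "U \<in> lmeasurable" using U(1) less_trans[OF Um ennreal_less_top] by (intro fmeasurableI) auto
    have Ud: "measure lebesgue U < \<delta>"
      using Um Ul by (simp add: emeasure_eq_measure2 ennreal_less_iff)
    have "\<exists>u v. x \<in> {u<..<v} \<and> {u..v} \<subseteq> U" if xK: "x \<in> K" for x
    proof -
      obtain r where r: "r > 0" "cball x r \<subseteq> U"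
        using U(1) subsetD[OF U(2) xK] unfolding open_contains_cball by auto
      then have "{x - r..x + r} \<subseteq> U" by (simp only: cball_eq_atLeastAtMost)
      moreover have "x \<in> {x - r<..<x + r}" using r by simp
      ultimately show ?thesis by blast
    qed
    then have "\<forall>x\<in>K. \<exists>u v. x \<in> {u<..<v} \<and> {u..v} \<subseteq> U" by blast
    then obtain u v where uv: "\<And>x. x \<in> K \<Longrightarrow> x \<in> {u x<..<v x} \<and> {u x..v x} \<subseteq> U"
      unfolding bchoice_iff by blast
    obtain K' where K': "K' \<subseteq> K" "finite K'" "K \<subseteq> (\<Union>x\<in>K'. {u x<..<v x})"
      by (rule compactE_image[OF K(1), of K "\<lambda>x. {u x<..<v x}"]) (use uv in auto)
    let ?\<F> = "(\<lambda>x. {u x..v x}) ` K'"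
    obtain p where p: "p division_of \<Union>?\<F>"
      by (rule elementary_unions_intervals[of ?\<F>]) (use K' in \<open>auto simp: cbox_interval\<close>)
    have sub: "\<Union>p \<subseteq> U" using p uv K' by (force simp: division_ofD(6)[OF p])
    have p': "finite p" "\<And>k. k \<in> p \<Longrightarrow> \<exists>u v. k = {u..v}"
      using division_ofD(1,4)[OF p] unfolding cbox_interval by auto
    have p_borel: "k \<in> sets ?M" if "k \<in> p" for k using p'(2)[OF that] by auto
    have "K \<subseteq> \<Union>p"
      unfolding division_ofD(6)[OF p] using K'(3) by (rule order_trans) (auto intro: less_imp_le)
    have "emeasure ?M K \<le> emeasure ?M (\<Union>p)"
      using \<open>K \<subseteq> \<Union>p\<close> p' p_borel by (intro emeasure_mono sets.finite_Union) auto
    also have "\<dots> \<le> (\<Sum>k\<in>p. emeasure ?M k)"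
      using p' p_borel emeasure_subadditive_finite[of p "\<lambda>k. k" ?M] by auto
    also have "\<dots> \<le> (\<Sum>k\<in>p. 2 * variation_on f (k \<inter> {a..b}))"
      using p'(2) Icc_le by (intro sum_mono) blast
    also have "\<dots> = 2 * (\<Sum>k\<in>p. variation_on f (k \<inter> {a..b}))" by (simp add: sum_distrib_left)
    also have "\<dots> \<le> 2 * variation_on f (\<Union>p \<inter> {a..b})"
      using p' division_ofD(5)[OF p] by (intro mult_left_mono sum_variation_on_le) auto
    also have "\<dots> \<le> 2 * ennreal (e/2)"
    proof (intro mult_left_mono \<delta>(2))
      have "compact (\<Union>p \<inter> {a..b})" using p' by (intro compact_Int compact_Union) auto
      then show l: "\<Union>p \<inter> {a..b} \<in> lmeasurable" by (rule lmeasurable_compact)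
      have "measure lebesgue (\<Union>p \<inter> {a..b}) \<le> measure lebesgue U"
        using sub Ul l by (intro measure_mono_fmeasurable) auto
      then show "measure lebesgue (\<Union>p \<inter> {a..b}) < \<delta>" using Ud by simp
    qed auto
    also have "\<dots> = ennreal e" using \<open>e > 0\<close> by (simp flip: ennreal_mult' ennreal_numeral)
    finally show False using e(2) by simp
  qed
  have abs: "absolutely_continuous lborel ?M"
    unfolding absolutely_continuous_def
  proof
    fix N assume N: "N \<in> null_sets (lborel :: real measure)"
    then have Nb: "N \<in> sets borel" by auto
    have "emeasure ?M N = (SUP K\<in>{K. K \<subseteq> N \<and> compact K}. emeasure ?M K)"
      using Nb fin by (intro inner_regular) (auto simp: finite_measure.emeasure_finite)
    also have "\<dots> = (SUP K\<in>{K. K \<subseteq> N \<and> compact K}. 0)"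
      using N by (intro SUP_cong refl compact_null) (auto intro: null_sets_subset simp: borel_compact)
    also have "\<dots> = 0" by (rule antisym[OF SUP_least]) auto
    finally show "N \<in> null_sets ?M" using Nb by (intro null_setsI) auto
  qed
  obtain g where g: "g \<in> borel_measurable lborel" "AE x in lborel. RN_deriv lborel ?M x = ennreal (g x)"
    "AE x in ?M. 0 < g x" "\<And>x. 0 \<le> g x"
    using sigma_finite_measure.real_RN_deriv[OF sigma_finite_lborel fin abs] by auto
  have dens: "density lborel g = ?M"
    using sigma_finite_measure.density_RN_deriv[OF sigma_finite_lborel abs] g
    by (subst density_cong[of _ _ "RN_deriv lborel ?M"]) auto
  have int: "integrable lborel g"
  proof (rule integrableI_nonneg)
    have "(\<integral>\<^sup>+x. ennreal (g x) \<partial>lborel) = emeasure (density lborel g) UNIV"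
      using g by (simp add: emeasure_density)
    also have "\<dots> < \<infinity>" unfolding dens
      using finite_measure.emeasure_finite[OF fin] by (simp add: less_top)
    finally show "(\<integral>\<^sup>+x. ennreal (g x) \<partial>lborel) < \<infinity>" .
  qed (use g in auto)
  show ?thesis
  proof (intro exI[of _ g] conjI int ballI)
    fix x assume x: "x \<in> {a..b}"
    have "ennreal (F x - F a) = emeasure (density lborel g) {a..x}"
      unfolding dens using Icc[of a x] x by simp
    also have "\<dots> = (\<integral>\<^sup>+t. ennreal (indicator {a..x} t * g t) \<partial>lborel)"
      using g by (auto simp: emeasure_density indicator_def intro!: nn_integral_cong)
    also have "\<dots> = ennreal (LINT t:{a..x}|lborel. g t)"
      unfolding set_lebesgue_integral_def using g int
      by (subst nn_integral_eq_integral) (auto intro: integrable_mult_indicator[where 'b=real, simplified])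
    finally show "F x - F a = (LINT t:{a..x}|lborel. g t)"
      using x mono[of a x] g by (subst (asm) ennreal_inj) (auto simp: set_lebesgue_integral_def)
  qed
qed

text \<open>Jordan decomposition: with \<open>V\<close> the variation function, the functions \<open>V\<close>, \<open>V - Re f\<close> and
  \<open>V - Im f\<close> are increasing with increments at most twice those of \<open>V\<close>, so each of them has a
  density, and \<open>f\<close> is a combination of the three.\<close>

theorem absolutely_continuous_imp_indefinite_integral:
  fixes f :: "real \<Rightarrow> complex"
  assumes ac: "absolutely_continuous_fun_on f {a..b}"
  shows "\<exists>g. integrable lborel g \<and> (\<forall>x\<in>{a..b}. f x - f a = (LINT t:{a..x}|lborel. g t))"
proof (cases "a \<le> b")
  case ab: True
  define V where "V x = enn2real (variation_on f {a..min b x})" for x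
  \<comment> \<open>Clamping the argument to \<open>[a, b]\<close> extends the functions to the whole line, as a Stieltjes
    measure requires.\<close>
  define \<pi> where "\<pi> x = max a (min b x)" for x
  have fin: "variation_on f S < \<infinity>" if "S \<subseteq> {a..b}" for S
    using absolutely_continuous_variation_finite[OF ac] variation_on_mono[OF that, of f]
    by (rule le_less_trans[rotated])
  have V_enn: "ennreal (V x) = variation_on f {a..min b x}" for x
    unfolding V_def using fin[of "{a..min b x}"] by simp
  have V_nonneg: "V x \<ge> 0" for x by (simp add: V_def)
  have V_mono: "V x \<le> V y" if "x \<le> y" for x y
    unfolding V_def using that fin[of "{a..min b y}"] by (intro enn2real_mono variation_on_mono) auto
  have V_diff: "ennreal (V y - V x) \<le> variation_on f ({x..y} \<inter> {a..b})" if xy: "x \<le> y" for x y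
  proof (cases "y < a \<or> b < x")
    case True
    then have "V y = V x" using xy by (auto simp: V_def min_def)
    then show ?thesis by simp
  next
    case False
    have eq: "{x..y} \<inter> {a..b} = {max a x..min b y}" by auto
    have "variation_on f {a..min b y} \<le> variation_on f {a..max a x} + variation_on f {max a x..min b y}"
      using False xy ab by (intro variation_on_subadditive) auto
    also have "variation_on f {a..max a x} = variation_on f {a..min b x}"
    proof (cases "x < a")
      case True
      have "variation_on f {a..a} = 0"
      proof -
        have "ennreal (norm (f (Sup k) - f (Inf k))) = 0" if "d division_of \<Union>d" "\<Union>d \<subseteq> {a..a}" "k \<in> d" for d k
        proof -
          have "k = {a}" using that by auto
          then show ?thesis by simp
        qed
        then show ?thesis unfolding variation_on_def by (intro antisym SUP_least) (auto intro!: sum_nonpos)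
      qed
      with True ab show ?thesis by (simp add: max_def min_def)
    next
      case False
      with \<open>\<not> (y < a \<or> b < x)\<close> have "max a x = x" "min b x = x" by auto
      then show ?thesis by simp
    qed
    finally have "ennreal (V y) \<le> ennreal (V x) + variation_on f {max a x..min b y}"
      unfolding V_enn .
    then show ?thesis unfolding eq
      using V_nonneg by (simp add: ennreal_minus[symmetric] ennreal_minus_le_iff add.commute)
  qed
  have f_diff: "norm (f (\<pi> y) - f (\<pi> x)) \<le> V y - V x" if xy: "x \<le> y" for x y
  proof (cases "y < a \<or> b < x")
    case True
    then have "\<pi> y = \<pi> x" using xy by (auto simp: \<pi>_def min_def max_def)
    then show ?thesis using V_mono[OF xy] by simp
  next
    case False
    have "variation_on f {a..min b x} + ennreal (norm (f (\<pi> y) - f (\<pi> x)))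
      \<le> variation_on f {a..min b x} + variation_on f {\<pi> x..\<pi> y}"
      using xy by (intro add_left_mono increment_le_variation_on) (auto simp: \<pi>_def)
    also have "\<dots> \<le> variation_on f ({a..min b x} \<union> {\<pi> x..\<pi> y})"
      by (rule variation_on_superadditive) (auto simp: interior_atLeastAtMost_real \<pi>_def)
    also have "\<dots> \<le> variation_on f {a..min b y}"
      using False xy ab by (intro variation_on_mono) (auto simp: \<pi>_def)
    finally have "ennreal (V x + norm (f (\<pi> y) - f (\<pi> x))) \<le> ennreal (V y)"
      unfolding V_enn[symmetric] using V_nonneg by simp
    then show ?thesis using V_nonneg by (subst (asm) ennreal_le_iff) auto
  qed
  have dens: "\<exists>g. integrable lborel g \<and> (\<forall>x\<in>{a..b}. (V x - h (f x)) - (V a - h (f a)) = (LINT t:{a..x}|lborel. g t))"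
    if h: "\<And>u v. \<bar>h u - h v\<bar> \<le> norm (u - v)" for h :: "complex \<Rightarrow> real"
  proof -
    let ?F = "\<lambda>x. V x - h (f (\<pi> x))"
    have incr: "?F x \<le> ?F y" "?F y - ?F x \<le> 2 * (V y - V x)" if "x \<le> y" for x y
      using h[of "f (\<pi> y)" "f (\<pi> x)"] f_diff[OF that] by (auto simp: abs_le_iff)
    have "\<exists>g. integrable lborel g \<and> (\<forall>x\<in>{a..b}. ?F x - ?F a = (LINT t:{a..x}|lborel. g t))"
    proof (rule variation_dominated_has_density[OF ac ab])
      fix x y :: real assume xy: "x \<le> y"
      show "?F x \<le> ?F y" using incr(1)[OF xy] .
      have "ennreal (?F y - ?F x) \<le> ennreal (2 * (V y - V x))"
        using incr(2)[OF xy] by (rule ennreal_leI)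
      also have "\<dots> = 2 * ennreal (V y - V x)"
          using V_mono[OF xy] by (subst ennreal_mult) auto
      also have "\<dots> \<le> 2 * variation_on f ({x..y} \<inter> {a..b})"
        using V_diff[OF xy] by (rule mult_left_mono) simp
      finally show "ennreal (?F y - ?F x) \<le> 2 * variation_on f ({x..y} \<inter> {a..b})" .
    qed
    then obtain g where g: "integrable lborel g" "\<And>x. x \<in> {a..b} \<Longrightarrow> ?F x - ?F a = (LINT t:{a..x}|lborel. g t)"
      by blast
    have "\<pi> x = x" if "x \<in> {a..b}" for x using that by (auto simp: \<pi>_def)
    with g ab show ?thesis by (intro exI[of _ g]) (metis atLeastAtMost_iff order_refl)
  qed
  obtain g0 where g0: "integrable lborel g0" "\<And>x. x \<in> {a..b} \<Longrightarrow> V x - V a = (LINT t:{a..x}|lborel. g0 t)"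
    using dens[of "\<lambda>_. 0"] by auto
  obtain g1 where g1: "integrable lborel g1"
    "\<And>x. x \<in> {a..b} \<Longrightarrow> (V x - Re (f x)) - (V a - Re (f a)) = (LINT t:{a..x}|lborel. g1 t)"
    using dens[of Re] abs_Re_le_cmod by (metis minus_complex.simps(1))
  obtain g2 where g2: "integrable lborel g2"
    "\<And>x. x \<in> {a..b} \<Longrightarrow> (V x - Im (f x)) - (V a - Im (f a)) = (LINT t:{a..x}|lborel. g2 t)"
    using dens[of Im] abs_Im_le_cmod by (metis minus_complex.simps(2))
  let ?g = "\<lambda>t. complex_of_real (g0 t - g1 t) + \<i> * complex_of_real (g0 t - g2 t)"
  have si: "set_integrable lborel {a..x} g" if "integrable lborel g" for x and g :: "real \<Rightarrow> real"
    using integrable_mult_indicator[OF _ that, of "{a..x}"] by (simp add: set_integrable_def)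
  show ?thesis
  proof (intro exI[of _ ?g] conjI ballI)
    show "integrable lborel ?g" using g0(1) g1(1) g2(1) by (intro Bochner_Integration.integrable_add integrable_mult_right integrable_of_real Bochner_Integration.integrable_diff)
    fix x assume x: "x \<in> {a..b}"
    have sc: "set_integrable lborel {a..x} (\<lambda>t. complex_of_real (g t))" if "integrable lborel g" for g :: "real \<Rightarrow> real"
      using integrable_mult_indicator[OF _ integrable_of_real[OF that], of "{a..x}"] by (simp add: set_integrable_def)
    have "f x - f a = complex_of_real (Re (f x) - Re (f a)) + \<i> * complex_of_real (Im (f x) - Im (f a))"
      by (simp add: complex_eq_iff)
    also have "Re (f x) - Re (f a) = (LINT t:{a..x}|lborel. g0 t - g1 t)"
      using g0(2)[OF x] g1(2)[OF x] si[OF g0(1), of x] si[OF g1(1), of x] by (simp add: set_integral_diff)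
    also have "Im (f x) - Im (f a) = (LINT t:{a..x}|lborel. g0 t - g2 t)"
      using g0(2)[OF x] g2(2)[OF x] si[OF g0(1), of x] si[OF g2(1), of x] by (simp add: set_integral_diff)
    also have "complex_of_real (LINT t:{a..x}|lborel. g0 t - g1 t) + \<i> * complex_of_real (LINT t:{a..x}|lborel. g0 t - g2 t)
      = (LINT t:{a..x}|lborel. ?g t)"
      using sc[of "\<lambda>t. g0 t - g1 t"] sc[of "\<lambda>t. g0 t - g2 t"] g0(1) g1(1) g2(1)
      by (subst set_integral_add(2)) (simp_all add: set_integral_complex_of_real del: of_real_diff)
    finally show "f x - f a = (LINT t:{a..x}|lborel. ?g t)" .
  qed
next
  case False
  then show ?thesis by (intro exI[of _ "\<lambda>_. 0"]) auto
qed

text \<open>Lebesgue's differentiation theorem for intervals \<open>[x, x + h]\<close> gives the derivative from the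
  right; applied to the reflected function it gives the derivative from the left.\<close>

lemma indefinite_integral_ae_differentiable:
  fixes g :: "real \<Rightarrow> complex"
  assumes g: "integrable lborel g"
  shows "AE x in lborel. \<forall>F a b. a < x \<and> x < b \<and> (\<forall>y\<in>{a..b}. F y - F a = (LINT t:{a..y}|lborel. g t))
    \<longrightarrow> (F has_vector_derivative g x) (at x)"
proof -
  have si: "set_integrable lborel {u..v} g" for u v
    using integrable_mult_indicator[OF _ g, of "{u..v}"] by (simp add: set_integrable_def)
  have hk: "g integrable_on {u..v}" "(LINT t:{u..v}|lborel. g t) = integral {u..v} g" for u v
    using set_borel_integral_eq_integral[OF si] by auto
  have cb: "g integrable_on cbox u v" "(\<lambda>t. g (- t)) integrable_on cbox u v" for u v
    using hk(1)[of u v] Henstock_Kurzweil_Integration.integrable_reflect_real[THEN iffD2, OF hk(1)[of "-v" "-u"]] by (auto simp: cbox_interval)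
  obtain N1 where N1: "negligible N1" "\<And>x e. x \<notin> N1 \<Longrightarrow> 0 < e \<Longrightarrow>
      \<exists>d>0. \<forall>h. 0 < h \<and> h < d \<longrightarrow> norm (integral (cbox x (x + h *\<^sub>R One)) g /\<^sub>R h ^ DIM(real) - g x) < e"
    using integrable_ccontinuous_explicit[OF cb(1)] by blast
  obtain N2 where N2: "negligible N2" "\<And>x e. x \<notin> N2 \<Longrightarrow> 0 < e \<Longrightarrow>
      \<exists>d>0. \<forall>h. 0 < h \<and> h < d \<longrightarrow> norm (integral (cbox x (x + h *\<^sub>R One)) (\<lambda>t. g (- t)) /\<^sub>R h ^ DIM(real) - g (- x)) < e"
    using integrable_ccontinuous_explicit[OF cb(2)] by blast
  have neg: "negligible (N1 \<union> uminus ` N2)"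
    using N1(1) N2(1)
    by (intro negligible_Un negligible_differentiable_image_negligible) (auto intro!: derivative_intros)
  have der: "(F has_vector_derivative g x) (at x)"
    if x: "x \<notin> N1 \<union> uminus ` N2" and ax: "a < x" "x < b"
      and F: "\<And>y. y \<in> {a..b} \<Longrightarrow> F y - F a = (LINT t:{a..y}|lborel. g t)" for x F a b
    unfolding has_vector_derivative_def has_derivative_at_alt
  proof (intro conjI allI impI)
    fix e :: real assume e: "e > 0"
    have x2: "- x \<notin> N2" using x by force
    obtain d1 where d1: "d1 > 0" "\<And>h. 0 < h \<Longrightarrow> h < d1 \<Longrightarrow> norm (integral {x..x + h} g /\<^sub>R h - g x) < e"
      using N1(2)[of x e] x e by auto
    obtain d2 where d2: "d2 > 0"
      "\<And>h. 0 < h \<Longrightarrow> h < d2 \<Longrightarrow> norm (integral {- x..- x + h} (\<lambda>t. g (- t)) /\<^sub>R h - g x) < e"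
      using N2(2)[OF x2 e] by auto
    have add: "F z - F y = integral {y..z} g" if "a \<le> y" "y \<le> z" "z \<le> b" for y z
    proof -
      have "F z - F y = integral {a..z} g - integral {a..y} g"
        using F[of z] F[of y] that unfolding hk(2) by (simp add: algebra_simps)
      also have "\<dots> = integral {y..z} g"
        using Henstock_Kurzweil_Integration.integral_combine[OF that(1,2) hk(1)] by (simp add: algebra_simps)
      finally show ?thesis .
    qed
    have scale: "norm (I - h *\<^sub>R g x) \<le> e * h" if "h > 0" "norm (I /\<^sub>R h - g x) < e" for I h
    proof -
      have "I - h *\<^sub>R g x = h *\<^sub>R (I /\<^sub>R h - g x)" using that(1) by (simp add: scaleR_right_diff_distrib)
      then have "norm (I - h *\<^sub>R g x) = h * norm (I /\<^sub>R h - g x)" using that(1) by simp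
      then show ?thesis using that by (simp add: mult.commute)
    qed
    show "\<exists>d>0. \<forall>y. norm (y - x) < d \<longrightarrow> norm (F y - F x - (y - x) *\<^sub>R g x) \<le> e * norm (y - x)"
    proof (intro exI conjI allI impI)
      show "min (min d1 d2) (min (x - a) (b - x)) > 0" using d1 d2 ax by simp
      fix y assume y: "norm (y - x) < min (min d1 d2) (min (x - a) (b - x))"
      consider "y = x" | "y > x" | "y < x" by linarith
      then show "norm (F y - F x - (y - x) *\<^sub>R g x) \<le> e * norm (y - x)"
      proof cases
        case 2
        then show ?thesis
          using scale[of "y - x" "integral {x..y} g"] d1(2)[of "y - x"] y ax add[of x y] by simp
      next
        case 3
        have "integral {- x..- y} (\<lambda>t. g (- t)) = integral {y..x} g"
          by (rule Henstock_Kurzweil_Integration.integral_reflect_real)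
        then have "norm (integral {y..x} g - (x - y) *\<^sub>R g x) \<le> e * (x - y)"
          using scale[of "x - y" "integral {y..x} g"] d2(2)[of "x - y"] y 3 by simp
        moreover have "F y - F x - (y - x) *\<^sub>R g x = - (integral {y..x} g - (x - y) *\<^sub>R g x)"
          using add[of y x] y 3 ax by (simp add: algebra_simps)
        moreover have "norm (y - x) = x - y" using 3 by simp
        ultimately show ?thesis by (simp only: norm_minus_cancel)
      qed simp
    qed
  qed (rule bounded_linear_scaleR_left)
  have "AE x in lebesgue. x \<notin> N1 \<union> uminus ` N2"
    using neg by (intro AE_not_in) (simp add: negligible_iff_null_sets)
  then have "AE x in lborel. x \<notin> N1 \<union> uminus ` N2"
    by (simp add: AE_completion_iff)
  then show ?thesis
    by (rule AE_mp) (auto intro!: AE_I2 der)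
qed

lemma has_vector_derivative_sequential_quotient:
  fixes F :: "real \<Rightarrow> complex"
  assumes "(F has_vector_derivative D) (at x)"
  shows "(\<lambda>n. (F (x + 1 / Suc n) - F x) * of_nat (Suc n)) \<longlonglongrightarrow> D"
proof -
  have "((\<lambda>h. norm (F (x + h) - F x - h *\<^sub>R D) / norm h) \<longlongrightarrow> 0) (at 0)"
    using assms by (simp add: has_vector_derivative_def has_derivative_at)
  moreover have "filterlim (\<lambda>n. 1 / real (Suc n)) (at 0) sequentially"
    using LIMSEQ_Suc[OF lim_1_over_n] by (auto simp: filterlim_at)
  ultimately have "(\<lambda>n. norm (F (x + 1 / Suc n) - F x - (1 / Suc n) *\<^sub>R D) / norm (1 / real (Suc n))) \<longlonglongrightarrow> 0"
    by (rule filterlim_compose)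
  also have "(\<lambda>n. norm (F (x + 1 / Suc n) - F x - (1 / Suc n) *\<^sub>R D) / norm (1 / real (Suc n)))
    = (\<lambda>n. norm ((F (x + 1 / Suc n) - F x) * of_nat (Suc n) - D))"
  proof
    fix n
    have "(F (x + 1 / Suc n) - F x) * of_nat (Suc n) - D
        = of_nat (Suc n) * (F (x + 1 / Suc n) - F x - (1 / Suc n) *\<^sub>R D)"
      by (simp add: scaleR_conv_of_real field_simps del: of_nat_Suc)
    then have "norm ((F (x + 1 / Suc n) - F x) * of_nat (Suc n) - D)
        = real (Suc n) * norm (F (x + 1 / Suc n) - F x - (1 / Suc n) *\<^sub>R D)"
      by (simp only: norm_mult norm_of_nat)
    then show "norm (F (x + 1 / Suc n) - F x - (1 / Suc n) *\<^sub>R D) / norm (1 / real (Suc n))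
      = norm ((F (x + 1 / Suc n) - F x) * of_nat (Suc n) - D)"
      by (simp del: of_nat_Suc)
  qed
  finally show ?thesis by (simp add: tendsto_norm_zero_iff LIM_zero_iff)
qed

text \<open>The derivative is defined only almost everywhere and is merely Lebesgue measurable. Tonelli
  arguments on product spaces need a Borel function, which a limit of difference quotients
  provides.\<close>

lemma AC_loc_pos_derivative:
  fixes f0 :: "real \<Rightarrow> complex"
  assumes ac: "AC_loc_pos f0" and cont: "continuous_on {0..} f0"
  obtains p where "p \<in> borel_measurable borel" "\<And>t. t \<le> 0 \<Longrightarrow> p t = 0"
    "AE t in lborel. t > 0 \<longrightarrow> p t = vector_derivative f0 (at t)"
    "\<And>a b. 0 < a \<Longrightarrow> a \<le> b \<Longrightarrow> f0 b - f0 a = (LINT t:{a..b}|lborel. p t)"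
proof -
  \<comment> \<open>\<open>lim\<close> is a Borel function of its parameter also where the sequence diverges.\<close>
  define F where "F t = f0 (max 0 t)" for t
  have F_meas: "F \<in> borel_measurable borel"
    unfolding F_def by (intro borel_measurable_continuous_onI continuous_on_compose2[OF cont]) (auto intro!: continuous_intros)
  define p where "p t = (if t > 0 then lim (\<lambda>n. (F (t + 1 / Suc n) - F t) * of_nat (Suc n)) else 0)" for t
  have p_meas: "p \<in> borel_measurable borel"
    unfolding p_def using F_meas by measurable
  have p_der: "p t = D" if D: "(f0 has_vector_derivative D) (at t)" and t: "t > 0" for t D
  proof -
    have "(\<lambda>n. (f0 (t + 1 / Suc n) - f0 t) * of_nat (Suc n)) \<longlonglongrightarrow> D"
      by (rule has_vector_derivative_sequential_quotient[OF D])
    moreover have "f0 (t + 1 / Suc n) = F (t + 1 / Suc n)" "f0 t = F t" for n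
      using t by (simp_all add: F_def max_def add_nonneg_nonneg)
    ultimately show ?thesis using t by (simp add: p_def limI)
  qed
  have density: "\<exists>g. integrable lborel g \<and> (\<forall>x\<in>{a..b}. f0 x - f0 a = (LINT t:{a..x}|lborel. g t))
      \<and> (AE t in lborel. a < t \<and> t < b \<longrightarrow> (f0 has_vector_derivative g t) (at t))"
    if ab: "0 < a" "a \<le> b" for a b
  proof -
    have "absolutely_continuous_fun_on f0 {a..b}" using ac ab by (auto simp: AC_loc_pos_def)
    from absolutely_continuous_imp_indefinite_integral[OF this] obtain g where
      g: "integrable lborel g" "\<And>x. x \<in> {a..b} \<Longrightarrow> f0 x - f0 a = (LINT t:{a..x}|lborel. g t)" by blast
    have "AE t in lborel. a < t \<and> t < b \<longrightarrow> (f0 has_vector_derivative g t) (at t)"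
      using indefinite_integral_ae_differentiable[OF g(1)]
    proof (rule AE_mp, intro AE_I2 impI)
      fix t
      assume H: "\<forall>F a b. a < t \<and> t < b \<and> (\<forall>y\<in>{a..b}. F y - F a = (LINT t:{a..y}|lborel. g t))
        \<longrightarrow> (F has_vector_derivative g t) (at t)" and t: "a < t \<and> t < b"
      show "(f0 has_vector_derivative g t) (at t)"
        by (rule spec[OF spec[OF spec[OF H, of f0], of a], of b, THEN mp]) (use t g(2) in blast)
    qed
    with g show ?thesis by blast
  qed
  have ae_diff: "AE t in lborel. t > 0 \<longrightarrow> (\<exists>D. (f0 has_vector_derivative D) (at t))"
  proof -
    have "AE t in lborel. \<forall>n. 1 / real (Suc n) < t \<and> t < real (Suc n) \<longrightarrow> (\<exists>D. (f0 has_vector_derivative D) (at t))"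
      unfolding AE_all_countable
    proof
      fix n
      have "0 < 1 / real (Suc n)" "1 / real (Suc n) \<le> real (Suc n)" by (auto simp: field_simps)
      from density[OF this] obtain g where
        "AE t in lborel. 1 / real (Suc n) < t \<and> t < real (Suc n) \<longrightarrow> (f0 has_vector_derivative g t) (at t)" by blast
      then show "AE t in lborel. 1 / real (Suc n) < t \<and> t < real (Suc n) \<longrightarrow> (\<exists>D. (f0 has_vector_derivative D) (at t))"
        by (rule AE_mp) (auto intro!: AE_I2)
    qed
    then show ?thesis
    proof (rule AE_mp, intro AE_I2 impI)
      fix t :: real
      assume all: "\<forall>n. 1 / real (Suc n) < t \<and> t < real (Suc n) \<longrightarrow> (\<exists>D. (f0 has_vector_derivative D) (at t))"
        and t: "t > 0"
      obtain n where n: "max (1 / t) t < real n" using reals_Archimedean2 by blast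
      then have "1 / t < real (Suc n)" "t < real (Suc n)" by auto
      then have "1 / real (Suc n) < t \<and> t < real (Suc n)" using t by (simp add: field_simps)
      with all show "\<exists>D. (f0 has_vector_derivative D) (at t)" by blast
    qed
  qed
  have ae_eq: "AE t in lborel. t > 0 \<longrightarrow> p t = vector_derivative f0 (at t)"
    using ae_diff
  proof (rule AE_mp, intro AE_I2 impI)
    fix t :: real
    assume "t > 0 \<longrightarrow> (\<exists>D. (f0 has_vector_derivative D) (at t))" "t > 0"
    then obtain D where D: "(f0 has_vector_derivative D) (at t)" by blast
    with p_der[OF D \<open>t > 0\<close>] show "p t = vector_derivative f0 (at t)"
      by (simp add: vector_derivative_at)
  qed
  have interval: "f0 b - f0 a = (LINT t:{a..b}|lborel. p t)"
    if ab: "0 < a" "a \<le> b" for a b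
  proof -
    obtain g where g: "integrable lborel g" "\<And>x. x \<in> {a..b} \<Longrightarrow> f0 x - f0 a = (LINT t:{a..x}|lborel. g t)"
      "AE t in lborel. a < t \<and> t < b \<longrightarrow> (f0 has_vector_derivative g t) (at t)"
      using density[OF ab] by blast
    have gm: "g \<in> borel_measurable borel" using borel_measurable_integrable[OF g(1)] by simp
    have "AE t in lborel. t \<noteq> a \<and> t \<noteq> b" using AE_lborel_singleton[of a] AE_lborel_singleton[of b] by eventually_elim simp
    with g(3) have ae: "AE t in lborel. indicator {a..b} t *\<^sub>R g t = indicator {a..b} t *\<^sub>R p t"
    proof eventually_elim
      case (elim t)
      then show ?case using ab p_der[of "g t" t] by (cases "a < t \<and> t < b") (auto simp: indicator_def)
    qed
    have "(LINT t:{a..b}|lborel. g t) = (LINT t:{a..b}|lborel. p t)"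
      unfolding set_lebesgue_integral_def using gm p_meas ae by (intro integral_cong_AE) auto
    then show ?thesis using g(2)[of b] ab by auto
  qed
  have "p t = 0" if "t \<le> 0" for t using that by (simp add: p_def)
  then show thesis
    by (rule that[OF p_meas _ ae_eq]) (use interval in auto)
qed

section \<open>Fourier inversion on Euclidean spaces\<close>

text \<open>Lebesgue measure on a Euclidean space is a product measure over the standard basis, so a
  product of functions of single coordinates integrates factorwise. This serves both the Gaussian
  and the indicator of a square.\<close>

lemma lborel_prod_Basis:
  fixes h :: "'a::euclidean_space \<Rightarrow> real \<Rightarrow> complex"
  assumes h: "\<And>b. b \<in> Basis \<Longrightarrow> integrable lborel (h b)"
  shows "integrable lborel (\<lambda>x::'a. \<Prod>b\<in>Basis. h b (x \<bullet> b))"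
    and "(LINT x|lborel. (\<Prod>b\<in>Basis. h b ((x::'a) \<bullet> b))) = (\<Prod>b\<in>Basis. LINT t|lborel. h b t)"
proof -
  interpret product_sigma_finite "\<lambda>_::'a. lborel :: real measure" by standard
  have [measurable]: "h b \<in> borel_measurable borel" if "b \<in> Basis" for b
    using borel_measurable_integrable[OF h[OF that]] by simp
  have meas: "(\<lambda>x::'a. \<Prod>b\<in>Basis. h b (x \<bullet> b)) \<in> borel_measurable borel"
    by (intro borel_measurable_prod) measurable
  have map: "(\<lambda>f. \<Sum>b\<in>Basis. f b *\<^sub>R b) \<in> measurable (\<Pi>\<^sub>M b\<in>(Basis::'a set). lborel) borel"
    by measurable
  have eq: "(\<Prod>b\<in>Basis. h b ((\<Sum>c\<in>Basis. f c *\<^sub>R c) \<bullet> (b::'a))) = (\<Prod>b\<in>Basis. h b (f b))" for f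
    by (intro prod.cong) auto
  have "integrable (\<Pi>\<^sub>M b\<in>(Basis::'a set). lborel) (\<lambda>f. \<Prod>b\<in>Basis. h b (f b))"
    using h by (intro product_integrable_prod) auto
  then show "integrable lborel (\<lambda>x::'a. \<Prod>b\<in>Basis. h b (x \<bullet> b))"
    by (subst lborel_eq, subst integrable_distr_eq[OF map meas], simp only: eq)
  have "(LINT f|(\<Pi>\<^sub>M b\<in>(Basis::'a set). lborel). (\<Prod>b\<in>Basis. h b (f b))) = (\<Prod>b\<in>Basis. LINT t|lborel. h b t)"
    using h by (intro product_integral_prod) auto
  then show "(LINT x|lborel. (\<Prod>b\<in>Basis. h b ((x::'a) \<bullet> b))) = (\<Prod>b\<in>Basis. LINT t|lborel. h b t)"
    by (subst lborel_eq, subst integral_distr[OF map meas], simp only: eq)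
qed

lemma exp_inner_eq_prod:
  fixes v y :: "'a::euclidean_space"
  shows "exp (\<i> * complex_of_real (v \<bullet> y)) = (\<Prod>b\<in>Basis. exp (\<i> * complex_of_real ((v \<bullet> b) * (y \<bullet> b))))"
  by (simp add: euclidean_inner[of v y] exp_sum[symmetric] sum_distrib_left)

lemma gaussian_fourier_real:
  assumes s: "s > 0"
  shows "integrable lborel (\<lambda>t. complex_of_real (exp (- (s * t)\<^sup>2 / 2)) * exp (\<i> * complex_of_real (a * t)))"
    and "(LINT t|lborel. complex_of_real (exp (- (s * t)\<^sup>2 / 2)) * exp (\<i> * complex_of_real (a * t)))
      = complex_of_real (sqrt (2 * pi) / s * exp (- (a / s)\<^sup>2 / 2))"
proof -
  define h where "h x = complex_of_real (exp (- x\<^sup>2 / 2)) * exp (\<i> * complex_of_real (a / s * x))" for x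
  have h_eq: "h x = complex_of_real (sqrt (2 * pi)) * (std_normal_density x *\<^sub>R exp (\<i> * complex_of_real (a / s * x)))" for x
    by (simp add: h_def std_normal_density_def scaleR_conv_of_real)
  have "integrable lborel (\<lambda>x. std_normal_density x *\<^sub>R exp (\<i> * complex_of_real (a / s * x)))"
    by (rule Bochner_Integration.integrable_bound[of _ std_normal_density])
      (auto simp: norm_exp_i_times)
  then have int: "integrable lborel h" unfolding h_eq by (intro integrable_mult_right)
  have "(LINT x|lborel. std_normal_density x *\<^sub>R exp (\<i> * complex_of_real (a / s * x)))
      = char std_normal_distribution (a / s)"
    unfolding char_def by (subst integral_density) (auto simp: mult_ac)
  also have "\<dots> = complex_of_real (exp (- (a / s)\<^sup>2 / 2))"
    by (simp add: char_std_normal_distribution)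
  finally have val: "(LINT x|lborel. h x) = complex_of_real (sqrt (2 * pi) * exp (- (a / s)\<^sup>2 / 2))"
    unfolding h_eq by (subst integral_mult_right_zero) simp
  have hs: "h (0 + s * t) = complex_of_real (exp (- (s * t)\<^sup>2 / 2)) * exp (\<i> * complex_of_real (a * t))" for t
    using s by (simp add: h_def)
  show "integrable lborel (\<lambda>t. complex_of_real (exp (- (s * t)\<^sup>2 / 2)) * exp (\<i> * complex_of_real (a * t)))"
    using lborel_integrable_real_affine[OF int, of s 0] s unfolding hs by simp
  have "(LINT x|lborel. h x) = s *\<^sub>R (LINT t|lborel. h (0 + s * t))"
    using lborel_integral_real_affine[of s h 0] s by simp
  then have "(LINT t|lborel. h (0 + s * t)) = (LINT x|lborel. h x) /\<^sub>R s" using s by simp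
  then show "(LINT t|lborel. complex_of_real (exp (- (s * t)\<^sup>2 / 2)) * exp (\<i> * complex_of_real (a * t)))
      = complex_of_real (sqrt (2 * pi) / s * exp (- (a / s)\<^sup>2 / 2))"
    unfolding val hs by (simp add: scaleR_conv_of_real field_simps)
qed

lemma gaussian_fourier:
  fixes v :: "'a::euclidean_space"
  assumes s: "s > 0"
  shows "integrable lborel (\<lambda>y::'a. complex_of_real (exp (- (s * norm y)\<^sup>2 / 2)) * exp (\<i> * complex_of_real (v \<bullet> y)))"
    and "(LINT y|lborel. complex_of_real (exp (- (s * norm y)\<^sup>2 / 2)) * exp (\<i> * complex_of_real (v \<bullet> y)))
      = complex_of_real ((sqrt (2 * pi) / s) ^ DIM('a) * exp (- (norm v / s)\<^sup>2 / 2))"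
proof -
  have norm2: "(norm y)\<^sup>2 = (\<Sum>b\<in>Basis. (y \<bullet> b)\<^sup>2)" for y :: 'a
    by (subst power2_norm_eq_inner, subst euclidean_inner) (simp only: power2_eq_square)
  have gauss: "exp (- (c * norm y)\<^sup>2 / 2) = (\<Prod>b\<in>Basis. exp (- (c * (y \<bullet> b))\<^sup>2 / 2))" for c and y :: 'a
    by (simp add: power_mult_distrib norm2 exp_sum[symmetric] sum_distrib_left sum_negf sum_divide_distrib)
  have eq: "complex_of_real (exp (- (s * norm y)\<^sup>2 / 2)) * exp (\<i> * complex_of_real (v \<bullet> y)) =
     (\<Prod>b\<in>Basis. complex_of_real (exp (- (s * (y \<bullet> b))\<^sup>2 / 2)) * exp (\<i> * complex_of_real ((v \<bullet> b) * (y \<bullet> b))))" for y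
    unfolding gauss exp_inner_eq_prod by (simp only: of_real_prod prod.distrib)
  have d: "(v \<bullet> b) / s = inverse s * (v \<bullet> b)" "norm v / s = inverse s * norm v" for b
    by (simp_all add: field_simps)
  note int = gaussian_fourier_real(1)[OF s]
  show "integrable lborel (\<lambda>y::'a. complex_of_real (exp (- (s * norm y)\<^sup>2 / 2)) * exp (\<i> * complex_of_real (v \<bullet> y)))"
    unfolding eq by (rule lborel_prod_Basis(1)[OF int])
  have "(LINT y|lborel. complex_of_real (exp (- (s * norm y)\<^sup>2 / 2)) * exp (\<i> * complex_of_real (v \<bullet> y)))
     = (\<Prod>b\<in>(Basis::'a set). complex_of_real (sqrt (2 * pi) / s * exp (- (inverse s * (v \<bullet> b))\<^sup>2 / 2)))"
    unfolding eq lborel_prod_Basis(2)[OF int] gaussian_fourier_real(2)[OF s] d ..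
  also have "\<dots> = complex_of_real ((sqrt (2 * pi) / s) ^ DIM('a) * exp (- (inverse s * norm v)\<^sup>2 / 2))"
    unfolding gauss by (simp only: of_real_prod[symmetric] prod.distrib prod_constant)
  finally show "(LINT y|lborel. complex_of_real (exp (- (s * norm y)\<^sup>2 / 2)) * exp (\<i> * complex_of_real (v \<bullet> y)))
      = complex_of_real ((sqrt (2 * pi) / s) ^ DIM('a) * exp (- (norm v / s)\<^sup>2 / 2))"
    unfolding d .
qed

lemma lborel_integral_affine:
  fixes H :: "'a::euclidean_space \<Rightarrow> complex"
  assumes "H \<in> borel_measurable borel" "s > 0"
  shows "(LINT u|lborel. H u) = s ^ DIM('a) *\<^sub>R (LINT z|lborel. H (x + s *\<^sub>R z))"
proof -
  have "(LINT u|lborel. H u) = (LINT u|density (distr lborel borel (\<lambda>z. x + s *\<^sub>R z)) (\<lambda>_. \<bar>s\<bar> ^ DIM('a)). H u)"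
    using lborel_affine[of s x] assms by simp
  also have "\<dots> = (LINT u|distr lborel borel (\<lambda>z. x + s *\<^sub>R z). (\<bar>s\<bar> ^ DIM('a)) *\<^sub>R H u)"
    using assms by (intro integral_density) auto
  also have "\<dots> = (LINT z|lborel. (\<bar>s\<bar> ^ DIM('a)) *\<^sub>R H (x + s *\<^sub>R z))"
    using assms by (intro integral_distr) auto
  finally show ?thesis using assms by simp
qed

text \<open>Gaussian summability. Damping \<open>ft\<close> by \<open>exp (-s\<^sup>2 |y|\<^sup>2 / 2)\<close> turns the inversion integral into the
  average of \<open>f (x + s z)\<close> over the Gaussian weight in \<open>z\<close>. As \<open>s\<close> tends to 0, dominated convergence
  applies on both sides: by integrability of \<open>ft\<close> on one, by continuity and boundedness of \<open>f\<close> on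
  the other.\<close>

theorem fourier_inversion:
  fixes f :: "'a::euclidean_space \<Rightarrow> complex"
  assumes cont: "continuous_on UNIV f" and int: "integrable lborel f" and bdd: "\<And>x. norm (f x) \<le> B"
    and ft: "\<And>y. ft y = (LINT u|lborel. f u * exp (\<i> * complex_of_real (u \<bullet> y)))"
    and ft_int: "integrable lborel ft"
  shows "f x = (LINT y|lborel. ft y * exp (- \<i> * complex_of_real (x \<bullet> y))) / (2 * pi) ^ DIM('a)"
proof -
  define c where "c = sqrt (2 * pi) ^ DIM('a)"
  have "c * c = (sqrt (2 * pi) * sqrt (2 * pi)) ^ DIM('a)"
    unfolding c_def by (simp only: power_mult_distrib)
  then have c: "c * c = (2 * pi) ^ DIM('a)" by simp
  have [measurable]: "f \<in> borel_measurable borel" "ft \<in> borel_measurable borel"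
    using borel_measurable_integrable[OF int] borel_measurable_integrable[OF ft_int] by simp_all
  define G :: "real \<Rightarrow> 'a \<Rightarrow> complex" where "G s y = complex_of_real (exp (- (s * norm y)\<^sup>2 / 2))" for s y
  have [measurable]: "G s \<in> borel_measurable borel" for s unfolding G_def by measurable
  have G_le: "norm (G s y) \<le> 1" for s y by (simp add: G_def)
  have G_int: "integrable lborel (G s)" if "s > 0" for s
    using gaussian_fourier(1)[OF that, of "0::'a"] by (simp add: G_def[abs_def])
  have smooth: "(LINT y|lborel. ft y * exp (- \<i> * complex_of_real (x \<bullet> y)) * G s y)
     = of_real c * (LINT z|lborel. f (x + s *\<^sub>R z) * G 1 z)" if s: "s > 0" for s
  proof -
    let ?k = "\<lambda>u y. f u * (G s y * exp (\<i> * complex_of_real ((u - x) \<bullet> y)))"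
    have k_norm: "norm (?k u y) = norm (f u) * norm (G s y)" for u y
      by (simp only: norm_mult norm_exp_i_times mult_1_right)
    have k_meas: "(\<lambda>(u, y). ?k u y) \<in> borel_measurable (lborel \<Otimes>\<^sub>M lborel)"
      unfolding split_beta by measurable
    have k_int: "integrable (lborel \<Otimes>\<^sub>M lborel) (\<lambda>(u, y). ?k u y)"
    proof (rule lborel_pair.Fubini_integrable[OF k_meas])
      show "integrable lborel (\<lambda>u. LINT y|lborel. norm (case (u, y) of (u, y) \<Rightarrow> ?k u y))"
        using int by (simp add: k_norm integrable_norm)
      show "AE u in lborel. integrable lborel (\<lambda>y. case (u, y) of (u, y) \<Rightarrow> ?k u y)"
      proof (intro AE_I2)
        fix u
        have "integrable lborel (\<lambda>y. G s y * exp (\<i> * complex_of_real ((u - x) \<bullet> y)))"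
          using gaussian_fourier(1)[OF s, of "u - x"] by (simp add: G_def)
        then show "integrable lborel (\<lambda>y. case (u, y) of (u, y) \<Rightarrow> ?k u y)" by simp
      qed
    qed
    have "ft y * exp (- \<i> * complex_of_real (x \<bullet> y)) * G s y = (LINT u|lborel. ?k u y)" for y
    proof -
      have "ft y * exp (- \<i> * complex_of_real (x \<bullet> y)) * G s y
        = (LINT u|lborel. f u * exp (\<i> * complex_of_real (u \<bullet> y)) * (exp (- \<i> * complex_of_real (x \<bullet> y)) * G s y))"
        unfolding ft by (subst integral_mult_left_zero) (simp add: mult.assoc)
      also have "\<dots> = (LINT u|lborel. ?k u y)"
      proof (rule Bochner_Integration.integral_cong[OF refl])
        fix u
        have "exp (\<i> * complex_of_real ((u - x) \<bullet> y)) = exp (\<i> * complex_of_real (u \<bullet> y)) * exp (- \<i> * complex_of_real (x \<bullet> y))"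
          by (simp add: exp_add[symmetric] inner_diff_left algebra_simps)
        then show "f u * exp (\<i> * complex_of_real (u \<bullet> y)) * (exp (- \<i> * complex_of_real (x \<bullet> y)) * G s y) = ?k u y"
          by simp
      qed
      finally show ?thesis .
    qed
    then have "(LINT y|lborel. ft y * exp (- \<i> * complex_of_real (x \<bullet> y)) * G s y) = (LINT y|lborel. LINT u|lborel. ?k u y)"
      by simp
    also have "\<dots> = (LINT u|lborel. LINT y|lborel. ?k u y)"
      by (rule lborel_pair.Fubini_integral[OF k_int])
    also have "\<dots> = (LINT u|lborel. f u * complex_of_real (c / s ^ DIM('a) * exp (- (norm (u - x) / s)\<^sup>2 / 2)))"
      using gaussian_fourier(2)[OF s, where ?'a = 'a] by (simp add: G_def c_def power_divide)
    also have "\<dots> = s ^ DIM('a) *\<^sub>R (LINT z|lborel. f (x + s *\<^sub>R z) * complex_of_real (c / s ^ DIM('a) * exp (- (norm ((x + s *\<^sub>R z) - x) / s)\<^sup>2 / 2)))"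
      by (rule lborel_integral_affine[OF _ s]) measurable
    also have "\<dots> = s ^ DIM('a) *\<^sub>R (LINT z|lborel. of_real (c / s ^ DIM('a)) * (f (x + s *\<^sub>R z) * G 1 z))"
      using s by (simp add: G_def mult_ac)
    also have "\<dots> = of_real c * (LINT z|lborel. f (x + s *\<^sub>R z) * G 1 z)"
      using s by (subst integral_mult_right_zero) (simp add: scaleR_conv_of_real)
    finally show ?thesis .
  qed
  define s where "s n = 1 / real (Suc n)" for n
  have s: "s n > 0" "s \<longlonglongrightarrow> 0" for n
    using LIMSEQ_Suc[OF lim_1_over_n] by (auto simp: s_def[abs_def])
  have "(\<lambda>n. LINT y|lborel. ft y * exp (- \<i> * complex_of_real (x \<bullet> y)) * G (s n) y)
     \<longlonglongrightarrow> (LINT y|lborel. ft y * exp (- \<i> * complex_of_real (x \<bullet> y)))"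
  proof (rule integral_dominated_convergence[of _ _ _ "\<lambda>y. norm (ft y)"])
    show "AE y in lborel. (\<lambda>n. ft y * exp (- \<i> * complex_of_real (x \<bullet> y)) * G (s n) y)
      \<longlonglongrightarrow> ft y * exp (- \<i> * complex_of_real (x \<bullet> y))"
    proof (intro AE_I2)
      fix y
      have "(\<lambda>n. G (s n) y) \<longlonglongrightarrow> complex_of_real (exp (- (0 * norm y)\<^sup>2 / 2))"
        unfolding G_def by (intro tendsto_intros s(2)) auto
      then have "(\<lambda>n. ft y * exp (- \<i> * complex_of_real (x \<bullet> y)) * G (s n) y)
        \<longlonglongrightarrow> ft y * exp (- \<i> * complex_of_real (x \<bullet> y)) * complex_of_real (exp (- (0 * norm y)\<^sup>2 / 2))"
        by (intro tendsto_mult tendsto_const)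
      then show "(\<lambda>n. ft y * exp (- \<i> * complex_of_real (x \<bullet> y)) * G (s n) y)
      \<longlonglongrightarrow> ft y * exp (- \<i> * complex_of_real (x \<bullet> y))" by simp
    qed
    show "AE y in lborel. norm (ft y * exp (- \<i> * complex_of_real (x \<bullet> y)) * G (s n) y) \<le> norm (ft y)" for n
      using G_le by (intro AE_I2) (simp add: norm_mult mult_left_le)
    show "integrable lborel (\<lambda>y. norm (ft y))" using ft_int by (rule integrable_norm)
  qed measurable
  moreover have "(\<lambda>n. of_real c * (LINT z|lborel. f (x + s n *\<^sub>R z) * G 1 z)) \<longlonglongrightarrow> of_real c * (LINT z|lborel. f x * G 1 z)"
  proof (intro tendsto_mult tendsto_const integral_dominated_convergence[of _ _ _ "\<lambda>z. B * norm (G 1 z)"])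
    show "AE z in lborel. (\<lambda>n. f (x + s n *\<^sub>R z) * G 1 z) \<longlonglongrightarrow> f x * G 1 z"
    proof (intro AE_I2 tendsto_mult tendsto_const)
      fix z
      have "(\<lambda>n. x + s n *\<^sub>R z) \<longlonglongrightarrow> x + 0 *\<^sub>R z" by (intro tendsto_intros s(2))
      then show "(\<lambda>n. f (x + s n *\<^sub>R z)) \<longlonglongrightarrow> f x"
        using continuous_on_tendsto_compose[OF cont] by simp
    qed
    show "AE z in lborel. norm (f (x + s n *\<^sub>R z) * G 1 z) \<le> B * norm (G 1 z)" for n
      using bdd by (intro AE_I2) (simp add: norm_mult mult_right_mono)
    show "integrable lborel (\<lambda>z. B * norm (G 1 z))" using G_int[of 1] by (intro integrable_mult_right integrable_norm) auto
  qed measurable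
  ultimately have "(LINT y|lborel. ft y * exp (- \<i> * complex_of_real (x \<bullet> y))) = of_real c * (LINT z|lborel. f x * G 1 z)"
    using smooth[OF s(1)] by (simp add: LIMSEQ_unique)
  also have "(LINT z|lborel. f x * G 1 z) = f x * of_real c"
    using gaussian_fourier(2)[of 1 "0::'a"] by (simp add: G_def c_def)
  also have "of_real c * (f x * of_real c) = f x * of_real ((2 * pi) ^ DIM('a))"
    unfolding c[symmetric] by simp
  finally show ?thesis by simp
qed

section \<open>Decay of sine and cosine transforms\<close>

text \<open>The quantity whose supremum over \<open>0 < \<delta> \<le> h\<close> is the modulus of continuity. A single shift suffices
  for the estimates, and it depends measurably on \<open>h\<close> by Tonelli.\<close>

definition shift_variation :: "(real \<Rightarrow> complex) \<Rightarrow> real \<Rightarrow> ennreal" where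
  "shift_variation p h = (\<integral>\<^sup>+t. ennreal (norm (p t - p (t + h))) * indicator {0..} t \<partial>lborel)"

definition trig_transform :: "(real \<Rightarrow> real) \<Rightarrow> (real \<Rightarrow> complex) \<Rightarrow> real \<Rightarrow> complex" where
  "trig_transform c p u = (LINT t|lborel. p t * complex_of_real (c (t * u)))"

lemma measurable_shift_variation [measurable]:
  assumes [measurable]: "p \<in> borel_measurable borel"
  shows "shift_variation p \<in> borel_measurable borel"
  unfolding shift_variation_def by measurable

lemma measurable_trig_transform [measurable]:
  assumes [measurable]: "p \<in> borel_measurable borel" "c \<in> borel_measurable borel"
  shows "trig_transform c p \<in> borel_measurable borel"
  unfolding trig_transform_def by measurable

lemma integrable_mult_bounded:
  fixes p :: "real \<Rightarrow> complex"
  assumes "integrable lborel p" "g \<in> borel_measurable borel" "\<And>x. \<bar>g x\<bar> \<le> 1"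
  shows "integrable lborel (\<lambda>t. p t * complex_of_real (g t))"
  by (rule Bochner_Integration.integrable_bound[OF assms(1)])
    (use assms borel_measurable_integrable[OF assms(1)] in \<open>auto simp: norm_mult mult_left_le\<close>)

lemma norm_trig_transform_le:
  assumes "integrable lborel p" "\<And>x. \<bar>c x\<bar> \<le> 1"
  shows "norm (trig_transform c p u) \<le> (LINT t|lborel. norm (p t))"
  unfolding trig_transform_def using assms
  by (intro order_trans[OF integral_norm_bound] integral_mono_AE' AE_I2)
    (auto simp: norm_mult mult_left_le integrable_norm)

text \<open>Translating by half a period \<open>pi / u\<close> changes the sign of the kernel, so that twice the
  transform is the transform of the increment of \<open>p\<close>; the initial segment appears because \<open>p\<close> is
  cut off at the origin.\<close>

lemma trig_transform_le_shift_variation: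
  fixes p :: "real \<Rightarrow> complex"
  assumes int: "integrable lborel p" and p0: "\<And>t. t \<le> 0 \<Longrightarrow> p t = 0"
    and c: "c \<in> borel_measurable borel" "\<And>x. \<bar>c x\<bar> \<le> 1" "\<And>x. c (x - pi) = - c x" and u: "u > 0"
  shows "ennreal (norm (trig_transform c p u))
     \<le> shift_variation p (pi / u) + (\<integral>\<^sup>+t. ennreal (norm (p t)) * indicator {0<..pi / u} t \<partial>lborel)"
proof -
  define h where "h = pi / u"
  have h: "h > 0" using u by (simp add: h_def)
  have [measurable]: "p \<in> borel_measurable borel" using borel_measurable_integrable[OF int] by simp
  note [measurable] = c(1)
  let ?I = "trig_transform c p u"
  have int_h: "integrable lborel (\<lambda>t. p (t + h))"
    using lborel_integrable_real_affine[OF int, of 1 h] by (simp add: add.commute)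
  have "(LINT t|lborel. p t * complex_of_real (c (t * u - pi))) =
     (LINT t|lborel. p (t + h) * complex_of_real (c ((t + h) * u - pi)))"
    using lborel_integral_real_affine[of 1 "\<lambda>t. p t * complex_of_real (c (t * u - pi))" h] by (simp add: add.commute)
  also have "(\<lambda>t. (t + h) * u - pi) = (\<lambda>t. t * u)" using u by (auto simp: h_def field_simps)
  then have "(\<lambda>t. p (t + h) * complex_of_real (c ((t + h) * u - pi))) = (\<lambda>t. p (t + h) * complex_of_real (c (t * u)))"
    by metis
  also have "(LINT t|lborel. p t * complex_of_real (c (t * u - pi))) = - ?I"
    unfolding trig_transform_def c(3) by simp
  finally have shift: "(LINT t|lborel. p (t + h) * complex_of_real (c (t * u))) = - ?I" by simp
  have "(LINT t|lborel. (p t - p (t + h)) * complex_of_real (c (t * u)))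
    = (LINT t|lborel. p t * complex_of_real (c (t * u))) - (LINT t|lborel. p (t + h) * complex_of_real (c (t * u)))"
    using integrable_mult_bounded[OF int, of "\<lambda>t. c (t * u)"] integrable_mult_bounded[OF int_h, of "\<lambda>t. c (t * u)"] c(2)
    by (simp add: left_diff_distrib)
  then have two: "2 * ?I = (LINT t|lborel. (p t - p (t + h)) * complex_of_real (c (t * u)))"
    unfolding shift by (simp add: trig_transform_def)
  have "norm ?I \<le> norm (2 * ?I)" by (simp add: norm_mult)
  then have "ennreal (norm ?I) \<le> ennreal (norm (2 * ?I))" by (rule ennreal_leI)
  also have "\<dots> \<le> (\<integral>\<^sup>+t. ennreal (norm ((p t - p (t + h)) * complex_of_real (c (t * u)))) \<partial>lborel)"
    unfolding two using int int_h integrable_mult_bounded[of "\<lambda>t. p t - p (t + h)" "\<lambda>t. c (t * u)"] c(2)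
    by (intro integral_norm_bound_ennreal) auto
  also have "\<dots> \<le> (\<integral>\<^sup>+t. ennreal (norm (p t - p (t + h))) * indicator {0..} t + ennreal (norm (p (t + h))) * indicator {0<..h} (t + h) \<partial>lborel)"
  proof (intro nn_integral_mono)
    fix t
    have "norm ((p t - p (t + h)) * complex_of_real (c (t * u))) \<le> norm (p t - p (t + h))"
      using c(2) by (simp add: norm_mult mult_left_le)
    then have "ennreal (norm ((p t - p (t + h)) * complex_of_real (c (t * u)))) \<le> ennreal (norm (p t - p (t + h)))"
      by (rule ennreal_leI)
    also have "\<dots> \<le> ennreal (norm (p t - p (t + h))) * indicator {0..} t + ennreal (norm (p (t + h))) * indicator {0<..h} (t + h)"
    proof (cases "t \<ge> 0")
      case False
      then show ?thesis using p0[of t] p0[of "t + h"] by (cases "t + h > 0") (auto simp: indicator_def)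
    qed simp
    finally show "ennreal (norm ((p t - p (t + h)) * complex_of_real (c (t * u))))
       \<le> ennreal (norm (p t - p (t + h))) * indicator {0..} t + ennreal (norm (p (t + h))) * indicator {0<..h} (t + h)" .
  qed
  also have "\<dots> = shift_variation p h + (\<integral>\<^sup>+t. ennreal (norm (p (t + h))) * indicator {0<..h} (t + h) \<partial>lborel)"
    unfolding shift_variation_def by (rule nn_integral_add) measurable
  also have "(\<integral>\<^sup>+t. ennreal (norm (p (t + h))) * indicator {0<..h} (t + h) \<partial>lborel) =
     (\<integral>\<^sup>+t. ennreal (norm (p t)) * indicator {0<..h} t \<partial>lborel)"
    by (subst nn_integral_real_affine[where c=1 and t=h]) (simp_all add: add.commute)
  finally show ?thesis unfolding h_def .
qed

lemma shift_variation_finite: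
  assumes int: "integrable lborel p"
  shows "shift_variation p h < \<infinity>"
proof -
  have int_h: "integrable lborel (\<lambda>t. p (t + h))"
    using lborel_integrable_real_affine[OF int, of 1 h] by (simp add: add.commute)
  have "shift_variation p h \<le> (\<integral>\<^sup>+t. ennreal (norm (p t - p (t + h))) \<partial>lborel)"
    unfolding shift_variation_def by (intro nn_integral_mono) (auto simp: indicator_def)
  also have "\<dots> < \<infinity>"
    using Bochner_Integration.integrable_diff[OF int int_h] by (simp add: integrable_iff_bounded)
  finally show ?thesis .
qed

text \<open>The measure \<open>dh / h\<close> is invariant under \<open>h \<mapsto> pi / h\<close>.\<close>

lemma nn_integral_inversion_finite:
  fixes H :: "real \<Rightarrow> real"
  assumes [measurable]: "H \<in> borel_measurable borel"
    and H0: "\<And>h. h \<in> {0<..1} \<Longrightarrow> H h \<ge> 0"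
    and fin: "(\<integral>\<^sup>+h. ennreal (H h / h) * indicator {0<..1} h \<partial>lborel) < \<infinity>"
  shows "(\<integral>\<^sup>+u. ennreal (H (pi / u) / u) * indicator {pi..} u \<partial>lborel) < \<infinity>"
proof -
  let ?f = "\<lambda>u. H (pi / u) / u"
  let ?S = "{0<..1} :: real set"
  have S: "(\<lambda>h. pi / h) ` ?S = {pi..}"
  proof (intro equalityI subsetI)
    fix u assume "u \<in> {pi..}"
    then have "u > 0" by (auto intro: less_le_trans[OF pi_gt_zero])
    then have "u = pi / (pi / u)" "pi / u \<in> ?S" using \<open>u \<in> {pi..}\<close> by auto
    then show "u \<in> (\<lambda>h. pi / h) ` ?S" by blast
  qed (auto simp: field_simps)
  have nonneg: "?f u \<ge> 0" if "u \<in> {pi..}" for u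
  proof -
    have "u > 0" using that by (auto intro: less_le_trans[OF pi_gt_zero])
    then show ?thesis using that H0[of "pi / u"] by auto
  qed
  have "set_integrable lborel ?S (\<lambda>h. H h / h)"
    unfolding set_integrable_def
  proof (rule integrableI_nonneg)
    show "AE h in lborel. 0 \<le> indicator ?S h *\<^sub>R (H h / h)"
      using H0 by (intro AE_I2) (auto simp: indicator_def)
    have "(\<integral>\<^sup>+h. ennreal (indicator ?S h *\<^sub>R (H h / h)) \<partial>lborel) = (\<integral>\<^sup>+h. ennreal (H h / h) * indicator {0<..1} h \<partial>lborel)"
      by (intro nn_integral_cong) (auto simp: indicator_def)
    then show "(\<integral>\<^sup>+h. ennreal (indicator ?S h *\<^sub>R (H h / h)) \<partial>lborel) < \<infinity>" using fin by simp
  qed measurable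
  then have "(\<lambda>h. H h / h) absolutely_integrable_on ?S"
    unfolding set_integrable_def by (intro integrable_completion[THEN iffD2]) auto
  moreover have "H h / h = \<bar>- (pi / h\<^sup>2)\<bar> * ?f (pi / h)" if "h \<in> ?S" for h
    using that by (simp add: field_simps power2_eq_square)
  ultimately have "(\<lambda>h. \<bar>- (pi / h\<^sup>2)\<bar> * ?f (pi / h)) absolutely_integrable_on ?S"
    by (subst (asm) set_integrable_cong[OF refl refl]) auto
  moreover have der: "((\<lambda>h. pi / h) has_field_derivative - (pi / h\<^sup>2)) (at h within ?S)" if "h \<in> ?S" for h
    using that by (auto intro!: derivative_eq_intros simp: power2_eq_square)
  moreover have "inj_on (\<lambda>h. pi / h) ?S" by (auto intro!: inj_onI)
  moreover have "?S \<in> sets lebesgue" by simp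
  ultimately have "?f absolutely_integrable_on (\<lambda>h. pi / h) ` ?S"
    using has_absolute_integral_change_of_variables_1'[of ?S "\<lambda>h. pi / h" "\<lambda>h. - (pi / h\<^sup>2)" ?f
      "integral ?S (\<lambda>h. \<bar>- (pi / h\<^sup>2)\<bar> * ?f (pi / h))"] by blast
  then have "?f absolutely_integrable_on {pi..}" unfolding S .
  then have "integrable lebesgue (\<lambda>u. indicator {pi..} u *\<^sub>R ?f u)" unfolding set_integrable_def .
  then have "integrable lborel (\<lambda>u. indicator {pi..} u *\<^sub>R ?f u)"
    by (subst (asm) integrable_completion) auto
  then have "(\<integral>\<^sup>+u. ennreal (norm (indicator {pi..} u *\<^sub>R ?f u)) \<partial>lborel) < \<infinity>"
    by (simp add: integrable_iff_bounded)
  also have "(\<integral>\<^sup>+u. ennreal (norm (indicator {pi..} u *\<^sub>R ?f u)) \<partial>lborel) = (\<integral>\<^sup>+u. ennreal (?f u) * indicator {pi..} u \<partial>lborel)"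
    using nonneg by (intro nn_integral_cong) (simp add: indicator_def del: abs_divide)
  finally show ?thesis .
qed

lemma nn_integral_inverse_Icc:
  assumes "0 < a" "a \<le> b"
  shows "(\<integral>\<^sup>+u. ennreal (1 / u) * indicator {a..b} u \<partial>lborel) = ennreal (ln (b / a))"
proof -
  have "(\<integral>\<^sup>+u. ennreal (1 / u) * indicator {a..b} u \<partial>lborel) = ennreal (ln b - ln a)"
    using assms by (intro nn_integral_FTC_Icc) (auto intro!: derivative_eq_intros simp: field_simps)
  then show ?thesis using assms by (simp add: ln_div)
qed

text \<open>Insert the half-period estimate. The substitution \<open>h = pi / u\<close> turns the shift term into the
  weighted modulus integral. In the term with the initial segment, Tonelli leaves for each \<open>t\<close> the
  integral of \<open>w (pi / u) / u\<close> over \<open>pi \<le> u \<le> pi / t\<close>, which is at most \<open>w t ln (1 / t)\<close> because \<open>w\<close>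
  decreases. This is where the logarithmic weight on the derivative near 0 comes from.\<close>

lemma trig_transform_weighted_decay:
  fixes p :: "real \<Rightarrow> complex" and w :: "real \<Rightarrow> real"
  assumes int: "integrable lborel p" and p0: "\<And>t. t \<le> 0 \<Longrightarrow> p t = 0"
    and c: "c \<in> borel_measurable borel" "\<And>x. \<bar>c x\<bar> \<le> 1" "\<And>x. c (x - pi) = - c x"
    and w[measurable]: "w \<in> borel_measurable borel" and w0: "\<And>h. 0 < h \<Longrightarrow> h \<le> 1 \<Longrightarrow> w h \<ge> 0"
    and w_anti: "\<And>h k. 0 < h \<Longrightarrow> h \<le> k \<Longrightarrow> k \<le> 1 \<Longrightarrow> w k \<le> w h"
    and A1: "(\<integral>\<^sup>+h. shift_variation p h * ennreal (w h / h) * indicator {0<..1} h \<partial>lborel) < \<infinity>"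
    and A2: "(\<integral>\<^sup>+t. ennreal (norm (p t) * (w t * ln (1 / t))) * indicator {0<..1} t \<partial>lborel) < \<infinity>"
  shows "(\<integral>\<^sup>+u. ennreal (norm (trig_transform c p u)) * ennreal (w (pi / u) / u) * indicator {pi..} u \<partial>lborel) < \<infinity>"
proof -
  have [measurable]: "p \<in> borel_measurable borel" using borel_measurable_integrable[OF int] by simp
  have pi_le: "u > 0" if "u \<in> {pi..}" for u :: real
    using that by (auto intro: less_le_trans[OF pi_gt_zero])
  let ?W = "\<lambda>u. ennreal (w (pi / u) / u) * indicator {pi..} u"
  let ?P = "\<lambda>u. \<integral>\<^sup>+t. ennreal (norm (p t)) * indicator {0<..pi / u} t \<partial>lborel"
  have [measurable]: "(\<lambda>u. ?P u) \<in> borel_measurable borel"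
  proof -
    have "(\<lambda>u. \<integral>\<^sup>+t. ennreal (norm (p t)) * (if 0 < t \<and> t \<le> pi / u then 1 else 0) \<partial>lborel) \<in> borel_measurable borel"
      by measurable
    then show ?thesis by (simp add: indicator_def)
  qed
  have part1: "(\<integral>\<^sup>+u. shift_variation p (pi / u) * ?W u \<partial>lborel) < \<infinity>"
  proof -
    define H where "H h = enn2real (shift_variation p h) * w h" for h
    have sv: "shift_variation p h = ennreal (enn2real (shift_variation p h))" for h
      using shift_variation_finite[OF int, of h] by simp
    have H0: "H h \<ge> 0" if "h \<in> {0<..1}" for h using w0 that by (simp add: H_def)
    have eq: "ennreal (H h / k) = shift_variation p h * ennreal (w h / k)" if "w h \<ge> 0" "k > 0" for h k
      using that by (subst sv) (simp add: H_def ennreal_mult'[symmetric])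
    have "(\<integral>\<^sup>+h. ennreal (H h / h) * indicator {0<..1} h \<partial>lborel)
      = (\<integral>\<^sup>+h. shift_variation p h * ennreal (w h / h) * indicator {0<..1} h \<partial>lborel)"
      using w0 by (intro nn_integral_cong) (auto simp: indicator_def eq)
    then have fin: "(\<integral>\<^sup>+h. ennreal (H h / h) * indicator {0<..1} h \<partial>lborel) < \<infinity>" using A1 by simp
    have [measurable]: "H \<in> borel_measurable borel" unfolding H_def by measurable
    have "(\<integral>\<^sup>+u. shift_variation p (pi / u) * ?W u \<partial>lborel) = (\<integral>\<^sup>+u. ennreal (H (pi / u) / u) * indicator {pi..} u \<partial>lborel)"
    proof (intro nn_integral_cong)
      fix u
      show "shift_variation p (pi / u) * ?W u = ennreal (H (pi / u) / u) * indicator {pi..} u"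
      proof (cases "u \<in> {pi..}")
        case True
        then show ?thesis using pi_le[OF True] w0[of "pi / u"] by (simp add: eq)
      qed simp
    qed
    also have "\<dots> < \<infinity>" using H0 fin by (intro nn_integral_inversion_finite) auto
    finally show ?thesis .
  qed
  have part2: "(\<integral>\<^sup>+u. ?P u * ?W u \<partial>lborel) < \<infinity>"
  proof -
    have "(\<integral>\<^sup>+u. ?P u * ?W u \<partial>lborel)
      = (\<integral>\<^sup>+u. \<integral>\<^sup>+t. ennreal (norm (p t)) * (if 0 < t \<and> t \<le> pi / u then 1 else 0) * ?W u \<partial>lborel \<partial>lborel)"
      by (intro nn_integral_cong, subst nn_integral_multc[symmetric]) (auto simp: indicator_def intro!: nn_integral_cong)
    also have "\<dots> = (\<integral>\<^sup>+t. \<integral>\<^sup>+u. ennreal (norm (p t)) * (if 0 < t \<and> t \<le> pi / u then 1 else 0) * ?W u \<partial>lborel \<partial>lborel)"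
      by (rule lborel_pair.Fubini') measurable
    also have "\<dots> \<le> (\<integral>\<^sup>+t. ennreal (norm (p t) * (w t * ln (1 / t))) * indicator {0<..1} t \<partial>lborel)"
    proof (intro nn_integral_mono)
      fix t :: real
      show "(\<integral>\<^sup>+u. ennreal (norm (p t)) * (if 0 < t \<and> t \<le> pi / u then 1 else 0) * ?W u \<partial>lborel)
         \<le> ennreal (norm (p t) * (w t * ln (1 / t))) * indicator {0<..1} t"
      proof (cases "t \<in> {0<..1}")
        case True
        have "(\<integral>\<^sup>+u. ennreal (norm (p t)) * (if 0 < t \<and> t \<le> pi / u then 1 else 0) * ?W u \<partial>lborel)
          \<le> (\<integral>\<^sup>+u. ennreal (norm (p t) * w t) * (ennreal (1 / u) * indicator {pi..pi / t} u) \<partial>lborel)"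
        proof (intro nn_integral_mono)
          fix u
          show "ennreal (norm (p t)) * (if 0 < t \<and> t \<le> pi / u then 1 else 0) * ?W u
            \<le> ennreal (norm (p t) * w t) * (ennreal (1 / u) * indicator {pi..pi / t} u)"
          proof (cases "u \<in> {pi..} \<and> t \<le> pi / u")
            case u: True
            then have u0: "u > 0" using pi_le by blast
            have "pi / u \<le> 1" using u u0 by simp
            then have "w (pi / u) \<le> w t" using u True by (intro w_anti) auto
            then have "norm (p t) * (w (pi / u) / u) \<le> norm (p t) * w t * (1 / u)"
              using u0 by (simp add: divide_right_mono mult_left_mono)
            moreover have "u \<in> {pi..pi / t}" using u True u0 by (auto simp: field_simps)
            moreover have "0 \<le> w t" using w0 True by auto
            ultimately show ?thesis using u True u0
              by (simp add: ennreal_mult'[symmetric] ennreal_leI)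
          qed (auto simp: indicator_def)
        qed
        also have "\<dots> = ennreal (norm (p t) * w t) * ennreal (ln ((pi / t) / pi))"
          using True by (subst nn_integral_cmult, measurable, subst nn_integral_inverse_Icc) (auto simp: field_simps)
        also have "\<dots> = ennreal (norm (p t) * (w t * ln (1 / t)))"
          using True w0[of t] by (simp add: ennreal_mult'[symmetric] mult.assoc)
        finally show ?thesis using True by simp
      next
        case False
        have "ennreal (norm (p t)) * ((if 0 < t \<and> t \<le> pi / u then 1 else 0) * ?W u) = 0" for u
        proof (cases "u \<in> {pi..}")
          case True
          then have "pi / u \<le> 1" using pi_le by simp
          then show ?thesis using False by auto
        qed simp
        then show ?thesis by (simp only: mult.assoc nn_integral_const mult_zero_left zero_le)
      qed
    qed
    also have "\<dots> < \<infinity>" by (rule A2)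
    finally show ?thesis .
  qed
  have "(\<integral>\<^sup>+u. ennreal (norm (trig_transform c p u)) * ennreal (w (pi / u) / u) * indicator {pi..} u \<partial>lborel)
    \<le> (\<integral>\<^sup>+u. shift_variation p (pi / u) * ?W u + ?P u * ?W u \<partial>lborel)"
  proof (intro nn_integral_mono)
    fix u
    show "ennreal (norm (trig_transform c p u)) * ennreal (w (pi / u) / u) * indicator {pi..} u
      \<le> shift_variation p (pi / u) * ?W u + ?P u * ?W u"
    proof (cases "u \<in> {pi..}")
      case True
      have "ennreal (norm (trig_transform c p u)) * ?W u \<le> (shift_variation p (pi / u) + ?P u) * ?W u"
        by (intro mult_right_mono trig_transform_le_shift_variation[OF int p0 c pi_le[OF True]]) auto
      then show ?thesis by (simp only: mult.assoc distrib_right)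
    qed simp
  qed
  also have "\<dots> = (\<integral>\<^sup>+u. shift_variation p (pi / u) * ?W u \<partial>lborel) + (\<integral>\<^sup>+u. ?P u * ?W u \<partial>lborel)"
    by (rule nn_integral_add) measurable
  also have "\<dots> < \<infinity>" using part1 part2 by simp
  finally show ?thesis .
qed

section \<open>Integrability of the transform of a superposition of squares\<close>

text \<open>The Fourier transform, at \<open>(a, b)\<close>, of the superposition with weight \<open>p t\<close> of the indicators of the
  squares \<open>max |u\<^sub>1| |u\<^sub>2| \<le> t\<close>. The value at a vanishing coordinate is 0 instead of the limit; this
  affects only a null set.\<close>

definition square_kernel :: "(real \<Rightarrow> complex) \<Rightarrow> real \<Rightarrow> real \<Rightarrow> complex" where
  "square_kernel p a b = (LINT t|lborel. p t * complex_of_real ((2 * sin (t * a) / a) * (2 * sin (t * b) / b)))"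

lemma nn_integral_abs_le:
  assumes [measurable]: "h \<in> borel_measurable borel"
  shows "(\<integral>\<^sup>+x. h \<bar>x::real\<bar> \<partial>lborel) \<le> 2 * (\<integral>\<^sup>+x. h x \<partial>lborel)"
proof -
  have "(\<integral>\<^sup>+x. h \<bar>x\<bar> \<partial>lborel) \<le> (\<integral>\<^sup>+x. h x + h (- x) \<partial>lborel)"
    by (intro nn_integral_mono) (auto simp: abs_if)
  also have "\<dots> = (\<integral>\<^sup>+x. h x \<partial>lborel) + (\<integral>\<^sup>+x. h (- x) \<partial>lborel)"
    by (rule nn_integral_add) measurable
  also have "(\<integral>\<^sup>+x. h (- x) \<partial>lborel) = (\<integral>\<^sup>+x. h x \<partial>lborel)"
    using nn_integral_real_affine[of h "-1" 0] by simp
  finally show ?thesis by (simp add: mult_2)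
qed

lemma nn_integral_inverse_square:
  assumes "a > 0"
  shows "(\<integral>\<^sup>+b. ennreal (1 / b\<^sup>2) * indicator {a..} b \<partial>lborel) = ennreal (1 / a)"
proof -
  have "((\<lambda>b::real. - 1 / b) \<longlongrightarrow> 0) at_top" by real_asymp
  then have "(\<integral>\<^sup>+b. ennreal (1 / b\<^sup>2) * indicator {a..} b \<partial>lborel) = ennreal (0 - (- 1 / a))"
    using assms by (intro nn_integral_FTC_atLeast) (auto intro!: derivative_eq_intros simp: power2_eq_square)
  then show ?thesis by simp
qed

lemma integrable_indicator_Icc: "integrable lborel (indicator {x..y} :: real \<Rightarrow> real)"
  by (intro integrable_real_indicator) (auto simp: emeasure_lborel_Icc_eq)

lemma integrable_pair_mult:
  fixes f :: "'a::euclidean_space \<Rightarrow> real" and g :: "'b::euclidean_space \<Rightarrow> real"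
  assumes f: "integrable lborel f" and g: "integrable lborel g"
  shows "integrable (lborel \<Otimes>\<^sub>M lborel) (\<lambda>(x, y). f x * g y)"
proof (rule lborel_pair.Fubini_integrable)
  have [measurable]: "f \<in> borel_measurable borel" "g \<in> borel_measurable borel"
    using borel_measurable_integrable[OF f] borel_measurable_integrable[OF g] by simp_all
  show "(\<lambda>(x, y). f x * g y) \<in> borel_measurable (lborel \<Otimes>\<^sub>M lborel)"
    unfolding split_beta by measurable
  have "(LINT y|lborel. norm (case (x, y) of (x, y) \<Rightarrow> f x * g y)) = norm (f x) * (LINT y|lborel. norm (g y))" for x
    by (simp add: abs_mult)
  then show "integrable lborel (\<lambda>x. LINT y|lborel. norm (case (x, y) of (x, y) \<Rightarrow> f x * g y))"
    by (simp only:) (intro integrable_mult_left integrable_norm f)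
  show "AE x in lborel. integrable lborel (\<lambda>y. case (x, y) of (x, y) \<Rightarrow> f x * g y)"
    using g by (intro AE_I2) simp
qed

text \<open>The cosine transform has derivative minus the sine transform of \<open>t p t\<close>. This is the step at
  which the second modulus of continuity enters.\<close>

lemma trig_transform_cos_diff:
  fixes p :: "real \<Rightarrow> complex"
  assumes p: "integrable lborel p" and q: "integrable lborel (\<lambda>t. t *\<^sub>R p t)" and xy: "x \<le> y"
  shows "trig_transform cos p x - trig_transform cos p y
    = (LINT u|lborel. indicator {x..y} u *\<^sub>R trig_transform sin (\<lambda>t. t *\<^sub>R p t) u)"
proof -
  have [measurable]: "p \<in> borel_measurable borel" using borel_measurable_integrable[OF p] by simp
  let ?k = "\<lambda>t u. indicator {x..y} u *\<^sub>R (t *\<^sub>R p t * complex_of_real (sin (t * u)))"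
  have k_le: "norm (?k t u) \<le> indicator {x..y} u * norm (t *\<^sub>R p t)" for t u
    using mult_left_le[of "\<bar>sin (t * u)\<bar>" "\<bar>t\<bar> * norm (p t)"] by (auto simp: indicator_def norm_mult mult_ac)
  have k_meas: "(\<lambda>(t, u). ?k t u) \<in> borel_measurable (lborel \<Otimes>\<^sub>M lborel)"
    unfolding split_beta by measurable
  have k_int: "integrable (lborel \<Otimes>\<^sub>M lborel) (\<lambda>(t, u). ?k t u)"
  proof (rule Bochner_Integration.integrable_bound[OF _ k_meas])
    show "integrable (lborel \<Otimes>\<^sub>M lborel) (\<lambda>(t, u). norm (t *\<^sub>R p t) * (indicator {x..y} u :: real))"
      by (rule integrable_pair_mult[OF integrable_norm[OF q] integrable_indicator_Icc])
    show "AE z in lborel \<Otimes>\<^sub>M lborel. norm (case z of (t, u) \<Rightarrow> ?k t u)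
      \<le> norm (case z of (t, u) \<Rightarrow> norm (t *\<^sub>R p t) * (indicator {x..y} u :: real))"
    proof (intro AE_I2)
      fix z :: "real \<times> real"
      obtain t u where z: "z = (t, u)" by fastforce
      have "norm (?k t u) \<le> norm (norm (t *\<^sub>R p t) * (indicator {x..y} u :: real))"
        using k_le[of u t] by (simp only: real_norm_def abs_mult abs_norm_cancel abs_indicator mult.commute)
      then show "norm (case z of (t, u) \<Rightarrow> ?k t u)
        \<le> norm (case z of (t, u) \<Rightarrow> norm (t *\<^sub>R p t) * (indicator {x..y} u :: real))"
        unfolding z prod.case .
    qed
  qed
  have inner: "(LINT u|lborel. ?k t u) = p t * complex_of_real (cos (t * x)) - p t * complex_of_real (cos (t * y))" for t
  proof -
    have "has_bochner_integral lborel (\<lambda>u. (t * sin (t * u)) * indicator {x..y} u) (- cos (t * y) - (- cos (t * x)))"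
      using xy by (intro has_bochner_integral_FTC_Icc_real) (auto intro!: derivative_eq_intros continuous_intros)
    then have "(LINT u|lborel. (t * sin (t * u)) * indicator {x..y} u) = cos (t * x) - cos (t * y)"
      by (simp add: has_bochner_integral_integral_eq)
    moreover have "(LINT u|lborel. ?k t u) = (LINT u|lborel. p t * complex_of_real ((t * sin (t * u)) * indicator {x..y} u))"
      by (intro Bochner_Integration.integral_cong) (auto simp: indicator_def scaleR_conv_of_real)
    ultimately show ?thesis
      by (simp only: integral_mult_right_zero integral_complex_of_real of_real_diff right_diff_distrib)
  qed
  have "trig_transform cos p x - trig_transform cos p y
     = (LINT t|lborel. p t * complex_of_real (cos (t * x)) - p t * complex_of_real (cos (t * y)))"
    unfolding trig_transform_def
    by (subst Bochner_Integration.integral_diff) (auto intro!: integrable_mult_bounded p)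
  also have "\<dots> = (LINT t|lborel. LINT u|lborel. ?k t u)" unfolding inner ..
  also have "\<dots> = (LINT u|lborel. LINT t|lborel. ?k t u)"
    by (rule lborel_pair.Fubini_integral[OF k_int, symmetric])
  also have "\<dots> = (LINT u|lborel. indicator {x..y} u *\<^sub>R trig_transform sin (\<lambda>t. t *\<^sub>R p t) u)"
    unfolding trig_transform_def by (simp only: integral_scaleR_right)
  finally show ?thesis .
qed

lemma norm_trig_transform_cos_diff_le:
  fixes p :: "real \<Rightarrow> complex"
  assumes p: "integrable lborel p" and q: "integrable lborel (\<lambda>t. t *\<^sub>R p t)" and xy: "x \<le> y"
  shows "ennreal (norm (trig_transform cos p x - trig_transform cos p y))
    \<le> (\<integral>\<^sup>+u. ennreal (norm (trig_transform sin (\<lambda>t. t *\<^sub>R p t) u)) * (if x \<le> u \<and> u \<le> y then 1 else 0) \<partial>lborel)"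
proof -
  let ?S = "trig_transform sin (\<lambda>t. t *\<^sub>R p t)"
  have [measurable]: "p \<in> borel_measurable borel" using borel_measurable_integrable[OF p] by simp
  have "ennreal (norm (LINT u|lborel. indicator {x..y} u *\<^sub>R ?S u)) \<le> (\<integral>\<^sup>+u. ennreal (norm (indicator {x..y} u *\<^sub>R ?S u)) \<partial>lborel)"
  proof (rule integral_norm_bound_ennreal)
    show "integrable lborel (\<lambda>u. indicator {x..y} u *\<^sub>R ?S u)"
    proof (rule Bochner_Integration.integrable_bound[of _ "\<lambda>u. indicator {x..y} u * (LINT t|lborel. norm (t *\<^sub>R p t))"])
      show "AE u in lborel. norm (indicator {x..y} u *\<^sub>R ?S u) \<le> norm (indicator {x..y} u * (LINT t|lborel. norm (t *\<^sub>R p t)))"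
        using norm_trig_transform_le[OF q, of sin] by (intro AE_I2) (auto simp: indicator_def intro: order_trans[OF _ abs_ge_self])
    qed (use integrable_indicator_Icc in auto)
  qed
  also have "\<dots> = (\<integral>\<^sup>+u. ennreal (norm (?S u)) * (if x \<le> u \<and> u \<le> y then 1 else 0) \<partial>lborel)"
    by (intro nn_integral_cong) (auto simp: indicator_def)
  finally show ?thesis unfolding trig_transform_cos_diff[OF p q xy] .
qed

lemma square_kernel_eq_cos:
  fixes p :: "real \<Rightarrow> complex"
  assumes p: "integrable lborel p"
  shows "square_kernel p a b = complex_of_real (2 / (a * b)) * (trig_transform cos p (a - b) - trig_transform cos p (a + b))"
proof -
  have eq: "(2 * sin (t * a) / a) * (2 * sin (t * b) / b) = 2 / (a * b) * (cos (t * (a - b)) - cos (t * (a + b)))" for t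
    by (simp add: cos_diff cos_add distrib_left right_diff_distrib)
  have "square_kernel p a b = (LINT t|lborel. complex_of_real (2 / (a * b)) *
     (p t * complex_of_real (cos (t * (a - b))) - p t * complex_of_real (cos (t * (a + b)))))"
    unfolding square_kernel_def eq by (intro Bochner_Integration.integral_cong) (auto simp: algebra_simps)
  also have "\<dots> = complex_of_real (2 / (a * b)) * (trig_transform cos p (a - b) - trig_transform cos p (a + b))"
    unfolding trig_transform_def
    by (subst integral_mult_right_zero, subst Bochner_Integration.integral_diff) (auto intro!: integrable_mult_bounded p)
  finally show ?thesis .
qed

lemma norm_square_kernel_le:
  fixes p :: "real \<Rightarrow> complex"
  assumes p2: "integrable lborel (\<lambda>t. t\<^sup>2 *\<^sub>R p t)"
  shows "norm (square_kernel p a b) \<le> 4 * (LINT t|lborel. norm (t\<^sup>2 *\<^sub>R p t))"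
proof -
  have sin_le: "\<bar>2 * sin (t * c) / c\<bar> \<le> 2 * \<bar>t\<bar>" for t c :: real
    using abs_sin_x_le_abs_x[of "t * c"] by (cases "c = 0") (auto simp: abs_mult field_simps)
  have le: "norm (p t * complex_of_real ((2 * sin (t * a) / a) * (2 * sin (t * b) / b))) \<le> 4 * norm (t\<^sup>2 *\<^sub>R p t)" for t
  proof -
    have "\<bar>(2 * sin (t * a) / a) * (2 * sin (t * b) / b)\<bar> \<le> (2 * \<bar>t\<bar>) * (2 * \<bar>t\<bar>)"
      unfolding abs_mult[of "2 * sin (t * a) / a"] by (intro mult_mono sin_le) auto
    also have "\<dots> = 4 * t\<^sup>2" by (simp add: power2_eq_square)
    finally have "norm (p t) * \<bar>(2 * sin (t * a) / a) * (2 * sin (t * b) / b)\<bar> \<le> norm (p t) * (4 * t\<^sup>2)"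
      by (rule mult_left_mono) simp
    then show ?thesis by (simp only: norm_mult norm_of_real norm_scaleR abs_power2) (simp add: mult_ac)
  qed
  have "norm (square_kernel p a b) \<le> (LINT t|lborel. norm (p t * complex_of_real ((2 * sin (t * a) / a) * (2 * sin (t * b) / b))))"
    unfolding square_kernel_def by (rule integral_norm_bound)
  also have "\<dots> \<le> (LINT t|lborel. 4 * norm (t\<^sup>2 *\<^sub>R p t))"
    using le integrable_norm[OF p2] by (intro integral_mono_AE' AE_I2) auto
  finally show ?thesis by simp
qed

text \<open>A majorant of the integral of \<open>1 / ((w + b) b)\<close> over \<open>b \<ge> 1\<close>; for \<open>w > 0\<close> that integral is \<open>ln (1 + w) / w\<close>.\<close>

definition decay_weight :: "real \<Rightarrow> real" where
  "decay_weight w = (if w < 4 then 1 else (1 + ln w) / w)"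

lemma measurable_decay_weight [measurable]: "decay_weight \<in> borel_measurable borel"
  unfolding decay_weight_def by measurable

text \<open>For fixed \<open>b\<close> and \<open>u\<close>, the admissible \<open>a\<close> fill an interval of length \<open>2 b\<close>, which cancels the
  factor \<open>1 / b\<close>, while \<open>1 / a \<le> 2 / u\<close>. The bound \<open>a \<ge> 5\<close> ensures \<open>u \<ge> 4\<close>, hence \<open>u > pi\<close>.\<close>

lemma nn_integral_strip_le:
  fixes s :: "real \<Rightarrow> ennreal"
  assumes [measurable]: "s \<in> borel_measurable borel"
  defines "T2 \<equiv> \<lambda>a b. if 0 < b \<and> b \<le> 1 \<and> 5 \<le> a then ennreal (2 / (a * b)) *
     (\<integral>\<^sup>+u. s u * (if a - b \<le> u \<and> u \<le> a + b then 1 else 0) \<partial>lborel) else 0"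
  shows "(\<integral>\<^sup>+b. \<integral>\<^sup>+a. T2 a b \<partial>lborel \<partial>lborel) \<le> 8 * (\<integral>\<^sup>+u. s u * ennreal (1 / u) * indicator {4..} u \<partial>lborel)"
proof -
  let ?D = "\<integral>\<^sup>+u. 8 * (s u * ennreal (1 / u) * indicator {4..} u) \<partial>lborel"
  have inner: "(\<integral>\<^sup>+a. T2 a b \<partial>lborel) \<le> ?D * indicator {0..1} b" for b
  proof (cases "0 < b \<and> b \<le> 1")
    case b: True
    have "(\<integral>\<^sup>+a. T2 a b \<partial>lborel) = (\<integral>\<^sup>+a. \<integral>\<^sup>+u. (if 5 \<le> a then ennreal (2 / (a * b)) else 0) *
       (s u * (if a - b \<le> u \<and> u \<le> a + b then 1 else 0)) \<partial>lborel \<partial>lborel)"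
      using b by (intro nn_integral_cong) (simp add: T2_def nn_integral_cmult)
    also have "\<dots> = (\<integral>\<^sup>+u. \<integral>\<^sup>+a. (if 5 \<le> a then ennreal (2 / (a * b)) else 0) *
       (s u * (if a - b \<le> u \<and> u \<le> a + b then 1 else 0)) \<partial>lborel \<partial>lborel)"
      by (rule lborel_pair.Fubini') measurable
    also have "\<dots> \<le> ?D"
    proof (intro nn_integral_mono)
      fix u :: real
      have "(\<integral>\<^sup>+a. (if 5 \<le> a then ennreal (2 / (a * b)) else 0) *
          (s u * (if a - b \<le> u \<and> u \<le> a + b then 1 else 0)) \<partial>lborel)
        \<le> (\<integral>\<^sup>+a. (s u * ennreal (4 / (u * b)) * indicator {4..} u) * indicator {u - b..u + b} a \<partial>lborel)"
      proof (intro nn_integral_mono)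
        fix a
        show "(if 5 \<le> a then ennreal (2 / (a * b)) else 0) * (s u * (if a - b \<le> u \<and> u \<le> a + b then 1 else 0))
          \<le> (s u * ennreal (4 / (u * b)) * indicator {4..} u) * indicator {u - b..u + b} a"
        proof (cases "5 \<le> a \<and> a - b \<le> u \<and> u \<le> a + b")
          case True
          then have u: "u \<ge> 4" "u \<le> 2 * a" using b by auto
          have "2 / (a * b) \<le> 4 / (u * b)" using u b True by (simp add: field_simps)
          then have "ennreal (2 / (a * b)) * s u \<le> ennreal (4 / (u * b)) * s u"
            by (intro mult_right_mono ennreal_leI) auto
          moreover have "a \<in> {u - b..u + b}" using True by auto
          ultimately show ?thesis using u True by (simp add: mult.commute)
        qed (auto simp: indicator_def)
      qed
      also have "\<dots> = (s u * ennreal (4 / (u * b)) * indicator {4..} u) * ennreal (2 * b)"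
        using b by (subst nn_integral_cmult_indicator) auto
      also have "\<dots> = 8 * (s u * ennreal (1 / u) * indicator {4..} u)"
      proof (cases "u \<ge> 4")
        case True
        have "ennreal (4 / (u * b)) * ennreal (2 * b) = ennreal (8 * (1 / u))"
          using True b by (subst ennreal_mult[symmetric]) (auto simp: field_simps)
        also have "\<dots> = 8 * ennreal (1 / u)" using True by (subst ennreal_mult) auto
        finally show ?thesis using True by (simp add: mult_ac)
      qed simp
      finally show "(\<integral>\<^sup>+a. (if 5 \<le> a then ennreal (2 / (a * b)) else 0) *
          (s u * (if a - b \<le> u \<and> u \<le> a + b then 1 else 0)) \<partial>lborel)
        \<le> 8 * (s u * ennreal (1 / u) * indicator {4..} u)" .
    qed
    finally show ?thesis using b by simp
  next
    case False
    then have "T2 a b = 0" for a by (auto simp: T2_def)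
    then show ?thesis by simp
  qed
  have "(\<integral>\<^sup>+b. \<integral>\<^sup>+a. T2 a b \<partial>lborel \<partial>lborel) \<le> (\<integral>\<^sup>+b. ?D * indicator {0..1::real} b \<partial>lborel)"
    by (intro nn_integral_mono inner)
  also have "\<dots> = ?D" by (subst nn_integral_cmult_indicator) auto
  also have "?D = 8 * (\<integral>\<^sup>+u. s u * ennreal (1 / u) * indicator {4..} u \<partial>lborel)"
    by (rule nn_integral_cmult) measurable
  finally show ?thesis .
qed

text \<open>Translate \<open>a\<close> to \<open>w = a - b\<close> and integrate over \<open>b\<close> first; the inner integral is split
  at \<open>b = w\<close>, with \<open>1 / (w b)\<close> as majorant below and \<open>1 / b\<^sup>2\<close> above.\<close>

lemma nn_integral_difference_le:
  fixes \<phi> :: "real \<Rightarrow> ennreal"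
  assumes [measurable]: "\<phi> \<in> borel_measurable borel"
  defines "T3 \<equiv> \<lambda>a b. if 1 \<le> b \<and> b \<le> a then ennreal (2 / (a * b)) * \<phi> (a - b) else 0"
  shows "(\<integral>\<^sup>+b. \<integral>\<^sup>+a. T3 a b \<partial>lborel \<partial>lborel) \<le> 2 * (\<integral>\<^sup>+w. \<phi> w * ennreal (decay_weight w) * indicator {0..} w \<partial>lborel)"
proof -
  have ln_pos: "ln w > 0" if "w \<ge> 4" for w :: real using that by (intro ln_gt_zero) auto
  have [measurable]: "(\<lambda>z. T3 (fst z) (snd z)) \<in> borel_measurable (borel \<Otimes>\<^sub>M borel)"
    unfolding T3_def by measurable
  have [measurable]: "(\<lambda>a. T3 a b) \<in> borel_measurable borel" for b
    unfolding T3_def by measurable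
  have shift: "(\<integral>\<^sup>+a. T3 a b \<partial>lborel) = (\<integral>\<^sup>+w. T3 (w + b) b \<partial>lborel)" for b
    using nn_integral_real_affine[of "\<lambda>a. T3 a b" 1 b] by (simp add: add.commute)
  have "(\<integral>\<^sup>+b. \<integral>\<^sup>+a. T3 a b \<partial>lborel \<partial>lborel) = (\<integral>\<^sup>+w. \<integral>\<^sup>+b. T3 (w + b) b \<partial>lborel \<partial>lborel)"
    unfolding shift by (rule lborel_pair.Fubini') (unfold T3_def, measurable)
  also have "\<dots> \<le> (\<integral>\<^sup>+w. 2 * (\<phi> w * ennreal (decay_weight w) * indicator {0..} w) \<partial>lborel)"
  proof (intro nn_integral_mono)
    fix w :: real
    show "(\<integral>\<^sup>+b. T3 (w + b) b \<partial>lborel) \<le> 2 * (\<phi> w * ennreal (decay_weight w) * indicator {0..} w)"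
    proof (cases "w \<ge> 0")
      case w: True
      have "(\<integral>\<^sup>+b. T3 (w + b) b \<partial>lborel) = (\<integral>\<^sup>+b. (2 * \<phi> w) * (ennreal (1 / ((w + b) * b)) * indicator {1..} b) \<partial>lborel)"
      proof (intro nn_integral_cong)
        fix b :: real
        have "ennreal (2 / ((w + b) * b)) = 2 * ennreal (1 / ((w + b) * b))" if "b \<ge> 1"
          using that w by (simp flip: ennreal_mult' ennreal_numeral)
        then show "T3 (w + b) b = (2 * \<phi> w) * (ennreal (1 / ((w + b) * b)) * indicator {1..} b)"
          using w by (auto simp: T3_def indicator_def mult_ac)
      qed
      also have "\<dots> = (2 * \<phi> w) * (\<integral>\<^sup>+b. ennreal (1 / ((w + b) * b)) * indicator {1..} b \<partial>lborel)"
        by (rule nn_integral_cmult) measurable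
      also have "\<dots> \<le> (2 * \<phi> w) * ennreal (decay_weight w)"
      proof (rule mult_left_mono)
        show "(\<integral>\<^sup>+b. ennreal (1 / ((w + b) * b)) * indicator {1..} b \<partial>lborel) \<le> ennreal (decay_weight w)"
        proof (cases "w < 4")
          case True
          have "(\<integral>\<^sup>+b. ennreal (1 / ((w + b) * b)) * indicator {1..} b \<partial>lborel) \<le> (\<integral>\<^sup>+b. ennreal (1 / b\<^sup>2) * indicator {1..} b \<partial>lborel)"
            using w by (intro nn_integral_mono) (auto simp: indicator_def power2_eq_square intro!: ennreal_leI divide_left_mono mult_right_mono)
          then show ?thesis using True nn_integral_inverse_square[of 1] by (simp add: decay_weight_def)
        next
          case False
          then have w4: "w \<ge> 4" by simp
          have "(\<integral>\<^sup>+b. ennreal (1 / ((w + b) * b)) * indicator {1..} b \<partial>lborel)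
            \<le> (\<integral>\<^sup>+b. ennreal (1 / w) * (ennreal (1 / b) * indicator {1..w} b) + ennreal (1 / b\<^sup>2) * indicator {w..} b \<partial>lborel)"
          proof (intro nn_integral_mono)
            fix b :: real
            consider "b < 1" | "1 \<le> b" "b \<le> w" | "b > w" by linarith
            then show "ennreal (1 / ((w + b) * b)) * indicator {1..} b
              \<le> ennreal (1 / w) * (ennreal (1 / b) * indicator {1..w} b) + ennreal (1 / b\<^sup>2) * indicator {w..} b"
            proof cases
              case 2
              then have "1 / ((w + b) * b) \<le> 1 / (w * b)"
                using w4 by (intro divide_left_mono mult_right_mono mult_pos_pos) auto
              then have "1 / ((w + b) * b) \<le> 1 / w * (1 / b)" by simp
              then have "ennreal (1 / ((w + b) * b)) \<le> ennreal (1 / w) * ennreal (1 / b)"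
                using w4 2 by (subst ennreal_mult[symmetric]) (auto intro: ennreal_leI)
              then show ?thesis using 2 by (simp add: add_increasing2)
            next
              case 3
              then have "1 / ((w + b) * b) \<le> 1 / b\<^sup>2" using w4
                by (simp add: power2_eq_square divide_left_mono mult_right_mono)
              then show ?thesis using 3 w4 by (simp add: ennreal_leI)
            qed simp
          qed
          also have "\<dots> = ennreal (1 / w) * (\<integral>\<^sup>+b. ennreal (1 / b) * indicator {1..w} b \<partial>lborel)
             + (\<integral>\<^sup>+b. ennreal (1 / b\<^sup>2) * indicator {w..} b \<partial>lborel)"
            by (subst nn_integral_add, measurable, subst nn_integral_cmult) auto
          also have "\<dots> = ennreal (1 / w) * ennreal (ln w) + ennreal (1 / w)"
            using w4 nn_integral_inverse_Icc[of 1 w] nn_integral_inverse_square[of w] by simp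
          also have "\<dots> = ennreal (decay_weight w)"
            using w4 ln_pos[OF w4] by (simp add: decay_weight_def ennreal_mult'[symmetric] ennreal_plus[symmetric] add_divide_distrib add.commute del: ennreal_plus)
          finally show ?thesis .
        qed
      qed simp
      finally show ?thesis using w by (simp add: mult.assoc)
    next
      case False
      then have "T3 (w + b) b = 0" for b by (auto simp: T3_def)
      then show ?thesis by simp
    qed
  qed
  also have "\<dots> = 2 * (\<integral>\<^sup>+w. \<phi> w * ennreal (decay_weight w) * indicator {0..} w \<partial>lborel)"
    by (rule nn_integral_cmult) measurable
  finally show ?thesis .
qed

text \<open>Translate \<open>a\<close> to \<open>v = a + b\<close>; then \<open>a \<ge> v / 2\<close> because \<open>a \<ge> b\<close>, and integrating \<open>1 / b\<close> over
  \<open>1 \<le> b \<le> v\<close> gives the logarithm.\<close>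

lemma nn_integral_sum_le:
  fixes \<phi> :: "real \<Rightarrow> ennreal"
  assumes [measurable]: "\<phi> \<in> borel_measurable borel"
  defines "T4 \<equiv> \<lambda>a b. if 1 \<le> b \<and> b \<le> a then ennreal (2 / (a * b)) * \<phi> (a + b) else 0"
  shows "(\<integral>\<^sup>+b. \<integral>\<^sup>+a. T4 a b \<partial>lborel \<partial>lborel) \<le> 4 * (\<integral>\<^sup>+w. \<phi> w * ennreal (decay_weight w) * indicator {0..} w \<partial>lborel)"
proof -
  have [measurable]: "(\<lambda>z. T4 (fst z) (snd z)) \<in> borel_measurable (borel \<Otimes>\<^sub>M borel)"
    unfolding T4_def by measurable
  have [measurable]: "(\<lambda>a. T4 a b) \<in> borel_measurable borel" for b
    unfolding T4_def by measurable
  have shift: "(\<integral>\<^sup>+a. T4 a b \<partial>lborel) = (\<integral>\<^sup>+v. T4 (v - b) b \<partial>lborel)" for b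
    using nn_integral_real_affine[of "\<lambda>a. T4 a b" 1 "- b"] by simp
  have "(\<integral>\<^sup>+b. \<integral>\<^sup>+a. T4 a b \<partial>lborel \<partial>lborel) = (\<integral>\<^sup>+v. \<integral>\<^sup>+b. T4 (v - b) b \<partial>lborel \<partial>lborel)"
    unfolding shift by (rule lborel_pair.Fubini') (unfold T4_def, measurable)
  also have "\<dots> \<le> (\<integral>\<^sup>+v. 4 * (\<phi> v * ennreal (decay_weight v) * indicator {0..} v) \<partial>lborel)"
  proof (intro nn_integral_mono)
    fix v :: real
    show "(\<integral>\<^sup>+b. T4 (v - b) b \<partial>lborel) \<le> 4 * (\<phi> v * ennreal (decay_weight v) * indicator {0..} v)"
    proof (cases "v \<ge> 1")
      case v: True
      have "(\<integral>\<^sup>+b. T4 (v - b) b \<partial>lborel) \<le> (\<integral>\<^sup>+b. (\<phi> v * ennreal (4 / v)) * (ennreal (1 / b) * indicator {1..v} b) \<partial>lborel)"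
      proof (intro nn_integral_mono)
        fix b :: real
        show "T4 (v - b) b \<le> (\<phi> v * ennreal (4 / v)) * (ennreal (1 / b) * indicator {1..v} b)"
        proof (cases "1 \<le> b \<and> b \<le> v - b")
          case True
          then have "2 / ((v - b) * b) \<le> 4 / v * (1 / b)" using v by (simp add: field_simps)
          then have "ennreal (2 / ((v - b) * b)) \<le> ennreal (4 / v) * ennreal (1 / b)"
            using v True by (subst ennreal_mult[symmetric]) (auto intro: ennreal_leI)
          then have "ennreal (2 / ((v - b) * b)) * \<phi> v \<le> ennreal (4 / v) * ennreal (1 / b) * \<phi> v"
            by (rule mult_right_mono) simp
          then show ?thesis using True by (simp add: T4_def mult_ac)
        qed (auto simp: T4_def)
      qed
      also have "\<dots> = (\<phi> v * ennreal (4 / v)) * ennreal (ln v)"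
        using v nn_integral_inverse_Icc[of 1 v] by (subst nn_integral_cmult) auto
      also have "\<dots> = \<phi> v * (4 * ennreal (ln v / v))"
        using v by (simp add: mult.assoc ennreal_mult'[symmetric] flip: ennreal_numeral)
      also have "\<dots> \<le> \<phi> v * (4 * ennreal (decay_weight v))"
      proof (intro mult_left_mono ennreal_leI)
        have "ln v < v" using v by (intro ln_less_self) auto
        then have "ln v / v \<le> v / v" using v by (intro divide_right_mono less_imp_le) auto
        then have "ln v / v \<le> 1" using v by (simp del: divide_le_eq_1_pos)
        then show "ln v / v \<le> decay_weight v"
          unfolding decay_weight_def using v by (auto simp: divide_right_mono)
      qed auto
      finally show ?thesis using v by (simp add: mult_ac)
    next
      case False
      then have "T4 (v - b) b = 0" for b by (auto simp: T4_def)
      then show ?thesis by simp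
    qed
  qed
  also have "\<dots> = 4 * (\<integral>\<^sup>+w. \<phi> w * ennreal (decay_weight w) * indicator {0..} w \<partial>lborel)"
    by (rule nn_integral_cmult) measurable
  finally show ?thesis .
qed

lemma nn_integral_iterated_add:
  fixes U V :: "real \<Rightarrow> real \<Rightarrow> ennreal"
  assumes U: "(\<lambda>z. U (fst z) (snd z)) \<in> borel_measurable (borel \<Otimes>\<^sub>M borel)"
    and V: "(\<lambda>z. V (fst z) (snd z)) \<in> borel_measurable (borel \<Otimes>\<^sub>M borel)"
  shows "(\<integral>\<^sup>+b. \<integral>\<^sup>+a. U a b + V a b \<partial>lborel \<partial>lborel)
    = (\<integral>\<^sup>+b. \<integral>\<^sup>+a. U a b \<partial>lborel \<partial>lborel) + (\<integral>\<^sup>+b. \<integral>\<^sup>+a. V a b \<partial>lborel \<partial>lborel)"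
proof -
  have sect: "(\<lambda>a. W a b) \<in> borel_measurable lborel"
    if "(\<lambda>z. W (fst z) (snd z)) \<in> borel_measurable (borel \<Otimes>\<^sub>M borel)" for W :: "real \<Rightarrow> real \<Rightarrow> ennreal" and b
    using measurable_compose[OF _ that, of "\<lambda>a. (a, b)" borel] by simp
  have swap: "(\<lambda>b. \<integral>\<^sup>+a. W a b \<partial>lborel) \<in> borel_measurable lborel"
    if "(\<lambda>z. W (fst z) (snd z)) \<in> borel_measurable (borel \<Otimes>\<^sub>M borel)" for W :: "real \<Rightarrow> real \<Rightarrow> ennreal"
  proof -
    have "(\<lambda>(b, a). W a b) \<in> borel_measurable (borel \<Otimes>\<^sub>M borel)"
      using measurable_compose[OF _ that, of "\<lambda>z. (snd z, fst z)" "borel \<Otimes>\<^sub>M borel"] by (simp add: split_beta)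
    then show ?thesis by measurable
  qed
  show ?thesis
    using sect[OF U] sect[OF V] swap[OF U] swap[OF V] by (simp add: nn_integral_add)
qed

lemma measurable_square_kernel [measurable (raw)]:
  assumes [measurable]: "p \<in> borel_measurable borel" "f \<in> borel_measurable X" "g \<in> borel_measurable X"
  shows "(\<lambda>x. square_kernel p (f x) (g x)) \<in> borel_measurable X"
  unfolding square_kernel_def by measurable

text \<open>By the symmetries of the kernel only \<open>0 < b \<le> a\<close> matters. Where \<open>a \<le> 5\<close> the kernel is bounded.
  For \<open>a > 5\<close> and \<open>b \<le> 1\<close> the difference of the cosine transforms at \<open>a - b\<close> and \<open>a + b\<close> is small and
  is estimated through its derivative; for \<open>b \<ge> 1\<close> the two transforms are estimated separately.\<close>

lemma square_kernel_integrable: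
  fixes p :: "real \<Rightarrow> complex"
  assumes p: "integrable lborel p" and p2: "integrable lborel (\<lambda>t. t\<^sup>2 *\<^sub>R p t)"
    and q: "integrable lborel (\<lambda>t. t *\<^sub>R p t)"
    and DF: "(\<integral>\<^sup>+u. ennreal (norm (trig_transform cos p u)) * ennreal ((1 + ln u) / u) * indicator {4..} u \<partial>lborel) < \<infinity>"
    and DS: "(\<integral>\<^sup>+u. ennreal (norm (trig_transform sin (\<lambda>t. t *\<^sub>R p t) u)) * ennreal (1 / u) * indicator {4..} u \<partial>lborel) < \<infinity>"
  shows "(\<integral>\<^sup>+b. \<integral>\<^sup>+a. ennreal (norm (square_kernel p a b)) \<partial>lborel \<partial>lborel) < \<infinity>"
proof -
  have [measurable]: "p \<in> borel_measurable borel" using borel_measurable_integrable[OF p] by simp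
  define F where "F = trig_transform cos p"
  define S where "S = trig_transform sin (\<lambda>t. t *\<^sub>R p t)"
  have [measurable]: "F \<in> borel_measurable borel" "S \<in> borel_measurable borel"
    unfolding F_def S_def by measurable
  define N where "N a b = ennreal (norm (square_kernel p a b))" for a b
  have N_meas [measurable]: "(\<lambda>z. N (fst z) (snd z)) \<in> borel_measurable (borel \<Otimes>\<^sub>M borel)"
    unfolding N_def square_kernel_def by measurable
  define M where "M = 4 * (LINT t|lborel. norm (t\<^sup>2 *\<^sub>R p t))"
  have N_M: "N a b \<le> ennreal M" for a b
    unfolding N_def M_def by (intro ennreal_leI norm_square_kernel_le p2)
  have N_zero: "N 0 b = 0" "N a 0 = 0" for a b by (simp_all add: N_def square_kernel_def)
  have N_abs: "N \<bar>a\<bar> \<bar>b\<bar> = N a b" for a b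
  proof -
    have "2 * sin (t * \<bar>c\<bar>) / \<bar>c\<bar> = 2 * sin (t * c) / c" for t c :: real by (cases "c \<ge> 0") auto
    then show ?thesis by (simp only: N_def square_kernel_def)
  qed
  have N_sym: "N a b = N b a" for a b by (simp only: N_def square_kernel_def mult.commute)
  have N_F: "N a b \<le> ennreal (2 / (a * b)) * ennreal (norm (F (a - b))) + ennreal (2 / (a * b)) * ennreal (norm (F (a + b)))"
    if "a > 0" "b > 0" for a b
  proof -
    have "norm (square_kernel p a b) = 2 / (a * b) * norm (F (a - b) - F (a + b))"
      unfolding square_kernel_eq_cos[OF p] F_def using that by (simp only: norm_mult norm_of_real) simp
    also have "\<dots> \<le> 2 / (a * b) * (norm (F (a - b)) + norm (F (a + b)))"
      using that by (intro mult_left_mono norm_triangle_ineq4) auto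
    finally show ?thesis
      unfolding N_def using that
      by (simp add: ennreal_mult'[symmetric] ennreal_plus[symmetric] distrib_left del: ennreal_plus)
  qed
  have N_S: "N a b \<le> ennreal (2 / (a * b)) * (\<integral>\<^sup>+u. ennreal (norm (S u)) * (if a - b \<le> u \<and> u \<le> a + b then 1 else 0) \<partial>lborel)"
    if "a > 0" "b > 0" for a b
  proof -
    have "norm (square_kernel p a b) = 2 / (a * b) * norm (F (a - b) - F (a + b))"
      unfolding square_kernel_eq_cos[OF p] F_def using that by (simp only: norm_mult norm_of_real) simp
    then have "N a b = ennreal (2 / (a * b)) * ennreal (norm (F (a - b) - F (a + b)))"
      unfolding N_def using that by (simp add: ennreal_mult'[symmetric])
    also have "\<dots> \<le> ennreal (2 / (a * b)) * (\<integral>\<^sup>+u. ennreal (norm (S u)) * (if a - b \<le> u \<and> u \<le> a + b then 1 else 0) \<partial>lborel)"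
      unfolding F_def S_def using that by (intro mult_left_mono norm_trig_transform_cos_diff_le p q) auto
    finally show ?thesis .
  qed

  define \<Phi> where "\<Phi> = (\<integral>\<^sup>+w. ennreal (norm (F w)) * ennreal (decay_weight w) * indicator {0..} w \<partial>lborel)"
  have \<Phi>: "\<Phi> < \<infinity>"
  proof -
    let ?C = "LINT t|lborel. norm (p t)"
    have "\<Phi> \<le> (\<integral>\<^sup>+w. ennreal ?C * indicator {0..4} w + ennreal (norm (F w)) * ennreal ((1 + ln w) / w) * indicator {4..} w \<partial>lborel)"
      unfolding \<Phi>_def
    proof (intro nn_integral_mono)
      fix w :: real
      show "ennreal (norm (F w)) * ennreal (decay_weight w) * indicator {0..} w
        \<le> ennreal ?C * indicator {0..4} w + ennreal (norm (F w)) * ennreal ((1 + ln w) / w) * indicator {4..} w"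
        using norm_trig_transform_le[OF p, of cos w] by (auto simp: decay_weight_def indicator_def F_def intro!: ennreal_leI)
    qed
    also have "\<dots> = ennreal ?C * emeasure lborel {0..4::real} + (\<integral>\<^sup>+w. ennreal (norm (F w)) * ennreal ((1 + ln w) / w) * indicator {4..} w \<partial>lborel)"
      by (subst nn_integral_add, measurable, subst nn_integral_cmult_indicator) auto
    also have "\<dots> < \<infinity>" using DF unfolding F_def[symmetric] by (simp add: ennreal_mult_less_top)
    finally show ?thesis .
  qed

  define T1 where "T1 a b = (if 0 < b \<and> b \<le> 5 \<and> 0 < a \<and> a \<le> 5 then ennreal M else 0)" for a b :: real
  define T2 where "T2 a b = (if 0 < b \<and> b \<le> 1 \<and> 5 \<le> a then ennreal (2 / (a * b)) *
     (\<integral>\<^sup>+u. ennreal (norm (S u)) * (if a - b \<le> u \<and> u \<le> a + b then 1 else 0) \<partial>lborel) else 0)" for a b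
  define T3 where "T3 a b = (if 1 \<le> b \<and> b \<le> a then ennreal (2 / (a * b)) * ennreal (norm (F (a - b))) else 0)" for a b
  define T4 where "T4 a b = (if 1 \<le> b \<and> b \<le> a then ennreal (2 / (a * b)) * ennreal (norm (F (a + b))) else 0)" for a b
  have [measurable]:
    "(\<lambda>z. T1 (fst z) (snd z)) \<in> borel_measurable (borel \<Otimes>\<^sub>M borel)"
    "(\<lambda>z. T2 (fst z) (snd z)) \<in> borel_measurable (borel \<Otimes>\<^sub>M borel)"
    "(\<lambda>z. T3 (fst z) (snd z)) \<in> borel_measurable (borel \<Otimes>\<^sub>M borel)"
    "(\<lambda>z. T4 (fst z) (snd z)) \<in> borel_measurable (borel \<Otimes>\<^sub>M borel)"
    unfolding T1_def T2_def T3_def T4_def by measurable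
  define Q where "Q a b = (if 0 < b \<and> b \<le> a then N a b else 0)" for a b
  have [measurable]: "(\<lambda>z. Q (fst z) (snd z)) \<in> borel_measurable (borel \<Otimes>\<^sub>M borel)"
    unfolding Q_def by measurable
  have Q_le: "Q a b \<le> T1 a b + T2 a b + T3 a b + T4 a b" for a b
  proof (cases "0 < b \<and> b \<le> a")
    case ab: True
    consider "a \<le> 5" | "a > 5" "b \<le> 1" | "b \<ge> 1" by linarith
    then show ?thesis
    proof cases
      case 1
      then have "Q a b \<le> T1 a b" using ab N_M by (simp add: Q_def T1_def)
      then show ?thesis by (simp add: add_increasing2 add.assoc)
    next
      case 2
      then have "Q a b \<le> T2 a b" using ab N_S by (simp add: Q_def T2_def)
      then show ?thesis by (meson add_increasing add_increasing2 zero_le)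
    next
      case 3
      then have "Q a b \<le> T3 a b + T4 a b" using ab N_F by (simp add: Q_def T3_def T4_def)
      then show ?thesis by (simp add: add.assoc) (meson add_increasing zero_le)
    qed
  next
    case False
    then have "Q a b = 0" unfolding Q_def by (rule if_not_P)
    then show ?thesis by simp
  qed

  have I1: "(\<integral>\<^sup>+b. \<integral>\<^sup>+a. T1 a b \<partial>lborel \<partial>lborel) < \<infinity>"
  proof -
    have "(\<integral>\<^sup>+b. \<integral>\<^sup>+a. T1 a b \<partial>lborel \<partial>lborel) = (\<integral>\<^sup>+b. \<integral>\<^sup>+a. ennreal M * indicator {0<..5::real} b * indicator {0<..5::real} a \<partial>lborel \<partial>lborel)"
      by (intro nn_integral_cong) (auto simp: T1_def indicator_def)
    also have "\<dots> = (\<integral>\<^sup>+b. ennreal M * indicator {0<..5::real} b * emeasure lborel {0<..5::real} \<partial>lborel)"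
      by (intro nn_integral_cong nn_integral_cmult_indicator) auto
    also have "\<dots> = (\<integral>\<^sup>+b. (ennreal M * emeasure lborel {0<..5::real}) * indicator {0<..5::real} b \<partial>lborel)"
      by (intro nn_integral_cong) (simp add: mult_ac)
    also have "\<dots> = ennreal M * emeasure lborel {0<..5::real} * emeasure lborel {0<..5::real}"
      by (intro nn_integral_cmult_indicator) auto
    also have "\<dots> < \<infinity>" by (simp add: ennreal_mult_less_top)
    finally show ?thesis .
  qed

  have "(\<integral>\<^sup>+b. \<integral>\<^sup>+a. T2 a b \<partial>lborel \<partial>lborel) \<le> 8 * (\<integral>\<^sup>+u. ennreal (norm (S u)) * ennreal (1 / u) * indicator {4..} u \<partial>lborel)"
    unfolding T2_def by (rule nn_integral_strip_le) measurable
  also have "\<dots> < \<infinity>" using DS unfolding S_def[symmetric] by (simp add: ennreal_mult_less_top)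
  finally have I2: "(\<integral>\<^sup>+b. \<integral>\<^sup>+a. T2 a b \<partial>lborel \<partial>lborel) < \<infinity>" .
  have "(\<integral>\<^sup>+b. \<integral>\<^sup>+a. T3 a b \<partial>lborel \<partial>lborel) \<le> 2 * \<Phi>"
    unfolding T3_def \<Phi>_def by (rule nn_integral_difference_le) measurable
  also have "\<dots> < \<infinity>" using \<Phi> by (simp add: ennreal_mult_less_top)
  finally have I3: "(\<integral>\<^sup>+b. \<integral>\<^sup>+a. T3 a b \<partial>lborel \<partial>lborel) < \<infinity>" .
  have "(\<integral>\<^sup>+b. \<integral>\<^sup>+a. T4 a b \<partial>lborel \<partial>lborel) \<le> 4 * \<Phi>"
    unfolding T4_def \<Phi>_def by (rule nn_integral_sum_le) measurable
  also have "\<dots> < \<infinity>" using \<Phi> by (simp add: ennreal_mult_less_top)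
  finally have I4: "(\<integral>\<^sup>+b. \<integral>\<^sup>+a. T4 a b \<partial>lborel \<partial>lborel) < \<infinity>" .

  have J: "(\<integral>\<^sup>+b. \<integral>\<^sup>+a. Q a b \<partial>lborel \<partial>lborel) < \<infinity>"
  proof -
    have "(\<integral>\<^sup>+b. \<integral>\<^sup>+a. Q a b \<partial>lborel \<partial>lborel) \<le> (\<integral>\<^sup>+b. \<integral>\<^sup>+a. T1 a b + T2 a b + T3 a b + T4 a b \<partial>lborel \<partial>lborel)"
      by (intro nn_integral_mono Q_le)
    also have "\<dots> = (\<integral>\<^sup>+b. \<integral>\<^sup>+a. T1 a b \<partial>lborel \<partial>lborel) + (\<integral>\<^sup>+b. \<integral>\<^sup>+a. T2 a b \<partial>lborel \<partial>lborel)
        + (\<integral>\<^sup>+b. \<integral>\<^sup>+a. T3 a b \<partial>lborel \<partial>lborel) + (\<integral>\<^sup>+b. \<integral>\<^sup>+a. T4 a b \<partial>lborel \<partial>lborel)"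
      by (subst nn_integral_iterated_add, measurable)+
    also have "\<dots> < \<infinity>" using I1 I2 I3 I4 by simp
    finally show ?thesis .
  qed

  define R where "R a b = Q a b + Q b a" for a b
  have [measurable]: "(\<lambda>z. R (fst z) (snd z)) \<in> borel_measurable (borel \<Otimes>\<^sub>M borel)"
    unfolding R_def Q_def N_def by measurable
  have R_le: "N a b \<le> R \<bar>a\<bar> \<bar>b\<bar>" for a b
  proof (cases "a = 0 \<or> b = 0")
    case False
    then show ?thesis
      using N_abs[of a b] N_sym[of "\<bar>a\<bar>" "\<bar>b\<bar>"] by (cases "\<bar>b\<bar> \<le> \<bar>a\<bar>") (auto simp: R_def Q_def)
  qed (auto simp: N_zero)
  have "(\<integral>\<^sup>+b. \<integral>\<^sup>+a. N a b \<partial>lborel \<partial>lborel) \<le> (\<integral>\<^sup>+b. \<integral>\<^sup>+a. R \<bar>a\<bar> \<bar>b\<bar> \<partial>lborel \<partial>lborel)"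
    by (intro nn_integral_mono R_le)
  also have "\<dots> \<le> (\<integral>\<^sup>+b. 2 * (\<integral>\<^sup>+a. R a \<bar>b\<bar> \<partial>lborel) \<partial>lborel)"
    by (intro nn_integral_mono nn_integral_abs_le) (unfold R_def Q_def N_def, measurable)
  also have "\<dots> = 2 * (\<integral>\<^sup>+b. (\<integral>\<^sup>+a. R a \<bar>b\<bar> \<partial>lborel) \<partial>lborel)"
    by (rule nn_integral_cmult) (unfold R_def Q_def N_def, measurable)
  also have "\<dots> \<le> 2 * (2 * (\<integral>\<^sup>+b. \<integral>\<^sup>+a. R a b \<partial>lborel \<partial>lborel))"
    by (intro mult_left_mono nn_integral_abs_le[of "\<lambda>b. \<integral>\<^sup>+a. R a b \<partial>lborel"])
      (unfold R_def Q_def N_def, measurable)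
  also have "(\<integral>\<^sup>+b. \<integral>\<^sup>+a. R a b \<partial>lborel \<partial>lborel) = (\<integral>\<^sup>+b. \<integral>\<^sup>+a. Q a b \<partial>lborel \<partial>lborel) + (\<integral>\<^sup>+b. \<integral>\<^sup>+a. Q b a \<partial>lborel \<partial>lborel)"
    unfolding R_def by (rule nn_integral_iterated_add) (unfold Q_def N_def, measurable)
  also have "(\<integral>\<^sup>+b. \<integral>\<^sup>+a. Q b a \<partial>lborel \<partial>lborel) = (\<integral>\<^sup>+b. \<integral>\<^sup>+a. Q a b \<partial>lborel \<partial>lborel)"
    by (rule lborel_pair.Fubini') (unfold Q_def N_def, measurable)
  finally have "(\<integral>\<^sup>+b. \<integral>\<^sup>+a. N a b \<partial>lborel \<partial>lborel) \<le> 2 * (2 * ((\<integral>\<^sup>+b. \<integral>\<^sup>+a. Q a b \<partial>lborel \<partial>lborel) + (\<integral>\<^sup>+b. \<integral>\<^sup>+a. Q a b \<partial>lborel \<partial>lborel)))" .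
  also have "\<dots> < \<infinity>" using J by (simp add: ennreal_mult_less_top)
  finally show ?thesis unfolding N_def .
qed

text \<open>Both decay integrals come from the weighted decay estimate: the cosine transform of \<open>p\<close> with the
  weight \<open>ln (2 / h)\<close>, the sine transform of \<open>t p t\<close> with the weight 1.\<close>

lemma square_kernel_integrable_of_moduli:
  fixes p :: "real \<Rightarrow> complex"
  assumes [measurable]: "p \<in> borel_measurable borel" and p0: "\<And>t. t \<le> 0 \<Longrightarrow> p t = 0"
    and W1: "(\<integral>\<^sup>+t. ennreal (norm (p t) * (ln (2 / t))\<^sup>2) * indicator {0<..1} t \<partial>lborel) < \<infinity>"
    and W2: "(\<integral>\<^sup>+t. ennreal (t\<^sup>2 * norm (p t)) * indicator {1..} t \<partial>lborel) < \<infinity>"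
    and M1: "(\<integral>\<^sup>+h. shift_variation p h * ennreal (ln (2 / h) / h) * indicator {0<..1} h \<partial>lborel) < \<infinity>"
    and M2: "(\<integral>\<^sup>+h. shift_variation (\<lambda>t. t *\<^sub>R p t) h * ennreal (1 / h) * indicator {0<..1} h \<partial>lborel) < \<infinity>"
  shows "integrable lborel p" "integrable lborel (\<lambda>t. t\<^sup>2 *\<^sub>R p t)"
    "(\<integral>\<^sup>+b. \<integral>\<^sup>+a. ennreal (norm (square_kernel p a b)) \<partial>lborel \<partial>lborel) < \<infinity>"
proof -
  let ?q = "\<lambda>t. t *\<^sub>R p t"
  have ln_half: "ln (2 / t) \<ge> 1 / 2" if "0 < t" "t \<le> 1" for t :: real
  proof -
    have "ln 2 \<le> ln (2 / t)" using that by (subst ln_le_cancel_iff) (auto simp: field_simps)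
    then show ?thesis using ln2_ge_two_thirds by linarith
  qed
  \<comment> \<open>Near 0 the logarithmic weight dominates a positive constant, near infinity \<open>t\<^sup>2\<close> dominates 1:
    one majorant serves all three functions \<open>p\<close>, \<open>t p\<close> and \<open>t\<^sup>2 p\<close>.\<close>
  have weight: "1 + t\<^sup>2 \<le> 8 * (ln (2 / t))\<^sup>2" if t: "0 < t" "t \<le> 1" for t :: real
  proof -
    have "(1 / 2)\<^sup>2 \<le> (ln (2 / t))\<^sup>2" using ln_half[OF t] by (intro power_mono) auto
    moreover have "t\<^sup>2 \<le> 1" using t by (simp add: power_le_one)
    ultimately show ?thesis by (simp add: power2_eq_square)
  qed
  have "(\<integral>\<^sup>+t. ennreal (norm ((1 + t\<^sup>2) *\<^sub>R p t)) \<partial>lborel)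
    \<le> (\<integral>\<^sup>+t. 8 * (ennreal (norm (p t) * (ln (2 / t))\<^sup>2) * indicator {0<..1} t) + 2 * (ennreal (t\<^sup>2 * norm (p t)) * indicator {1..} t) \<partial>lborel)"
  proof (intro nn_integral_mono)
    fix t :: real
    consider "t \<le> 0" | "0 < t" "t \<le> 1" | "1 < t" by linarith
    then show "ennreal (norm ((1 + t\<^sup>2) *\<^sub>R p t))
      \<le> 8 * (ennreal (norm (p t) * (ln (2 / t))\<^sup>2) * indicator {0<..1} t) + 2 * (ennreal (t\<^sup>2 * norm (p t)) * indicator {1..} t)"
    proof cases
      case 1
      then show ?thesis using p0 by simp
    next
      case 2
      have "norm ((1 + t\<^sup>2) *\<^sub>R p t) = (1 + t\<^sup>2) * norm (p t)" by simp
      also have "\<dots> \<le> 8 * (ln (2 / t))\<^sup>2 * norm (p t)"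
        using weight[OF 2] by (rule mult_right_mono) simp
      finally have "ennreal (norm ((1 + t\<^sup>2) *\<^sub>R p t)) \<le> ennreal (8 * (norm (p t) * (ln (2 / t))\<^sup>2))"
        by (intro ennreal_leI) (simp add: mult_ac)
      also have "\<dots> = 8 * ennreal (norm (p t) * (ln (2 / t))\<^sup>2)" by (subst ennreal_mult) auto
      finally show ?thesis using 2 by (intro add_increasing2) auto
    next
      case 3
      have "1 \<le> t\<^sup>2" using 3 by (simp add: one_le_power)
      then have "(1 + t\<^sup>2) * norm (p t) \<le> (2 * t\<^sup>2) * norm (p t)" by (intro mult_right_mono) auto
      moreover have "norm ((1 + t\<^sup>2) *\<^sub>R p t) = (1 + t\<^sup>2) * norm (p t)" by simp
      ultimately have "ennreal (norm ((1 + t\<^sup>2) *\<^sub>R p t)) \<le> ennreal (2 * (t\<^sup>2 * norm (p t)))"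
        by (intro ennreal_leI) (simp only: mult.assoc)
      also have "\<dots> = 2 * ennreal (t\<^sup>2 * norm (p t))" by (subst ennreal_mult) auto
      finally show ?thesis using 3 by (intro add_increasing) auto
    qed
  qed
  also have "\<dots> = 8 * (\<integral>\<^sup>+t. ennreal (norm (p t) * (ln (2 / t))\<^sup>2) * indicator {0<..1} t \<partial>lborel)
     + 2 * (\<integral>\<^sup>+t. ennreal (t\<^sup>2 * norm (p t)) * indicator {1..} t \<partial>lborel)"
    by (subst nn_integral_add, measurable, simp add: nn_integral_cmult)
  also have "\<dots> < \<infinity>" using W1 W2 by (simp add: ennreal_mult_less_top)
  finally have dom: "integrable lborel (\<lambda>t. (1 + t\<^sup>2) *\<^sub>R p t)"
    by (intro integrableI_bounded) auto
  have sub: "integrable lborel (\<lambda>t. c t *\<^sub>R p t)"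
    if [measurable]: "c \<in> borel_measurable borel" and c: "\<And>t. \<bar>c t\<bar> \<le> 1 + t\<^sup>2" for c :: "real \<Rightarrow> real"
  proof (rule Bochner_Integration.integrable_bound[OF dom])
    show "AE t in lborel. norm (c t *\<^sub>R p t) \<le> norm ((1 + t\<^sup>2) *\<^sub>R p t)"
      using c by (intro AE_I2) (auto intro!: mult_right_mono order_trans[OF _ abs_ge_self])
  qed measurable
  show p: "integrable lborel p" using sub[of "\<lambda>_. 1"] by simp
  show p2: "integrable lborel (\<lambda>t. t\<^sup>2 *\<^sub>R p t)" by (rule sub) auto
  have q: "integrable lborel ?q"
  proof (rule sub)
    fix t :: real
    have "0 \<le> (\<bar>t\<bar> - 1)\<^sup>2 + \<bar>t\<bar>" by simp
    then show "\<bar>t\<bar> \<le> 1 + t\<^sup>2" by (simp add: power2_eq_square algebra_simps flip: abs_mult)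
  qed measurable
  have q0: "?q t = 0" if "t \<le> 0" for t using p0[OF that] by simp
  show "(\<integral>\<^sup>+b. \<integral>\<^sup>+a. ennreal (norm (square_kernel p a b)) \<partial>lborel \<partial>lborel) < \<infinity>"
  proof (rule square_kernel_integrable[OF p p2 q])
    have le: "(\<integral>\<^sup>+t. ennreal (norm (p t) * (ln (2 / t) * ln (1 / t))) * indicator {0<..1} t \<partial>lborel)
      \<le> (\<integral>\<^sup>+t. ennreal (norm (p t) * (ln (2 / t))\<^sup>2) * indicator {0<..1} t \<partial>lborel)"
    proof (intro nn_integral_mono)
      fix t :: real
      show "ennreal (norm (p t) * (ln (2 / t) * ln (1 / t))) * indicator {0<..1} t
        \<le> ennreal (norm (p t) * (ln (2 / t))\<^sup>2) * indicator {0<..1} t"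
      proof (cases "t \<in> {0<..1}")
        case True
        then have "ln (1 / t) \<le> ln (2 / t)" by (subst ln_le_cancel_iff) (auto simp: field_simps)
        then have "ln (2 / t) * ln (1 / t) \<le> (ln (2 / t))\<^sup>2"
          unfolding power2_eq_square using ln_half[of t] True by (intro mult_left_mono) auto
        then show ?thesis by (intro mult_right_mono ennreal_leI mult_left_mono) auto
      qed simp
    qed
    have "(\<integral>\<^sup>+u. ennreal (norm (trig_transform cos p u)) * ennreal (ln (2 / (pi / u)) / u) * indicator {pi..} u \<partial>lborel) < \<infinity>"
    proof (rule trig_transform_weighted_decay[OF p p0, of cos "\<lambda>h. ln (2 / h)"])
      show "(\<integral>\<^sup>+h. shift_variation p h * ennreal (ln (2 / h) / h) * indicator {0<..1} h \<partial>lborel) < \<infinity>" by (rule M1)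
      show "(\<integral>\<^sup>+t. ennreal (norm (p t) * (ln (2 / t) * ln (1 / t))) * indicator {0<..1} t \<partial>lborel) < \<infinity>"
        using le W1 by (rule le_less_trans)
      show "ln (2 / h) \<ge> 0" if "0 < h" "h \<le> 1" for h :: real using ln_half[OF that] by simp
      show "ln (2 / k) \<le> ln (2 / h)" if "0 < h" "h \<le> k" "k \<le> 1" for h k :: real
        using that by (subst ln_le_cancel_iff) (auto simp: field_simps)
    qed (auto simp: cos_diff)
    then have fin: "4 * (\<integral>\<^sup>+u. ennreal (norm (trig_transform cos p u)) * ennreal (ln (2 / (pi / u)) / u) * indicator {pi..} u \<partial>lborel) < \<infinity>"
      by (simp add: ennreal_mult_less_top)
    have "(\<integral>\<^sup>+u. ennreal (norm (trig_transform cos p u)) * ennreal ((1 + ln u) / u) * indicator {4..} u \<partial>lborel)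
      \<le> (\<integral>\<^sup>+u. 4 * (ennreal (norm (trig_transform cos p u)) * ennreal (ln (2 / (pi / u)) / u) * indicator {pi..} u) \<partial>lborel)"
    proof (intro nn_integral_mono)
      fix u :: real
      show "ennreal (norm (trig_transform cos p u)) * ennreal ((1 + ln u) / u) * indicator {4..} u
        \<le> 4 * (ennreal (norm (trig_transform cos p u)) * ennreal (ln (2 / (pi / u)) / u) * indicator {pi..} u)"
      proof (cases "u \<ge> 4")
        case True
        have u: "u \<ge> pi" "u > 0" using True pi_less_4 by auto
        have "ln (2 / (pi / u)) = ln 2 + ln u - ln pi" using u by (simp add: ln_mult ln_div)
        moreover have "ln pi \<le> ln 4" using pi_less_4 by (subst ln_le_cancel_iff) auto
        moreover have "ln (4::real) = 2 * ln 2" using ln_realpow[of 2 2] by simp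
        moreover have "ln 4 \<le> ln u" using True by (subst ln_le_cancel_iff) auto
        ultimately have "1 + ln u \<le> 4 * ln (2 / (pi / u))"
          using ln2_ge_two_thirds ln_half[of "pi / u"] u by (simp add: algebra_simps)
        then have "(1 + ln u) / u \<le> 4 * (ln (2 / (pi / u)) / u)" using u by (simp add: divide_right_mono)
        then have "ennreal ((1 + ln u) / u) \<le> ennreal (4 * (ln (2 / (pi / u)) / u))" by (rule ennreal_leI)
        also have "\<dots> = 4 * ennreal (ln (2 / (pi / u)) / u)"
          using ln_half[of "pi / u"] u by (subst ennreal_mult) auto
        finally have "ennreal (norm (trig_transform cos p u)) * ennreal ((1 + ln u) / u)
          \<le> ennreal (norm (trig_transform cos p u)) * (4 * ennreal (ln (2 / (pi / u)) / u))"
          by (rule mult_left_mono) simp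
        then show ?thesis using True u(1) by (simp add: mult_ac)
      qed simp
    qed
    also have "\<dots> = 4 * (\<integral>\<^sup>+u. ennreal (norm (trig_transform cos p u)) * ennreal (ln (2 / (pi / u)) / u) * indicator {pi..} u \<partial>lborel)"
      by (rule nn_integral_cmult) measurable
    also have "\<dots> < \<infinity>" by (rule fin)
    finally show "(\<integral>\<^sup>+u. ennreal (norm (trig_transform cos p u)) * ennreal ((1 + ln u) / u) * indicator {4..} u \<partial>lborel) < \<infinity>" .
  next
    have "(\<integral>\<^sup>+u. ennreal (norm (trig_transform sin ?q u)) * ennreal (1 / u) * indicator {pi..} u \<partial>lborel) < \<infinity>"
    proof (rule trig_transform_weighted_decay[OF q q0, of sin "\<lambda>_. 1"])
      show "(\<integral>\<^sup>+h. shift_variation ?q h * ennreal (1 / h) * indicator {0<..1} h \<partial>lborel) < \<infinity>" by (rule M2)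
      have "(\<integral>\<^sup>+t. ennreal (norm (?q t) * (1 * ln (1 / t))) * indicator {0<..1} t \<partial>lborel)
        \<le> (\<integral>\<^sup>+t. 2 * (ennreal (norm (p t) * (ln (2 / t))\<^sup>2) * indicator {0<..1} t) \<partial>lborel)"
      proof (intro nn_integral_mono)
        fix t :: real
        show "ennreal (norm (?q t) * (1 * ln (1 / t))) * indicator {0<..1} t
          \<le> 2 * (ennreal (norm (p t) * (ln (2 / t))\<^sup>2) * indicator {0<..1} t)"
        proof (cases "t \<in> {0<..1}")
          case True
          then have t: "0 < t" "t \<le> 1" by auto
          have "ln (1 / t) \<le> ln (2 / t)" using t by (subst ln_le_cancel_iff) (auto simp: field_simps)
          also have "\<dots> \<le> 2 * (ln (2 / t))\<^sup>2"
            using mult_right_mono[OF ln_half[OF t], of "2 * ln (2 / t)"] ln_half[OF t] by (simp add: power2_eq_square)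
          finally have "t * ln (1 / t) \<le> 1 * (2 * (ln (2 / t))\<^sup>2)"
            using t by (intro mult_mono) auto
          then have "norm (p t) * (t * ln (1 / t)) \<le> norm (p t) * (2 * (ln (2 / t))\<^sup>2)"
            by (intro mult_left_mono) auto
          then have "ennreal (norm (?q t) * (1 * ln (1 / t))) \<le> ennreal (2 * (norm (p t) * (ln (2 / t))\<^sup>2))"
            using t by (intro ennreal_leI) (simp add: mult_ac)
          also have "\<dots> = 2 * ennreal (norm (p t) * (ln (2 / t))\<^sup>2)" by (subst ennreal_mult) auto
          finally show ?thesis using True by simp
        qed simp
      qed
      also have "\<dots> = 2 * (\<integral>\<^sup>+t. ennreal (norm (p t) * (ln (2 / t))\<^sup>2) * indicator {0<..1} t \<partial>lborel)"
        by (rule nn_integral_cmult) measurable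
      also have "\<dots> < \<infinity>" using W1 by (simp add: ennreal_mult_less_top)
      finally show "(\<integral>\<^sup>+t. ennreal (norm (?q t) * (1 * ln (1 / t))) * indicator {0<..1} t \<partial>lborel) < \<infinity>" .
    qed (auto simp: sin_diff)
    moreover have "(\<integral>\<^sup>+u. ennreal (norm (trig_transform sin ?q u)) * ennreal (1 / u) * indicator {4..} u \<partial>lborel)
      \<le> (\<integral>\<^sup>+u. ennreal (norm (trig_transform sin ?q u)) * ennreal (1 / u) * indicator {pi..} u \<partial>lborel)"
      using pi_less_4 by (intro nn_integral_mono mult_left_mono) (auto simp: indicator_def)
    ultimately show "(\<integral>\<^sup>+u. ennreal (norm (trig_transform sin ?q u)) * ennreal (1 / u) * indicator {4..} u \<partial>lborel) < \<infinity>"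
      by (rule le_less_trans[rotated])
  qed
qed

section \<open>Functions of the maximum of the coordinates\<close>

lemma Basis_real2: "(Basis :: (real^2) set) = {axis 1 1, axis 2 1}" "axis 1 1 \<noteq> (axis 2 1 :: real^2)"
  by (auto simp: Basis_vec_def UNIV_2 axis_eq_axis)

lemma prod_Basis_real2: "(\<Prod>b\<in>(Basis :: (real^2) set). h b (x \<bullet> b)) = h (axis 1 1) (x $ 1) * h (axis 2 1) (x $ 2)"
  using Basis_real2(2) by (simp add: Basis_real2(1) inner_axis)

lemma lborel_real2:
  "(lborel :: (real^2) measure) = distr (lborel \<Otimes>\<^sub>M lborel) borel (\<lambda>z. fst z *\<^sub>R axis 1 1 + snd z *\<^sub>R axis 2 1)"
proof (rule lborel_eqI)
  fix l u :: "real^2"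
  let ?T = "\<lambda>z::real \<times> real. fst z *\<^sub>R axis 1 1 + snd z *\<^sub>R (axis 2 1 :: real^2)"
  assume le: "\<And>b. b \<in> Basis \<Longrightarrow> l \<bullet> b \<le> u \<bullet> b"
  have le': "l $ 1 \<le> u $ 1" "l $ 2 \<le> u $ 2"
    using le[of "axis 1 1"] le[of "axis 2 1"] by (auto simp: Basis_real2 inner_axis)
  have T: "?T \<in> measurable (lborel \<Otimes>\<^sub>M lborel) borel" by measurable
  have axis0: "axis (2::2) 1 $ 1 = (0::real)" "axis (1::2) 1 $ 2 = (0::real)" by (simp_all add: axis_def)
  have "emeasure (distr (lborel \<Otimes>\<^sub>M lborel) borel ?T) (box l u) = emeasure (lborel \<Otimes>\<^sub>M lborel) (?T -` box l u \<inter> space (lborel \<Otimes>\<^sub>M lborel))"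
    by (rule emeasure_distr[OF T]) simp
  also have "?T -` box l u \<inter> space (lborel \<Otimes>\<^sub>M lborel) = box (l $ 1) (u $ 1) \<times> box (l $ 2) (u $ 2)"
    by (auto simp: mem_box Basis_real2(1) inner_axis axis0 space_pair_measure)
  also have "emeasure (lborel \<Otimes>\<^sub>M lborel) (box (l $ 1) (u $ 1) \<times> box (l $ 2) (u $ 2))
    = ennreal (u $ 1 - l $ 1) * ennreal (u $ 2 - l $ 2)"
    using le' by (subst lborel.emeasure_pair_measure_Times) auto
  also have "\<dots> = (\<Prod>b\<in>Basis. (u - l) \<bullet> b)"
    using le' Basis_real2(2) by (simp add: Basis_real2(1) inner_axis ennreal_mult)
  finally show "emeasure (distr (lborel \<Otimes>\<^sub>M lborel) borel ?T) (box l u) = (\<Prod>b\<in>Basis. (u - l) \<bullet> b)" .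
qed simp

lemma nn_integral_real2:
  assumes h: "(\<lambda>z. h (fst z) (snd z)) \<in> borel_measurable (borel \<Otimes>\<^sub>M borel)"
  shows "(\<integral>\<^sup>+y. h (y $ 1) (y $ 2) \<partial>(lborel :: (real^2) measure)) = (\<integral>\<^sup>+b. \<integral>\<^sup>+a. h a b \<partial>lborel \<partial>lborel)"
proof -
  let ?T = "\<lambda>z::real \<times> real. fst z *\<^sub>R axis 1 1 + snd z *\<^sub>R (axis 2 1 :: real^2)"
  have comp: "?T z $ 1 = fst z" "?T z $ 2 = snd z" for z by (simp_all add: axis_def)
  have h2: "(\<lambda>y::real^2. h (y $ 1) (y $ 2)) \<in> borel_measurable borel"
    using measurable_compose[OF _ h, of "\<lambda>y::real^2. (y $ 1, y $ 2)" borel] by simp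
  have "(\<integral>\<^sup>+y. h (y $ 1) (y $ 2) \<partial>(lborel :: (real^2) measure)) = (\<integral>\<^sup>+z. h (?T z $ 1) (?T z $ 2) \<partial>(lborel \<Otimes>\<^sub>M lborel))"
    by (subst lborel_real2, subst nn_integral_distr) (use h2 in auto)
  also have "\<dots> = (\<integral>\<^sup>+z. h (fst z) (snd z) \<partial>(lborel \<Otimes>\<^sub>M lborel))" unfolding comp ..
  also have "\<dots> = (\<integral>\<^sup>+b. \<integral>\<^sup>+a. h a b \<partial>lborel \<partial>lborel)"
    using h lborel_pair.nn_integral_snd[of "\<lambda>z. h (fst z) (snd z)"] by simp
  finally show ?thesis .
qed

lemma integral_exp_Icc:
  fixes c t :: real
  assumes "c \<noteq> 0" "t \<ge> 0"
  shows "(LINT s|lborel. indicator {- t..t} s *\<^sub>R exp (\<i> * complex_of_real (s * c))) = complex_of_real (2 * sin (t * c) / c)"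
proof -
  have der: "((\<lambda>s. exp (\<i> * complex_of_real (s * c)) / (\<i> * complex_of_real c)) has_vector_derivative exp (\<i> * complex_of_real (s * c))) (at s within A)" for s A
  proof -
    have "((\<lambda>z. exp (\<i> * (z * complex_of_real c)) / (\<i> * complex_of_real c)) has_field_derivative exp (\<i> * (complex_of_real s * complex_of_real c))) (at (complex_of_real s))"
      using assms by (auto intro!: derivative_eq_intros simp: complex_eq_iff)
    from has_vector_derivative_real_field[OF this, of A] show ?thesis by simp
  qed
  have "(LINT s|lborel. indicator {- t..t} s *\<^sub>R exp (\<i> * complex_of_real (s * c)))
     = exp (\<i> * complex_of_real (t * c)) / (\<i> * complex_of_real c) - exp (\<i> * complex_of_real (- t * c)) / (\<i> * complex_of_real c)"
    using assms by (intro integral_FTC_Icc der continuous_intros) auto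
  also have "\<dots> = (exp (\<i> * complex_of_real (t * c)) - exp (\<i> * complex_of_real (- t * c))) / (\<i> * complex_of_real c)"
    by (rule diff_divide_distrib[symmetric])
  also have "exp (\<i> * complex_of_real (t * c)) - exp (\<i> * complex_of_real (- t * c)) = 2 * \<i> * complex_of_real (sin (t * c))"
    by (simp add: complex_eq_iff Re_exp Im_exp)
  also have "2 * \<i> * complex_of_real (sin (t * c)) / (\<i> * complex_of_real c) = complex_of_real (2 * sin (t * c) / c)"
    using assms by (simp add: field_simps)
  finally show ?thesis .
qed

lemma fourier_square:
  fixes y :: "real^2"
  assumes y: "y $ 1 \<noteq> 0" "y $ 2 \<noteq> 0" and t: "t \<ge> 0"
  shows "(LINT u|lborel. of_bool (max \<bar>u $ 1\<bar> \<bar>u $ 2\<bar> \<le> t) * exp (\<i> * complex_of_real (u \<bullet> y)))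
    = complex_of_real ((2 * sin (t * y $ 1) / y $ 1) * (2 * sin (t * y $ 2) / y $ 2))"
proof -
  let ?h = "\<lambda>(b::real^2) s. indicator {- t..t} s *\<^sub>R exp (\<i> * complex_of_real (s * (y \<bullet> b)))"
  have int: "integrable lborel (?h b)" for b
    by (rule borel_integrable_compact) (auto intro!: continuous_intros)
  have eq: "of_bool (max \<bar>u $ 1\<bar> \<bar>u $ 2\<bar> \<le> t) * exp (\<i> * complex_of_real (u \<bullet> y)) = (\<Prod>b\<in>Basis. ?h b (u \<bullet> b))" for u
  proof -
    have "(\<Prod>b\<in>Basis. ?h b (u \<bullet> b)) = (\<Prod>b\<in>Basis. indicator {- t..t} (u \<bullet> b)) * exp (\<i> * complex_of_real (u \<bullet> y))"
    proof -
      have "complex_of_real (indicator A x) = indicator A x" for A and x :: real by (simp add: indicator_def)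
      then show ?thesis unfolding exp_inner_eq_prod by (simp add: scaleR_conv_of_real prod.distrib)
    qed
    also have "(\<Prod>b\<in>Basis. indicator {- t..t} (u \<bullet> b)) = (of_bool (max \<bar>u $ 1\<bar> \<bar>u $ 2\<bar> \<le> t) :: complex)"
      unfolding prod_Basis_real2[of "\<lambda>_. indicator {- t..t}"] by (auto simp: indicator_def abs_le_iff)
    finally show ?thesis by simp
  qed
  have "(LINT u|lborel. of_bool (max \<bar>u $ 1\<bar> \<bar>u $ 2\<bar> \<le> t) * exp (\<i> * complex_of_real (u \<bullet> y))) = (\<Prod>b\<in>Basis. LINT s|lborel. ?h b s)"
    unfolding eq by (rule lborel_prod_Basis(2)[OF int])
  also have "\<dots> = (LINT s|lborel. ?h (axis 1 1) s) * (LINT s|lborel. ?h (axis 2 1) s)"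
    using Basis_real2(2) by (simp add: Basis_real2(1))
  also have "\<dots> = complex_of_real (2 * sin (t * y $ 1) / y $ 1) * complex_of_real (2 * sin (t * y $ 2) / y $ 2)"
    using integral_exp_Icc[OF y(1) t] integral_exp_Icc[OF y(2) t] by (simp only: inner_axis) simp
  finally show ?thesis by simp
qed

text \<open>The modulus ignores changes on null sets, and translates of null sets are null.\<close>

lemma shift_variation_le_L1_modulus:
  assumes ae: "AE t in lborel. t > 0 \<longrightarrow> p t = f t" and h: "h > 0"
  shows "shift_variation p h \<le> L1_modulus f h"
proof -
  obtain N where N: "{t \<in> space lborel. \<not> (t > 0 \<longrightarrow> p t = f t)} \<subseteq> N" "emeasure lborel N = 0" "N \<in> sets lborel"
    using ae by (rule AE_E)
  have N1: "AE t in lborel. t \<notin> N" using N by (intro AE_not_in) auto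
  have "AE t in lborel. h + 1 * t \<notin> N"
    by (rule AE_borel_affine[of 1 "\<lambda>x. x \<notin> N" h]) (use N(3) N1 in auto)
  with N1 AE_lborel_singleton[of "0::real"]
  have "AE t in lborel. ennreal (norm (p t - p (t + h))) * indicator {0..} t = ennreal (norm (f t - f (t + h))) * indicator {0..} t"
  proof eventually_elim
    case (elim t)
    show ?case
    proof (cases "t > 0")
      case True
      have "p s = f s" if "s \<notin> N" "s > 0" for s using N(1) that by auto
      with True elim h have "p t = f t" "p (t + h) = f (t + h)" by (simp_all add: add.commute[of h])
      then show ?thesis by simp
    qed (use elim in auto)
  qed
  then have "shift_variation p h = (\<integral>\<^sup>+t\<in>{0..}. ennreal (norm (f t - f (t + h))) \<partial>lebesgue)"
    unfolding shift_variation_def nn_integral_completion by (rule nn_integral_cong_AE)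
  also have "\<dots> \<le> L1_modulus f h"
    unfolding L1_modulus_def using h by (intro SUP_upper) auto
  finally show ?thesis .
qed

definition tail :: "(real \<Rightarrow> complex) \<Rightarrow> real \<Rightarrow> complex" where
  "tail p r = (LINT t|lborel. p t * of_bool (r \<le> t))"

lemma norm_tail_le:
  assumes "integrable lborel p"
  shows "norm (tail p r) \<le> (LINT t|lborel. norm (p t))"
  unfolding tail_def using assms
  by (intro order_trans[OF integral_norm_bound] integral_mono_AE' AE_I2) (auto simp: norm_mult integrable_norm)

lemma tail_diff:
  assumes p: "integrable lborel p" and ab: "a \<le> b"
  shows "tail p a - tail p b = (LINT t:{a..b}|lborel. p t)"
proof -
  have [measurable]: "p \<in> borel_measurable borel" using borel_measurable_integrable[OF p] by simp
  have int: "integrable lborel (\<lambda>t. p t * of_bool (r \<le> t))" for r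
    by (rule Bochner_Integration.integrable_bound[OF p]) (auto simp: norm_mult)
  have "tail p a - tail p b = (LINT t|lborel. p t * of_bool (a \<le> t) - p t * of_bool (b \<le> t))"
    unfolding tail_def by (rule Bochner_Integration.integral_diff[symmetric]; rule int)
  also have "\<dots> = (LINT t:{a..b}|lborel. p t)"
    unfolding set_lebesgue_integral_def
  proof (rule integral_cong_AE)
    show "AE t in lborel. p t * of_bool (a \<le> t) - p t * of_bool (b \<le> t) = indicator {a..b} t *\<^sub>R p t"
      using AE_lborel_singleton[of b] by eventually_elim (use ab in \<open>auto simp: indicator_def\<close>)
  qed measurable
  finally show ?thesis .
qed

text \<open>The function is a superposition of indicators of squares, and the Fourier transform of such an
  indicator is a product of two sine quotients. The squares have area \<open>4 t\<^sup>2\<close>, so integrability of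
  \<open>t\<^sup>2 p t\<close> is exactly what Fubini needs.\<close>

lemma
  fixes p :: "real \<Rightarrow> complex" and y :: "real^2"
  assumes p: "integrable lborel p" and p2: "integrable lborel (\<lambda>t. t\<^sup>2 *\<^sub>R p t)" and p0: "\<And>t. t \<le> 0 \<Longrightarrow> p t = 0"
  shows integrable_tail_max: "integrable lborel (\<lambda>u::real^2. tail p (max \<bar>u $ 1\<bar> \<bar>u $ 2\<bar>))"
    and fourier_tail_max: "y $ 1 \<noteq> 0 \<Longrightarrow> y $ 2 \<noteq> 0 \<Longrightarrow>
      (LINT u|lborel. tail p (max \<bar>u $ 1\<bar> \<bar>u $ 2\<bar>) * exp (\<i> * complex_of_real (u \<bullet> y))) = square_kernel p (y $ 1) (y $ 2)"
proof -
  have [measurable]: "p \<in> borel_measurable borel" using borel_measurable_integrable[OF p] by simp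
  let ?m = "\<lambda>u::real^2. max \<bar>u $ 1\<bar> \<bar>u $ 2\<bar>"
  let ?k = "\<lambda>y t u. p t * (of_bool (?m u \<le> t) * exp (\<i> * complex_of_real (u \<bullet> y)))"
  have box: "of_bool (?m u \<le> t) = (indicator (cbox (\<chi> i. - t) (\<chi> i. t)) u :: real)" for u t
    by (auto simp: indicator_def mem_box_cart forall_2 abs_le_iff)
  have box_int: "integrable lborel (\<lambda>u. of_bool (?m u \<le> t) :: real)" for t
    unfolding box by (intro integrable_real_indicator emeasure_bounded_finite bounded_cbox) auto
  have box_val: "(LINT u|lborel. of_bool (?m u \<le> t)) = (4 * t\<^sup>2 :: real)" if "t \<ge> 0" for t
    unfolding box using that by (simp add: content_cbox_if_cart interval_eq_empty_cart UNIV_2 power2_eq_square)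
  have k_norm: "norm (?k y t u) = norm (p t) * of_bool (?m u \<le> t)" for y t u
    by (simp only: norm_mult norm_exp_i_times mult_1_right) simp
  have k_meas: "(\<lambda>(t, u). ?k y t u) \<in> borel_measurable (lborel \<Otimes>\<^sub>M lborel)" for y
  proof -
    define m where "m = ?m"
    have [measurable]: "m \<in> borel_measurable borel"
      unfolding m_def by (intro borel_measurable_continuous_onI continuous_intros)
    have "(\<lambda>z. p (fst z) * ((if m (snd z) \<le> fst z then 1 else 0) * exp (\<i> * complex_of_real (snd z \<bullet> y))))
      \<in> borel_measurable (lborel \<Otimes>\<^sub>M lborel)"
      by measurable
    then show ?thesis by (simp only: case_prod_unfold of_bool_def m_def)
  qed
  have k_int: "integrable (lborel \<Otimes>\<^sub>M lborel) (\<lambda>(t, u). ?k y t u)" for y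
  proof (rule lborel_pair.Fubini_integrable[OF k_meas])
    have "(LINT u|lborel. norm (case (t, u) of (t, u) \<Rightarrow> ?k y t u)) = 4 * norm (t\<^sup>2 *\<^sub>R p t)" for t
    proof (cases "t \<ge> 0")
      case True
      then show ?thesis by (simp only: prod.case k_norm integral_mult_right_zero box_val) simp
    qed (use p0 in simp)
    then show "integrable lborel (\<lambda>t. LINT u|lborel. norm (case (t, u) of (t, u) \<Rightarrow> ?k y t u))"
      using integrable_norm[OF p2] by (simp only: integrable_mult_right)
    have "integrable lborel (\<lambda>u. ?k y t u)" for t
    proof (rule Bochner_Integration.integrable_bound[of _ "\<lambda>u. norm (p t) * of_bool (?m u \<le> t)"])
      show "integrable lborel (\<lambda>u. norm (p t) * of_bool (?m u \<le> t))"
        using box_int by (rule integrable_mult_right)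
      show "AE u in lborel. norm (?k y t u) \<le> norm (norm (p t) * of_bool (?m u \<le> t))"
        unfolding k_norm by (intro AE_I2) simp
    qed measurable
    then show "AE t in lborel. integrable lborel (\<lambda>u. case (t, u) of (t, u) \<Rightarrow> ?k y t u)" by simp
  qed
  have k_tail: "(LINT t|lborel. ?k y t u) = tail p (?m u) * exp (\<i> * complex_of_real (u \<bullet> y))" for y u
    unfolding tail_def mult.assoc[symmetric] by (rule integral_mult_left_zero)
  show "integrable lborel (\<lambda>u. tail p (?m u))"
    using lborel_pair.integrable_snd[OF k_int, of 0] unfolding k_tail by simp
  assume y: "y $ 1 \<noteq> 0" "y $ 2 \<noteq> 0"
  have "(LINT u|lborel. tail p (?m u) * exp (\<i> * complex_of_real (u \<bullet> y))) = (LINT u|lborel. LINT t|lborel. ?k y t u)"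
    unfolding k_tail ..
  also have "\<dots> = (LINT t|lborel. LINT u|lborel. ?k y t u)"
    by (rule lborel_pair.Fubini_integral[OF k_int])
  also have "\<dots> = square_kernel p (y $ 1) (y $ 2)"
    unfolding square_kernel_def
  proof (rule Bochner_Integration.integral_cong[OF refl])
    fix t
    show "(LINT u|lborel. ?k y t u) = p t * complex_of_real ((2 * sin (t * y $ 1) / y $ 1) * (2 * sin (t * y $ 2) / y $ 2))"
    proof (cases "t \<ge> 0")
      case True
      then show ?thesis by (subst integral_mult_right_zero) (simp only: fourier_square[OF y True])
    qed (use p0 in simp)
  qed
  finally show "(LINT u|lborel. tail p (?m u) * exp (\<i> * complex_of_real (u \<bullet> y))) = square_kernel p (y $ 1) (y $ 2)" .
qed

text \<open>By the fundamental theorem, \<open>f0 + tail p\<close> is constant on the positive half-line. The constant is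
  integrable over the plane, because \<open>f\<close> and the tail are, and so it is 0.\<close>

lemma tail_max_representation:
  fixes f0 :: "real \<Rightarrow> complex" and f :: "real ^ 2 \<Rightarrow> complex"
  assumes f_def: "\<And>x. f x = f0 (max \<bar>x $ 1\<bar> \<bar>x $ 2\<bar>)" and f_int: "integrable lborel f"
    and p: "integrable lborel p" and p2: "integrable lborel (\<lambda>t. t\<^sup>2 *\<^sub>R p t)" and p0: "\<And>t. t \<le> 0 \<Longrightarrow> p t = 0"
    and ftc: "\<And>a b. 0 < a \<Longrightarrow> a \<le> b \<Longrightarrow> f0 b - f0 a = (LINT t:{a..b}|lborel. p t)"
    and x: "x \<noteq> 0"
  shows "f x = - tail p (max \<bar>x $ 1\<bar> \<bar>x $ 2\<bar>)"
proof -
  define c where "c = f0 1 + tail p 1"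
  have const: "f0 r + tail p r = c" if r: "r > 0" for r
  proof (cases "r \<le> 1")
    case True
    show ?thesis using ftc[OF r True] tail_diff[OF p True] by (simp add: c_def algebra_simps)
  next
    case False
    then have "1 \<le> r" by simp
    show ?thesis using ftc[OF zero_less_one \<open>1 \<le> r\<close>] tail_diff[OF p \<open>1 \<le> r\<close>] by (simp add: c_def algebra_simps)
  qed
  have m_pos: "max \<bar>u $ 1\<bar> \<bar>u $ 2\<bar> > 0" if "u \<noteq> 0" for u :: "real^2"
    using that by (auto simp: vec_eq_iff forall_2)
  have f_tail: "f u + tail p (max \<bar>u $ 1\<bar> \<bar>u $ 2\<bar>) = c" if "u \<noteq> 0" for u
    unfolding f_def by (rule const[OF m_pos[OF that]])
  have int: "integrable lborel (\<lambda>u. f u + tail p (max \<bar>u $ 1\<bar> \<bar>u $ 2\<bar>))"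
    using f_int integrable_tail_max[OF p p2 p0] by (rule Bochner_Integration.integrable_add)
  moreover have "AE u in lborel. f u + tail p (max \<bar>u $ 1\<bar> \<bar>u $ 2\<bar>) = c"
    using AE_lborel_singleton[of "0 :: real^2"] by eventually_elim (rule f_tail)
  ultimately have "integrable lborel (\<lambda>u::real^2. c)"
    using integrable_cong_AE[OF borel_measurable_integrable[OF int], of "\<lambda>_. c"] by simp
  then have "(\<integral>\<^sup>+u. ennreal (norm c) \<partial>(lborel :: (real^2) measure)) < \<infinity>"
    by (simp add: integrable_iff_bounded del: nn_integral_const)
  then have "c = 0" by (auto simp: ennreal_mult_less_top ennreal_top_mult)
  then show ?thesis using f_tail[OF x] by (simp add: add_eq_0_iff2)
qed

theorem mainTheorem3:
  fixes f0 :: "real \<Rightarrow> complex" and f :: "real ^ 2 \<Rightarrow> complex"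
    and f0' f1' :: "real \<Rightarrow> complex"
  assumes f_def: "\<And>x. f x = f0 (max \<bar>x $ 1\<bar> \<bar>x $ 2\<bar>)"
    and f_cont: "continuous_on UNIV f"
    and f_int: "integrable lebesgue f"
    and f0_ac: "AC_loc_pos f0"
    and f0'_def: "\<And>t. t > 0 \<Longrightarrow> f0' t = vector_derivative f0 (at t)"
    and f1'_def: "\<And>t. t > 0 \<Longrightarrow> f1' t = t *\<^sub>R f0' t"
    and weighted: "(\<integral>\<^sup>+t\<in>{0<..1}. ennreal (norm (f0' t) * (ln (2 / t))\<^sup>2) \<partial>lebesgue)
      + (\<integral>\<^sup>+t\<in>{1..}. ennreal (t\<^sup>2 * norm (f0' t)) \<partial>lebesgue) < \<infinity>"
    and moduli: "(\<integral>\<^sup>+t\<in>{0<..1}. L1_modulus f0' t * ennreal (ln (2 / t) / t) \<partial>lebesgue)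
      + (\<integral>\<^sup>+t\<in>{0<..1}. L1_modulus f1' t * ennreal (1 / t) \<partial>lebesgue) < \<infinity>"
  shows "f \<in> wiener_algebra"
proof -
  have f0_cont: "continuous_on {0..} f0"
  proof -
    have "continuous_on {0..} (\<lambda>r. f (r *\<^sub>R axis 1 1))"
      by (intro continuous_on_compose2[OF f_cont] continuous_intros) auto
    moreover have "f (r *\<^sub>R axis 1 1) = f0 r" if "r \<in> {0..}" for r
      using that by (simp add: f_def) (simp add: axis_def)
    ultimately show ?thesis by (subst (asm) continuous_on_cong[OF refl, where g = f0]) auto
  qed
  obtain p where p_meas: "p \<in> borel_measurable borel" and p0: "\<And>t. t \<le> 0 \<Longrightarrow> p t = 0"
    and p_ae: "AE t in lborel. t > 0 \<longrightarrow> p t = vector_derivative f0 (at t)"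
    and p_ftc: "\<And>a b. 0 < a \<Longrightarrow> a \<le> b \<Longrightarrow> f0 b - f0 a = (LINT t:{a..b}|lborel. p t)"
    using AC_loc_pos_derivative[OF f0_ac f0_cont] by metis
  let ?q = "\<lambda>t. t *\<^sub>R p t"
  have ae0: "AE t in lborel. t > 0 \<longrightarrow> p t = f0' t"
    using p_ae by eventually_elim (simp add: f0'_def)
  have ae1: "AE t in lborel. t > 0 \<longrightarrow> ?q t = f1' t"
    using ae0 by eventually_elim (simp add: f1'_def)
  have W1: "(\<integral>\<^sup>+t. ennreal (norm (p t) * (ln (2 / t))\<^sup>2) * indicator {0<..1} t \<partial>lborel) < \<infinity>"
  proof -
    have "(\<integral>\<^sup>+t. ennreal (norm (p t) * (ln (2 / t))\<^sup>2) * indicator {0<..1} t \<partial>lborel)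
      = (\<integral>\<^sup>+t\<in>{0<..1}. ennreal (norm (f0' t) * (ln (2 / t))\<^sup>2) \<partial>lebesgue)"
      unfolding nn_integral_completion
      by (rule nn_integral_cong_AE) (use ae0 in eventually_elim, auto simp: indicator_def)
    also have "\<dots> < \<infinity>" using weighted by (simp add: ennreal_add_less_top)
    finally show ?thesis .
  qed
  have W2: "(\<integral>\<^sup>+t. ennreal (t\<^sup>2 * norm (p t)) * indicator {1..} t \<partial>lborel) < \<infinity>"
  proof -
    have "(\<integral>\<^sup>+t. ennreal (t\<^sup>2 * norm (p t)) * indicator {1..} t \<partial>lborel)
      = (\<integral>\<^sup>+t\<in>{1..}. ennreal (t\<^sup>2 * norm (f0' t)) \<partial>lebesgue)"
      unfolding nn_integral_completion
      by (rule nn_integral_cong_AE) (use ae0 in eventually_elim, auto simp: indicator_def)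
    also have "\<dots> < \<infinity>" using weighted by (simp add: ennreal_add_less_top)
    finally show ?thesis .
  qed
  have M1: "(\<integral>\<^sup>+h. shift_variation p h * ennreal (ln (2 / h) / h) * indicator {0<..1} h \<partial>lborel) < \<infinity>"
  proof -
    have "(\<integral>\<^sup>+h. shift_variation p h * ennreal (ln (2 / h) / h) * indicator {0<..1} h \<partial>lborel)
      \<le> (\<integral>\<^sup>+t\<in>{0<..1}. L1_modulus f0' t * ennreal (ln (2 / t) / t) \<partial>lebesgue)"
      unfolding nn_integral_completion using shift_variation_le_L1_modulus[OF ae0]
      by (intro nn_integral_mono) (auto simp: indicator_def intro!: mult_right_mono)
    also have "\<dots> < \<infinity>" using moduli by (simp add: ennreal_add_less_top)
    finally show ?thesis .
  qed
  have M2: "(\<integral>\<^sup>+h. shift_variation ?q h * ennreal (1 / h) * indicator {0<..1} h \<partial>lborel) < \<infinity>"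
  proof -
    have "(\<integral>\<^sup>+h. shift_variation ?q h * ennreal (1 / h) * indicator {0<..1} h \<partial>lborel)
      \<le> (\<integral>\<^sup>+t\<in>{0<..1}. L1_modulus f1' t * ennreal (1 / t) \<partial>lebesgue)"
      unfolding nn_integral_completion using shift_variation_le_L1_modulus[OF ae1]
      by (intro nn_integral_mono) (auto simp: indicator_def intro!: mult_right_mono)
    also have "\<dots> < \<infinity>" using moduli by (simp add: ennreal_add_less_top)
    finally show ?thesis .
  qed
  note core = square_kernel_integrable_of_moduli[OF p_meas p0 W1 W2 M1 M2]
  have f_meas: "f \<in> borel_measurable borel" using f_cont by (rule borel_measurable_continuous_onI)
  note [measurable] = f_meas p_meas
  have f_int': "integrable lborel f" using f_int by (subst (asm) integrable_completion) auto
  let ?m = "\<lambda>u::real^2. max \<bar>u $ 1\<bar> \<bar>u $ 2\<bar>"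
  have f_tail: "f x = - tail p (?m x)" if "x \<noteq> 0" for x
    by (rule tail_max_representation[OF f_def f_int' core(1,2) p0 p_ftc that])
  have f_ae: "AE u in lborel. f u = - tail p (?m u)"
    using AE_lborel_singleton[of "0 :: real^2"] by eventually_elim (rule f_tail)
  have bdd: "norm (f x) \<le> max (norm (f 0)) (LINT t|lborel. norm (p t))" for x
    using f_tail[of x] norm_tail_le[OF core(1), of "?m x"] by (cases "x = 0") auto
  \<comment> \<open>The sign is positive here because the representation in the Wiener algebra, which plays the
    part of the inverse transform, has the negative sign.\<close>
  define ft where "ft y = (LINT u|lborel. f u * exp (\<i> * complex_of_real (u \<bullet> y)))" for y :: "real^2"
  have ft_meas [measurable]: "ft \<in> borel_measurable borel"
    unfolding ft_def by measurable
  have ft_eq: "ft y = - square_kernel p (y $ 1) (y $ 2)" if y: "y $ 1 \<noteq> 0" "y $ 2 \<noteq> 0" for y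
  proof -
    have tail_meas: "(\<lambda>u. tail p (?m u)) \<in> borel_measurable lborel"
      using integrable_tail_max[OF core(1,2) p0] by (rule borel_measurable_integrable)
    have "ft y = (LINT u|lborel. - (tail p (?m u) * exp (\<i> * complex_of_real (u \<bullet> y))))"
      unfolding ft_def
    proof (rule integral_cong_AE)
      show "AE u in lborel. f u * exp (\<i> * complex_of_real (u \<bullet> y)) = - (tail p (?m u) * exp (\<i> * complex_of_real (u \<bullet> y)))"
        using f_ae by eventually_elim simp
      show "(\<lambda>u. - (tail p (?m u) * exp (\<i> * complex_of_real (u \<bullet> y)))) \<in> borel_measurable lborel"
        using tail_meas by measurable
    qed measurable
    also have "\<dots> = - square_kernel p (y $ 1) (y $ 2)"
      using fourier_tail_max[OF core(1,2) p0 y] by simp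
    finally show ?thesis .
  qed
  have coord: "AE y in lborel. (y::real^2) $ i \<noteq> 0" for i
  proof -
    have "negligible {y::real^2. y \<bullet> axis i 1 = 0}"
      by (rule negligible_standard_hyperplane) (auto simp: Basis_vec_def)
    then have "AE y in lebesgue. y \<notin> {y::real^2. y \<bullet> axis i 1 = 0}"
      by (intro AE_not_in) (simp add: negligible_iff_null_sets)
    then show ?thesis by (simp add: AE_completion_iff inner_axis)
  qed
  have ft_int: "integrable lborel ft"
  proof (rule integrableI_bounded)
    have "(\<integral>\<^sup>+y. ennreal (norm (ft y)) \<partial>lborel) = (\<integral>\<^sup>+y. ennreal (norm (square_kernel p (y $ 1) (y $ 2))) \<partial>(lborel :: (real^2) measure))"
      by (rule nn_integral_cong_AE) (use coord[of 1] coord[of 2] in eventually_elim, simp add: ft_eq)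
    also have "\<dots> = (\<integral>\<^sup>+b. \<integral>\<^sup>+a. ennreal (norm (square_kernel p a b)) \<partial>lborel \<partial>lborel)"
      by (rule nn_integral_real2) measurable
    also have "\<dots> < \<infinity>" by (rule core(3))
    finally show "(\<integral>\<^sup>+y. ennreal (norm (ft y)) \<partial>lborel) < \<infinity>" .
  qed simp
  let ?g = "\<lambda>y. ft y / complex_of_real ((2 * pi) ^ DIM(real^2))"
  have "integrable lebesgue ?g"
    using ft_int by (subst integrable_completion) auto
  moreover have "f x = (\<integral>y. ?g y * exp (- \<i> * complex_of_real (x \<bullet> y)) \<partial>lebesgue)" for x
  proof -
    have "(\<integral>y. ?g y * exp (- \<i> * complex_of_real (x \<bullet> y)) \<partial>lebesgue)
      = (LINT y|lborel. ft y * exp (- \<i> * complex_of_real (x \<bullet> y)) / complex_of_real ((2 * pi) ^ DIM(real^2)))"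
      by (subst integral_completion) auto
    also have "\<dots> = f x"
      using fourier_inversion[OF f_cont f_int' bdd ft_def ft_int, of x] by simp
    finally show ?thesis ..
  qed
  ultimately show ?thesis unfolding wiener_algebra_def by blast
qed

end
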